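(* Let $d\in[1,+\infty]$ and let $G:\mathbb{D}\times[0,+\infty)\to\mathbb{C}$ be a Herglotz vector field of order $d$. Then: (i) For every $z\in\mathbb{D}$ there exists a unique maximal solution $w(t)=w_z(t)\in\mathbb{D}$ to the initial value problem $$\frac{dw}{dt}=-G(w,t),\qquad w(0)=z.$$ (Maximal, or non-extendable, means that there are no solutions $[0,T)\ni t\mapsto\tilde w_z(t)\in\mathbb{D}$ to this initial value problem, with $T\in(0,+\infty]$, such that $w_z$ is the restriction of $\tilde w_z$ to a proper subset of $[0,T)$.) (ii) For every $t\ge0$, the set $\Omega_t$ of all $z\in\mathbb{D}$ for which $w_z$ is defined at the point $t$ is a simply connected domain, and the function $g_t:\Omega_t\to\mathbb{D}$ defined by $g_t(z):=w_z(t)$ for all $z\in\Omega_t$ maps $\Omega_t$ conformally onto $\mathbb{D}$. (iii) The functions $f_t:=g_t^{-1}:\mathbb{D}\to\Omega_t$, $t\ge0$, form a decreasing Loewner chain of order $d$, and $(z,t)\mapsto f_t(z)$ is the unique solution (on $\mathbb{D}\times[0,+\infty)$) to the initial value problem $$\frac{\partial f_t(z)}{\partial t}=\frac{\partial f_t(z)}{\partial z}\,G(z,t),\qquad f_0=\mathrm{id}_{\mathbb{D}}.$$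
   Context: $\mathbb{D}=\{z\in\mathbb{C}:|z|<1\}$; $\mathrm{Hol}(\mathbb{D},\mathbb{D})$ is the set of holomorphic self-maps of $\mathbb{D}$. A null-set is a set of Lebesgue measure zero. Infinitesimal generator: a one-parametric semigroup in $\mathrm{Hol}(\mathbb{D},\mathbb{D})$ is a family $(\phi_t)_{t\ge0}$ of holomorphic self-maps of $\mathbb{D}$ with $\phi_0=\mathrm{id}_{\mathbb{D}}$, $\phi_t\circ\phi_s=\phi_{t+s}$ for all $s,t\ge0$, and $\phi_t(z)\to z$ as $t\to0^+$ for all $z\in\mathbb{D}$. Its infinitesimal generator is the holomorphic function $H:\mathbb{D}\to\mathbb{C}$ such that for each $z\in\mathbb{D}$ the function $t\mapsto\phi_t(z)$ solves $dw/dt=H(w)$, $w(0)=z$. Herglotz vector field of order $d$: a function $G:\mathbb{D}\times[0,+\infty)\to\mathbb{C}$ such that (1) for all $z\in\mathbb{D}$ the function $t\mapsto G(z,t)$ is measurable on $[0,+\infty)$; (2) for all $t\ge0$ the function $z\mapsto G(z,t)$ is holomorphic in $\mathbb{D}$; (3) for any compact set $K\subset\mathbb{D}$ and any $T>0$ there exists a non-negative function $k_{K,T}\in L^d([0,T],\mathbb{R})$ such that $|G(z,t)|\le k_{K,T}(t)$ for all $z\in K$ and a.e. $t\in[0,T]$; (4) for a.e. $t\ge0$ the function $G(\cdot,t)$ is the infinitesimal generator of a one-parametric semigroup in $\mathrm{Hol}(\mathbb{D},\mathbb{D})$. The ODE is understood in the sense of Carathéodory: solutions are locally absolutely continuous functions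 on an interval, with values in $\mathbb{D}$, satisfying the equation almost everywhere. Solution to the PDE $\partial F/\partial t=(\partial F/\partial z)\,G(z,t)$: a function $F:\mathbb{D}\times E\to\mathbb{C}$, where $E\subset[0,+\infty)$ is an interval, such that $F$ is continuous in $\mathbb{D}\times E$; $F(\cdot,t)$ is holomorphic in $\mathbb{D}$ for every $t\in E$; $F(z,\cdot)$ is locally absolutely continuous in $E$ for every $z\in\mathbb{D}$; and for every $z\in\mathbb{D}$ the equation holds for a.e. $t\in E$. Decreasing Loewner chain of order $d$: a family $(f_t)_{t\ge0}$ of holomorphic self-maps of $\mathbb{D}$ such that (DC1) each $f_t:\mathbb{D}\to\mathbb{D}$ is univalent; (DC2) $f_0=\mathrm{id}_{\mathbb{D}}$ and $f_t(\mathbb{D})\subset f_s(\mathbb{D})$ whenever $0\le s\le t$; (DC3) for any compact set $K\subset\mathbb{D}$ and all $T>0$ there exists a non-negative function $k_{K,T}\in L^d([0,T],\mathbb{R})$ such that $|f_s(z)-f_t(z)|\le\int_s^tk_{K,T}(\xi)\,d\xi$ for all $z\in K$ and all $0\le s\le t\le T$. *)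

theory Defs
  imports "HOL-Complex_Analysis.Complex_Analysis"
begin

abbreviation disc :: "complex set" where
  "disc \<equiv> ball 0 1"

definition Lp_on :: "ereal \<Rightarrow> real set \<Rightarrow> (real \<Rightarrow> real) \<Rightarrow> bool" where
  "Lp_on d S k \<longleftrightarrow>
     k \<in> borel_measurable (lebesgue_on S) \<and>
     (if d = \<infinity> then \<exists>C. AE t in lebesgue_on S. \<bar>k t\<bar> \<le> C
      else integrable (lebesgue_on S) (\<lambda>t. \<bar>k t\<bar> powr real_of_ereal d))"

definition abs_continuous_on :: "real \<Rightarrow> real \<Rightarrow> (real \<Rightarrow> complex) \<Rightarrow> bool" where
  "abs_continuous_on a b f \<longleftrightarrow>
     (\<forall>\<epsilon>>0. \<exists>\<delta>>0. \<forall>(n::nat) u v.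
        (\<forall>i<n. a \<le> u i \<and> u i \<le> v i \<and> v i \<le> b) \<and>
        disjoint_family_on (\<lambda>i. {u i<..<v i}) {..<n} \<and>
        (\<Sum>i<n. v i - u i) < \<delta> \<longrightarrow>
        (\<Sum>i<n. dist (f (u i)) (f (v i))) < \<epsilon>)"

definition loc_abs_continuous_on :: "real set \<Rightarrow> (real \<Rightarrow> complex) \<Rightarrow> bool" where
  "loc_abs_continuous_on E f \<longleftrightarrow> (\<forall>a b. a \<le> b \<and> {a..b} \<subseteq> E \<longrightarrow> abs_continuous_on a b f)"

text \<open>Families of self-maps of the disc are total functions; only their values at times
  \<open>t \<ge> 0\<close> and points of the disc are constrained.\<close>

definition one_param_semigroup :: "(real \<Rightarrow> complex \<Rightarrow> complex) \<Rightarrow> bool" where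
  "one_param_semigroup \<phi> \<longleftrightarrow>
     (\<forall>t\<ge>0. \<phi> t holomorphic_on disc \<and> \<phi> t ` disc \<subseteq> disc) \<and>
     (\<forall>z\<in>disc. \<phi> 0 z = z) \<and>
     (\<forall>s\<ge>0. \<forall>t\<ge>0. \<forall>z\<in>disc. \<phi> t (\<phi> s z) = \<phi> (t + s) z) \<and>
     (\<forall>z\<in>disc. ((\<lambda>t. \<phi> t z) \<longlongrightarrow> z) (at_right 0))"

definition generator_of :: "(complex \<Rightarrow> complex) \<Rightarrow> (real \<Rightarrow> complex \<Rightarrow> complex) \<Rightarrow> bool" where
  "generator_of H \<phi> \<longleftrightarrow>
     H holomorphic_on disc \<and>
     (\<forall>z\<in>disc. \<phi> 0 z = z \<and>
        (\<forall>t\<ge>0. ((\<lambda>s. \<phi> s z) has_vector_derivative H (\<phi> t z)) (at t within {0..})))"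

definition infinitesimal_generator :: "(complex \<Rightarrow> complex) \<Rightarrow> bool" where
  "infinitesimal_generator H \<longleftrightarrow> (\<exists>\<phi>. one_param_semigroup \<phi> \<and> generator_of H \<phi>)"

definition herglotz_vector_field :: "ereal \<Rightarrow> (complex \<Rightarrow> real \<Rightarrow> complex) \<Rightarrow> bool" where
  "herglotz_vector_field d G \<longleftrightarrow>
     (\<forall>z\<in>disc. G z \<in> borel_measurable (lebesgue_on {0..})) \<and>
     (\<forall>t\<ge>0. (\<lambda>z. G z t) holomorphic_on disc) \<and>
     (\<forall>K T. compact K \<and> K \<subseteq> disc \<and> 0 < T \<longrightarrow>
        (\<exists>k. (\<forall>t\<in>{0..T}. 0 \<le> k t) \<and> Lp_on d {0..T} k \<and>
             (AE t in lebesgue_on {0..T}. \<forall>z\<in>K. norm (G z t) \<le> k t))) \<and>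
     (AE t in lebesgue_on {0..}. infinitesimal_generator (\<lambda>z. G z t))"

text \<open>Solutions of \<open>dw/dt = V(w,t)\<close>, \<open>w(0) = z\<close> are partial functions of time:
  the interval on which a solution is defined is \<open>dom w\<close>.\<close>

definition ivp_solution ::
    "(complex \<Rightarrow> real \<Rightarrow> complex) \<Rightarrow> complex \<Rightarrow> (real \<rightharpoonup> complex) \<Rightarrow> bool" where
  "ivp_solution V z w \<longleftrightarrow>
     is_interval (dom w) \<and> dom w \<subseteq> {0..} \<and> ran w \<subseteq> disc \<and>
     loc_abs_continuous_on (dom w) (\<lambda>t. the (w t)) \<and>
     (AE t in lebesgue_on (dom w).
        ((\<lambda>s. the (w s)) has_vector_derivative V (the (w t)) t) (at t within dom w)) \<and>
     w 0 = Some z"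

definition maximal_ivp_solution ::
    "(complex \<Rightarrow> real \<Rightarrow> complex) \<Rightarrow> complex \<Rightarrow> (real \<rightharpoonup> complex) \<Rightarrow> bool" where
  "maximal_ivp_solution V z w \<longleftrightarrow>
     ivp_solution V z w \<and>
     \<not> (\<exists>(T::ereal) w'. 0 < T \<and> dom w' = {t. 0 \<le> t \<and> ereal t < T} \<and>
          ivp_solution V z w' \<and> w \<subseteq>\<^sub>m w' \<and> dom w \<subset> dom w')"

definition trajectory :: "(complex \<Rightarrow> real \<Rightarrow> complex) \<Rightarrow> complex \<Rightarrow> (real \<rightharpoonup> complex)" where
  "trajectory G z = (THE w. maximal_ivp_solution (\<lambda>\<zeta> t. - G \<zeta> t) z w)"

definition Omega :: "(complex \<Rightarrow> real \<Rightarrow> complex) \<Rightarrow> real \<Rightarrow> complex set" where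
  "Omega G t = {z \<in> disc. t \<in> dom (trajectory G z)}"

definition flow_map :: "(complex \<Rightarrow> real \<Rightarrow> complex) \<Rightarrow> real \<Rightarrow> complex \<Rightarrow> complex" where
  "flow_map G t z = the (trajectory G z t)"

definition inverse_flow :: "(complex \<Rightarrow> real \<Rightarrow> complex) \<Rightarrow> real \<Rightarrow> complex \<Rightarrow> complex" where
  "inverse_flow G t = inv_into (Omega G t) (flow_map G t)"

definition decreasing_loewner_chain :: "ereal \<Rightarrow> (real \<Rightarrow> complex \<Rightarrow> complex) \<Rightarrow> bool" where
  "decreasing_loewner_chain d f \<longleftrightarrow>
     (\<forall>t\<ge>0. f t holomorphic_on disc \<and> f t ` disc \<subseteq> disc \<and> inj_on (f t) disc) \<and>
     (\<forall>z\<in>disc. f 0 z = z) \<and>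
     (\<forall>s t. 0 \<le> s \<and> s \<le> t \<longrightarrow> f t ` disc \<subseteq> f s ` disc) \<and>
     (\<forall>K T. compact K \<and> K \<subseteq> disc \<and> 0 < T \<longrightarrow>
        (\<exists>k. (\<forall>t\<in>{0..T}. 0 \<le> k t) \<and> Lp_on d {0..T} k \<and>
             (\<forall>z\<in>K. \<forall>s t. 0 \<le> s \<and> s \<le> t \<and> t \<le> T \<longrightarrow>
                norm (f s z - f t z) \<le> (LINT \<xi>:{s..t}|lebesgue. k \<xi>))))"

text \<open>Solutions of \<open>\<partial>F/\<partial>t = (\<partial>F/\<partial>z) G(z,t)\<close> on \<open>disc \<times> E\<close>.
  The null set of exceptional times may depend on \<open>z\<close>.\<close>

definition loewner_pde_solution ::
    "(complex \<Rightarrow> real \<Rightarrow> complex) \<Rightarrow> real set \<Rightarrow> (complex \<Rightarrow> real \<Rightarrow> complex) \<Rightarrow> bool" where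
  "loewner_pde_solution G E F \<longleftrightarrow>
     is_interval E \<and> E \<subseteq> {0..} \<and>
     continuous_on (disc \<times> E) (\<lambda>(z, t). F z t) \<and>
     (\<forall>t\<in>E. (\<lambda>z. F z t) holomorphic_on disc) \<and>
     (\<forall>z\<in>disc. loc_abs_continuous_on E (F z)) \<and>
     (\<forall>z\<in>disc. AE t in lebesgue_on E.
        (F z has_vector_derivative deriv (\<lambda>\<zeta>. F \<zeta> t) z * G z t) (at t within E))"

end

theory Submission
  imports Defs
begin

text \<open>The equation \<open>dw/dt = -G(w,t)\<close> is best read backwards in time. Followed towards decreasing \<open>t\<close>, a
solution moves along the field \<open>G(\<cdot>,t)\<close>, which generates a semigroup of self-maps of the disc.
The Schwarz-Pick lemma for such a semigroup, differentiated at time \<open>0\<close>, gives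
\<open>Re (cnj z * H z) \<le> (1 - |z|^2) |H 0|\<close> for its generator \<open>H\<close> (\<open>generator_inequality\<close>). Hence
\<open>|w|\<close> can approach \<open>1\<close> backwards only at a rate controlled by the integrable function \<open>|G(0,t)|\<close>
(\<open>a_priori_bound\<close>), and for all \<open>t \<ge> 0\<close> and all \<open>z\<close> in the disc there is a solution on the whole
of \<open>[0,t]\<close> with value \<open>z\<close> at time \<open>t\<close>. Let \<open>backflow t z s\<close> be its value at \<open>s\<close>, and put
\<open>f_t(z) = backflow t z 0\<close>. Uniqueness of solutions makes every \<open>f_t\<close> injective and gives
\<open>f_t = f_s \<circ> backflow t \<cdot> s\<close> for \<open>s \<le> t\<close>, so the ranges decrease. A point \<open>z\<close> lies in the range of
\<open>f_t\<close> exactly if its trajectory lives up to time \<open>t\<close>, and then the trajectory is at \<open>f_t^{-1}(z)\<close>: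
the maximal solutions, the sets \<open>\<Omega>_t\<close>, the maps \<open>g_t\<close> and their inverses are all read off from \<open>f_t\<close>.

The solutions are constructed for truncated fields, obtained by composing \<open>G\<close> with the nearest-point
projection onto a smaller disc and cutting off in time. Such a field is bounded by \<open>k(t)\<close> and Lipschitz
with constant \<open>k(t)\<close> for one \<open>k\<close> that is integrable over the whole line, and the Banach fixed point
theorem in a weighted supremum norm yields solutions for all times (\<open>solution_exists\<close>). The difference
\<open>\<Delta>\<close> of two solutions satisfies a linear equation \<open>\<Delta>' = Q \<Delta>\<close> with \<open>|Q| \<le> k\<close>, so
\<open>\<Delta>(t) = \<Delta>(s) exp (\<integral>Q)\<close> (\<open>solution_difference\<close>). This formula gives uniqueness and Lipschitz dependence
on the initial value; divided by \<open>\<Delta>(s)\<close> it gives complex differentiability in the initial value by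
dominated convergence, that is, holomorphy of \<open>f_t\<close>.

For a solution \<open>F\<close> of the partial differential equation the exceptional null set depends on \<open>z\<close>, so
\<open>F(w(t),t)\<close> cannot be differentiated along a trajectory by the chain rule. Increments are estimated
instead. With \<open>K = \<integral>k\<close>, the function \<open>h(t) = F(w(t),t)\<close> satisfies
\<open>|h(t) - h(s)| \<le> C (K(t) - K(s))^2\<close>, which forces \<open>h\<close> to be constant
(\<open>quadratic_bound_imp_constant\<close>); comparing \<open>h(0)\<close> with \<open>h(t)\<close> identifies \<open>F\<close> with \<open>f\<close>. An estimate of
the same kind for \<open>f_t\<close> itself shows that it solves the equation (\<open>chain_second_order\<close>).

All of this rests on the calculus of absolutely continuous functions: primitives are differentiable
almost everywhere, which follows from Henstock's lemma and Vitali's covering theorem, and an absolutely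
continuous function whose derivative vanishes almost everywhere is constant, which follows from
Cousin's lemma.\<close>

section \<open>Lebesgue's differentiation theorem on the line\<close>

text \<open>By Henstock's lemma the Riemann errors over disjoint tagged intervals subordinate to a suitable gauge
have sum less than \<open>e * \<eta>\<close>. The intervals with error at least \<open>e\<close> times their length form a Vitali cover of
the bad set, so disjoint ones cover almost all of it, and their total length is at most \<open>\<eta>\<close>.\<close>

lemma Lebesgue_differentiation_bad_set_negligible:
  fixes f :: "real \<Rightarrow> 'b::euclidean_space"
  assumes f: "f integrable_on {a..b}" and e: "e > 0"
  shows "negligible {x. \<forall>d>0. \<exists>u v. a \<le> u \<and> u \<le> x \<and> x \<le> v \<and> v \<le> b \<and> u < v \<and> v - u < d \<and>
           norm ((v - u) *\<^sub>R f x - integral {u..v} f) \<ge> e * (v - u)}"  (is "negligible ?E")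
proof (rule negligible_outer_le[THEN iffD2], intro allI impI)
  fix \<eta> :: real assume \<eta>: "\<eta> > 0"
  have fi: "f integrable_on cbox a b" using f by simp
  obtain \<gamma> where \<gamma>: "gauge \<gamma>"
    and H: "\<And>p. \<lbrakk>p tagged_partial_division_of (cbox a b); \<gamma> fine p\<rbrakk> \<Longrightarrow>
             sum (\<lambda>(x,k). norm(measure lborel k *\<^sub>R f x - integral k f)) p < e * \<eta>"
    by (rule Henstock_lemma[OF fi mult_pos_pos[OF e \<eta>]]) blast
  define K where "K = {(x,u,v). a \<le> u \<and> u \<le> x \<and> x \<le> v \<and> v \<le> b \<and> u < v \<and> {u..v} \<subseteq> \<gamma> x \<and>
           norm ((v - u) *\<^sub>R f x - integral {u..v} f) \<ge> e * (v - u)}"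
  define c where "c = (\<lambda>(x::real,u::real,v::real). (u+v)/2)"
  define r where "r = (\<lambda>(x::real,u::real,v::real). (v-u)/2)"
  have cb: "cball (c (x,u,v)) (r (x,u,v)) = {u..v}" for x u v
    by (auto simp: c_def r_def cball_eq_atLeastAtMost diff_divide_distrib add_divide_distrib)
  have cov: "\<exists>i. i \<in> K \<and> x \<in> cball (c i) (r i) \<and> r i < d" if x: "x \<in> ?E" and d: "d > 0" for x d
  proof -
    obtain \<delta> where \<delta>: "\<delta> > 0" "ball x \<delta> \<subseteq> \<gamma> x"
      using \<gamma> unfolding gauge_def by (meson open_contains_ball)
    have "min d \<delta> > 0" using d \<delta> by simp
    with x obtain u v where uv: "a \<le> u" "u \<le> x" "x \<le> v" "v \<le> b" "u < v" "v - u < min d \<delta>"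
      "norm ((v - u) *\<^sub>R f x - integral {u..v} f) \<ge> e * (v - u)" by blast
    have "{u..v} \<subseteq> ball x \<delta>" using uv by (auto simp: dist_real_def)
    then have "(x,u,v) \<in> K" unfolding K_def using uv \<delta> by auto
    moreover have "x \<in> cball (c (x,u,v)) (r (x,u,v))" unfolding cb using uv by auto
    moreover have "r (x,u,v) < d" using uv by (auto simp: r_def)
    ultimately show ?thesis by blast
  qed
  have pos: "0 < r i" if "i \<in> K" for i using that by (auto simp: K_def r_def)
  obtain C where C: "countable C" "C \<subseteq> K"
     "pairwise (\<lambda>i j. disjnt (cball (c i) (r i)) (cball (c j) (r j))) C"
     "negligible(?E - (\<Union>i \<in> C. cball (c i) (r i)))"
    by (rule Vitali_covering_theorem_cballs[where S="?E" and K=K and r=r and a=c, OF pos cov])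
  have fin: "measure lebesgue (\<Union>i\<in>F. cball (c i) (r i)) \<le> \<eta>" if F: "F \<subseteq> C" "finite F" for F
  proof -
    let ?p = "(\<lambda>(x,u,v). (x,{u..v})) ` F"
    have inj: "inj_on (\<lambda>(x,u,v). (x,{u..v})) F"
    proof (rule inj_onI)
      fix i j assume *: "i \<in> F" "j \<in> F" "(\<lambda>(x,u,v). (x,{u..v})) i = (\<lambda>(x,u,v). (x,{u..v})) j"
      obtain x u v y u' v' where ij: "i = (x,u,v)" "j = (y,u',v')" by (metis prod_cases3)
      have "u < v" "u' < v'" using * F C(2) by (auto simp: K_def ij)
      then show "i = j" using *(3) by (auto simp: ij)
    qed
    have dj: "{u..v} \<inter> {u'..v'} = {}" if "(x,u,v) \<in> F" "(x',u',v') \<in> F" "(x,u,v) \<noteq> (x',u',v')" for x u v x' u' v'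
    proof -
      have "disjnt (cball (c (x,u,v)) (r (x,u,v))) (cball (c (x',u',v')) (r (x',u',v')))"
        by (rule pairwiseD[OF C(3)]) (use that F in auto)
      then show ?thesis unfolding cb disjnt_def .
    qed
    have "?p tagged_partial_division_of (cbox a b)"
      unfolding tagged_partial_division_of_def
    proof (intro conjI allI impI)
      show "finite ?p" using F by simp
    next
      fix x k assume "(x,k) \<in> ?p"
      then obtain u v where uv: "(x,u,v) \<in> F" "k = {u..v}" by auto
      then have "(x,u,v) \<in> K" using F C(2) by auto
      then show "x \<in> k" "k \<subseteq> cbox a b" using uv by (auto simp: K_def)
      show "\<exists>a b. k = cbox a b" using uv by auto
    next
      fix x k x' k' assume A: "(x,k) \<in> ?p \<and> (x',k') \<in> ?p \<and> (x,k) \<noteq> (x',k')"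
      obtain u v where uv: "(x,u,v) \<in> F" "k = {u..v}" using A by auto
      obtain u' v' where uv': "(x',u',v') \<in> F" "k' = {u'..v'}" using A by auto
      have "(x,u,v) \<noteq> (x',u',v')" using A uv uv' by auto
      then have "k \<inter> k' = {}" using dj uv uv' by blast
      then show "interior k \<inter> interior k' = {}" using interior_subset by fast
    qed
    moreover have "\<gamma> fine ?p"
      unfolding fine_def using F C(2) by (auto simp: K_def)
    ultimately have "sum (\<lambda>(x,k). norm(measure lborel k *\<^sub>R f x - integral k f)) ?p < e * \<eta>" by (rule H)
    then have S: "(\<Sum>(x,u,v)\<in>F. norm(measure lborel {u..v} *\<^sub>R f x - integral {u..v} f)) < e * \<eta>"
      unfolding sum.reindex[OF inj] by (simp add: case_prod_beta o_def)
    have "(\<Sum>(x,u,v)\<in>F. e * (v-u)) \<le> (\<Sum>(x,u,v)\<in>F. norm(measure lborel {u..v} *\<^sub>R f x - integral {u..v} f))"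
    proof (rule sum_mono, clarify)
      fix x u v assume "(x,u,v) \<in> F"
      then have "(x,u,v) \<in> K" using F C(2) by auto
      then show "e * (v - u) \<le> norm (measure lborel {u..v} *\<^sub>R f x - integral {u..v} f)" by (auto simp: K_def)
    qed
    with S have "e * (\<Sum>(x,u,v)\<in>F. v - u) < e * \<eta>"
      by (simp add: sum_distrib_left case_prod_beta)
    then have le: "(\<Sum>(x,u,v)\<in>F. v - u) < \<eta>" using e by simp
    have "measure lebesgue (\<Union>i\<in>F. cball (c i) (r i)) \<le> (\<Sum>i\<in>F. measure lebesgue (cball (c i) (r i)))"
      by (rule measure_UNION_le) (use F in auto)
    also have "\<dots> = (\<Sum>(x,u,v)\<in>F. v - u)"
    proof (rule sum.cong[OF refl], clarify)
      fix x u v assume "(x,u,v) \<in> F"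
      then have "u < v" using F C(2) by (auto simp: K_def)
      then show "measure lebesgue (cball (c (x,u,v)) (r (x,u,v))) = v - u" unfolding cb by simp
    qed
    finally show ?thesis using le by simp
  qed
  let ?U = "\<Union>i\<in>C. cball (c i) (r i)"
  have U: "?U \<in> lmeasurable" "measure lebesgue ?U \<le> \<eta>"
    by (rule fmeasurable_UN_bound[OF C(1)], simp, use fin in blast)
       (rule measure_UN_bound[OF C(1)], simp, use fin in blast)
  let ?T = "(?E - ?U) \<union> ?U"
  have "?T \<in> lmeasurable" by (rule fmeasurable.Un[OF negligible_imp_measurable[OF C(4)] U(1)])
  moreover have "measure lebesgue ?T \<le> measure lebesgue (?E - ?U) + measure lebesgue ?U"
    by (rule measure_Un_le) (use U C(4) in \<open>auto intro: negligible_imp_sets\<close>)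
  ultimately show "\<exists>T. ?E \<subseteq> T \<and> T \<in> lmeasurable \<and> measure lebesgue T \<le> \<eta>"
    using U(2) negligible_imp_measure0[OF C(4)] by (intro exI[of _ ?T]) auto
qed

lemma AE_indefinite_integral_has_vector_derivative:
  fixes f :: "real \<Rightarrow> 'b::euclidean_space"
  assumes f: "f integrable_on {a..b}"
  shows "negligible {x\<in>{a<..<b}. \<not> ((\<lambda>t. integral {a..t} f) has_vector_derivative f x) (at x)}"
    (is "negligible ?N")
proof -
  define E where "E e = {x. \<forall>d>0. \<exists>u v. a \<le> u \<and> u \<le> x \<and> x \<le> v \<and> v \<le> b \<and> u < v \<and> v - u < d \<and>
           norm ((v - u) *\<^sub>R f x - integral {u..v} f) \<ge> e * (v - u)}" for e
  have "negligible (\<Union>n. E (1 / real (Suc n)))"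
    unfolding E_def
    by (rule negligible_Union_nat, rule Lebesgue_differentiation_bad_set_negligible[OF f]) simp
  moreover have "?N \<subseteq> (\<Union>n. E (1 / real (Suc n)))"
  proof (rule subsetI, rule ccontr)
    fix x assume x: "x \<in> ?N" and nx: "x \<notin> (\<Union>n. E (1 / real (Suc n)))"
    have "((\<lambda>t. integral {a..t} f) has_vector_derivative f x) (at x)"
      unfolding has_vector_derivative_def has_derivative_within_alt2
    proof (intro conjI allI impI)
      show "bounded_linear (\<lambda>xa. xa *\<^sub>R f x)" by (rule bounded_linear_scaleR_left)
      fix e :: real assume e: "e > 0"
      obtain n where n: "1 / real (Suc n) < e" using nat_approx_posE[OF e] by auto
      have "x \<notin> E (1 / real (Suc n))" using nx by auto
      then have "\<exists>d>0. \<forall>u v. a \<le> u \<longrightarrow> u \<le> x \<longrightarrow> x \<le> v \<longrightarrow> v \<le> b \<longrightarrow> u < v \<longrightarrow> v - u < d \<longrightarrow>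
           norm ((v - u) *\<^sub>R f x - integral {u..v} f) < 1 / real (Suc n) * (v - u)"
        unfolding E_def mem_Collect_eq by (meson not_le)
      then obtain d where d: "d > 0" and D: "\<And>u v. \<lbrakk>a \<le> u; u \<le> x; x \<le> v; v \<le> b; u < v; v - u < d\<rbrakk> \<Longrightarrow>
           norm ((v - u) *\<^sub>R f x - integral {u..v} f) < 1 / real (Suc n) * (v - u)"
        by blast
      have D': "norm ((v - u) *\<^sub>R f x - integral {u..v} f) \<le> e * (v - u)"
        if "a \<le> u" "u \<le> x" "x \<le> v" "v \<le> b" "u < v" "v - u < d" for u v
      proof -
        have "1 / real (Suc n) * (v - u) \<le> e * (v - u)" using n that by (intro mult_right_mono) auto
        then show ?thesis using D[OF that] by linarith
      qed
      let ?d = "min d (min (x - a) (b - x))"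
      show "\<forall>\<^sub>F y in at x. norm (integral {a..y} f - integral {a..x} f - (y - x) *\<^sub>R f x) \<le> e * norm (y - x)"
        unfolding eventually_at
      proof (intro exI[of _ ?d] conjI ballI impI)
        show "?d > 0" using d x by auto
        fix y assume "y \<in> UNIV" and y: "y \<noteq> x \<and> dist y x < ?d"
        have ay: "a < y" "y < b" "\<bar>y - x\<bar> < d" using y x by (auto simp: dist_real_def abs_if split: if_splits)
        have fi: "f integrable_on {a..t}" if "t < b" for t
          using f by (rule integrable_on_subinterval) (use that in auto)
        show "norm (integral {a..y} f - integral {a..x} f - (y - x) *\<^sub>R f x) \<le> e * norm (y - x)"
        proof (cases "x < y")
          case True
          have "integral {a..x} f + integral {x..y} f = integral {a..y} f"
            by (rule Henstock_Kurzweil_Integration.integral_combine) (use True x fi ay in auto)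
          then have "norm (integral {a..y} f - integral {a..x} f - (y - x) *\<^sub>R f x) = norm ((y - x) *\<^sub>R f x - integral {x..y} f)"
            by (metis add_diff_cancel_left' norm_minus_commute)
          also have "\<dots> \<le> e * (y - x)" by (rule D') (use True x ay in auto)
          finally show ?thesis using True by simp
        next
          case False
          then have lt: "y < x" using y by auto
          have "integral {a..y} f + integral {y..x} f = integral {a..x} f"
            by (rule Henstock_Kurzweil_Integration.integral_combine) (use lt x fi ay in auto)
          then have "integral {a..y} f - integral {a..x} f - (y - x) *\<^sub>R f x = ((x - y) *\<^sub>R f x - integral {y..x} f)"
            by (simp add: algebra_simps)
          then have "norm (integral {a..y} f - integral {a..x} f - (y - x) *\<^sub>R f x) = norm ((x - y) *\<^sub>R f x - integral {y..x} f)"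
            by simp
          also have "\<dots> \<le> e * (x - y)" by (rule D') (use lt x ay in auto)
          finally show ?thesis using lt by simp
        qed
      qed
    qed
    then show False using x by auto
  qed
  ultimately show ?thesis by (rule negligible_subset)
qed

text \<open>The integrands below are integrable over the whole line. Integrating from \<open>-\<infinity>\<close> instead of from an
initial time treats both directions of time alike.\<close>

definition primitive :: "(real \<Rightarrow> 'b::euclidean_space) \<Rightarrow> real \<Rightarrow> 'b" where
  "primitive f t = (LINT s:{..t}|lebesgue. f s)"

lemma set_integrable_of_integrable:
  fixes f :: "real \<Rightarrow> 'b::euclidean_space"
  assumes "integrable lebesgue f" "S \<in> sets lebesgue"
  shows "set_integrable lebesgue S f"
  using set_integrable_subset[of lebesgue UNIV f S] assms by (auto simp: set_integrable_def)

lemma primitive_diff: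
  fixes f :: "real \<Rightarrow> 'b::euclidean_space"
  assumes f: "integrable lebesgue f" and st: "s \<le> t"
  shows "primitive f t - primitive f s = (LINT x:{s..t}|lebesgue. f x)"
    and "primitive f t - primitive f s = (LINT x:{s<..<t}|lebesgue. f x)"
proof -
  have "{..t} = {..s} \<union> {s<..t}" using st by auto
  then have 1: "primitive f t = primitive f s + (LINT x:{s<..t}|lebesgue. f x)"
    unfolding primitive_def
    by (simp only:) (rule set_integral_Un, use f in \<open>auto intro!: set_integrable_of_integrable\<close>)
  have ae: "AE x in lebesgue. x \<noteq> s \<and> x \<noteq> t"
    by (rule AE_I'[where N="{s,t}"]) (auto simp: negligible_iff_null_sets[symmetric])
  have m: "(\<lambda>x. indicator A x *\<^sub>R f x) \<in> borel_measurable lebesgue" if "A \<in> sets lebesgue" for A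
    using set_integrable_of_integrable[OF f that] unfolding set_integrable_def by (rule borel_measurable_integrable)
  have cong: "(LINT x:A|lebesgue. f x) = (LINT x:B|lebesgue. f x)"
    if "A \<in> sets lebesgue" "B \<in> sets lebesgue" "\<And>x. x \<noteq> s \<Longrightarrow> x \<noteq> t \<Longrightarrow> x \<in> A \<longleftrightarrow> x \<in> B" for A B
    unfolding set_lebesgue_integral_def
  proof (rule integral_cong_AE)
    show "AE x in lebesgue. indicat_real A x *\<^sub>R f x = indicat_real B x *\<^sub>R f x"
      using ae by eventually_elim (use that(3) in \<open>auto simp: indicator_def\<close>)
  qed (rule m[OF that(1)], rule m[OF that(2)])
  have 2: "(LINT x:{s<..t}|lebesgue. f x) = (LINT x:{s..t}|lebesgue. f x)"
    "(LINT x:{s<..t}|lebesgue. f x) = (LINT x:{s<..<t}|lebesgue. f x)"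
    by (rule cong; auto)+
  show "primitive f t - primitive f s = (LINT x:{s..t}|lebesgue. f x)"
    "primitive f t - primitive f s = (LINT x:{s<..<t}|lebesgue. f x)"
    using 1 2 by auto
qed

lemma primitive_diff_integral:
  fixes f :: "real \<Rightarrow> 'b::euclidean_space"
  assumes f: "integrable lebesgue f" and st: "s \<le> t"
  shows "primitive f t - primitive f s = integral {s..t} f" "f integrable_on {s..t}"
  using primitive_diff(1)[OF assms] set_lebesgue_integral_eq_integral[OF set_integrable_of_integrable[OF f, of "{s..t}"]]
  by auto

lemma AE_primitive_has_vector_derivative:
  fixes f :: "real \<Rightarrow> 'b::euclidean_space"
  assumes f: "integrable lebesgue f"
  shows "AE x in lebesgue. (primitive f has_vector_derivative f x) (at x)"
proof -
  let ?B = "\<lambda>n::nat. {x\<in>{-real n<..<real n}. \<not> ((\<lambda>t. integral {-real n..t} f) has_vector_derivative f x) (at x)}"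
  have neg: "negligible (\<Union>n. ?B n)"
    by (rule negligible_Union_nat, rule AE_indefinite_integral_has_vector_derivative,
        rule primitive_diff_integral(2)[OF f]) simp
  show ?thesis
  proof (rule AE_I')
    show "(\<Union>n. ?B n) \<in> null_sets lebesgue" using neg by (simp add: negligible_iff_null_sets)
    show "{x \<in> space lebesgue. \<not> (primitive f has_vector_derivative f x) (at x)} \<subseteq> (\<Union>n. ?B n)"
    proof (rule subsetI, rule ccontr)
      fix x assume x: "x \<in> {x \<in> space lebesgue. \<not> (primitive f has_vector_derivative f x) (at x)}" and nx: "x \<notin> (\<Union>n. ?B n)"
      obtain n :: nat where n: "\<bar>x\<bar> < n" using reals_Archimedean2 by blast
      then have xn: "x \<in> {-real n<..<real n}" by auto
      with nx have "((\<lambda>t. integral {-real n..t} f) has_vector_derivative f x) (at x)" by blast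
      then have "((\<lambda>t. primitive f (-real n) + integral {-real n..t} f) has_vector_derivative 0 + f x) (at x)"
        by (intro derivative_intros)
      then have "(primitive f has_vector_derivative 0 + f x) (at x)"
      proof (rule has_vector_derivative_transform_within_open[where S="{-real n<..<real n}"])
        fix y assume "y \<in> {-real n<..<real n}"
        then show "primitive f (-real n) + integral {-real n..y} f = primitive f y"
          using primitive_diff_integral(1)[OF f, of "-real n" y] by (auto simp: algebra_simps)
      qed (use xn in auto)
      then show False using x by simp
    qed
  qed
qed

section \<open>Absolutely continuous functions\<close>

text \<open>The definition speaks of families indexed by an initial segment of the natural numbers; here the index
set is any finite set, such as a tagged division.\<close>

lemma abs_continuous_onD:
  assumes f: "abs_continuous_on a b f" and e: "\<epsilon> > 0"
  obtains \<delta> where "\<delta> > 0"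
    "\<And>(I::'i set) u v. \<lbrakk>finite I; \<And>i. i \<in> I \<Longrightarrow> a \<le> u i \<and> u i \<le> v i \<and> v i \<le> b;
        disjoint_family_on (\<lambda>i. {u i<..<v i}) I; (\<Sum>i\<in>I. v i - u i) < \<delta>\<rbrakk>
      \<Longrightarrow> (\<Sum>i\<in>I. dist (f (u i)) (f (v i))) < \<epsilon>"
proof -
  obtain \<delta> where d: "\<delta> > 0" and D: "\<forall>(n::nat) u v.
        (\<forall>i<n. a \<le> u i \<and> u i \<le> v i \<and> v i \<le> b) \<and>
        disjoint_family_on (\<lambda>i. {u i<..<v i}) {..<n} \<and>
        (\<Sum>i<n. v i - u i) < \<delta> \<longrightarrow>
        (\<Sum>i<n. dist (f (u i)) (f (v i))) < \<epsilon>"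
    using f e unfolding abs_continuous_on_def by meson
  show thesis
  proof (rule that[OF d])
    fix I :: "'i set" and u v
    assume I: "finite I" "\<And>i. i \<in> I \<Longrightarrow> a \<le> u i \<and> u i \<le> v i \<and> v i \<le> b"
        "disjoint_family_on (\<lambda>i. {u i<..<v i}) I" "(\<Sum>i\<in>I. v i - u i) < \<delta>"
    obtain h where h: "bij_betw h {..<card I} I"
      using ex_bij_betw_nat_finite[OF I(1)] by (auto simp: atLeast0LessThan)
    have hI: "h i \<in> I" if "i < card I" for i using h that by (auto simp: bij_betw_def)
    have "(\<Sum>i<card I. v (h i) - u (h i)) < \<delta>"
      using I(4) sum.reindex_bij_betw[OF h, of "\<lambda>i. v i - u i"] by simp
    moreover have "disjoint_family_on (\<lambda>i. {u (h i)<..<v (h i)}) {..<card I}"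
      unfolding disjoint_family_on_def
    proof (intro ballI impI)
      fix m n assume "m \<in> {..<card I}" "n \<in> {..<card I}" "m \<noteq> n"
      then have "h m \<noteq> h n" "h m \<in> I" "h n \<in> I" using h by (auto simp: bij_betw_def inj_on_def)
      then show "{u (h m)<..<v (h m)} \<inter> {u (h n)<..<v (h n)} = {}"
        using I(3) by (simp add: disjoint_family_on_def)
    qed
    ultimately have "(\<Sum>i<card I. dist (f (u (h i))) (f (v (h i)))) < \<epsilon>"
      using D[rule_format, of "card I" "u \<circ> h" "v \<circ> h"] I(2) hI by simp
    then show "(\<Sum>i\<in>I. dist (f (u i)) (f (v i))) < \<epsilon>"
      using sum.reindex_bij_betw[OF h, of "\<lambda>i. dist (f (u i)) (f (v i))"] by simp
  qed
qed

text \<open>Sums, products and compositions with Lipschitz maps all reduce to this comparison of increments.\<close>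

lemma abs_continuous_on_combine:
  assumes f: "abs_continuous_on a b f" and g: "abs_continuous_on a b g"
    and h: "\<And>s t. \<lbrakk>a \<le> s; s \<le> t; t \<le> b\<rbrakk> \<Longrightarrow> dist (h s) (h t) \<le> C * (dist (f s) (f t) + dist (g s) (g t))"
  shows "abs_continuous_on a b h"
  unfolding abs_continuous_on_def
proof (intro allI impI)
  fix \<epsilon> :: real assume e: "\<epsilon> > 0"
  define c where "c = 2 * (\<bar>C\<bar> + 1)"
  have c: "c > 0" by (simp add: c_def add_pos_nonneg)
  then have ec: "\<epsilon> / c > 0" using e by simp
  obtain \<delta>1 where d1: "\<delta>1 > 0" and D1: "\<forall>(n::nat) u v.
        (\<forall>i<n. a \<le> u i \<and> u i \<le> v i \<and> v i \<le> b) \<and>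
        disjoint_family_on (\<lambda>i. {u i<..<v i}) {..<n} \<and>
        (\<Sum>i<n. v i - u i) < \<delta>1 \<longrightarrow>
        (\<Sum>i<n. dist (f (u i)) (f (v i))) < \<epsilon> / c"
    using f ec unfolding abs_continuous_on_def by meson
  obtain \<delta>2 where d2: "\<delta>2 > 0" and D2: "\<forall>(n::nat) u v.
        (\<forall>i<n. a \<le> u i \<and> u i \<le> v i \<and> v i \<le> b) \<and>
        disjoint_family_on (\<lambda>i. {u i<..<v i}) {..<n} \<and>
        (\<Sum>i<n. v i - u i) < \<delta>2 \<longrightarrow>
        (\<Sum>i<n. dist (g (u i)) (g (v i))) < \<epsilon> / c"
    using g ec unfolding abs_continuous_on_def by meson
  show "\<exists>\<delta>>0. \<forall>(n::nat) u v.
        (\<forall>i<n. a \<le> u i \<and> u i \<le> v i \<and> v i \<le> b) \<and>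
        disjoint_family_on (\<lambda>i. {u i<..<v i}) {..<n} \<and>
        (\<Sum>i<n. v i - u i) < \<delta> \<longrightarrow>
        (\<Sum>i<n. dist (h (u i)) (h (v i))) < \<epsilon>"
  proof (intro exI[of _ "min \<delta>1 \<delta>2"] conjI allI impI)
    show "min \<delta>1 \<delta>2 > 0" using d1 d2 by simp
    fix n :: nat and u v :: "nat \<Rightarrow> real"
    assume A: "(\<forall>i<n. a \<le> u i \<and> u i \<le> v i \<and> v i \<le> b) \<and>
        disjoint_family_on (\<lambda>i. {u i<..<v i}) {..<n} \<and>
        (\<Sum>i<n. v i - u i) < min \<delta>1 \<delta>2"
    have F: "(\<Sum>i<n. dist (f (u i)) (f (v i))) < \<epsilon> / c" using A by (intro D1[rule_format]) auto
    have G: "(\<Sum>i<n. dist (g (u i)) (g (v i))) < \<epsilon> / c" using A by (intro D2[rule_format]) auto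
    have "(\<Sum>i<n. dist (h (u i)) (h (v i))) \<le> (\<Sum>i<n. (\<bar>C\<bar> + 1) * (dist (f (u i)) (f (v i)) + dist (g (u i)) (g (v i))))"
    proof (rule sum_mono)
      fix i assume "i \<in> {..<n}"
      then have "dist (h (u i)) (h (v i)) \<le> C * (dist (f (u i)) (f (v i)) + dist (g (u i)) (g (v i)))"
        using A by (intro h) auto
      also have "\<dots> \<le> (\<bar>C\<bar> + 1) * (dist (f (u i)) (f (v i)) + dist (g (u i)) (g (v i)))"
        by (rule mult_right_mono) auto
      finally show "dist (h (u i)) (h (v i)) \<le> (\<bar>C\<bar> + 1) * (dist (f (u i)) (f (v i)) + dist (g (u i)) (g (v i)))" .
    qed
    also have "\<dots> = (\<bar>C\<bar> + 1) * ((\<Sum>i<n. dist (f (u i)) (f (v i))) + (\<Sum>i<n. dist (g (u i)) (g (v i))))"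
      by (simp only: sum_distrib_left[symmetric] sum.distrib)
    also have "\<dots> < (\<bar>C\<bar> + 1) * (\<epsilon> / c + \<epsilon> / c)"
      using F G by (intro mult_strict_left_mono) auto
    also have "\<dots> = (2 * (\<bar>C\<bar> + 1)) * (\<epsilon> / c)" by (simp add: algebra_simps add_divide_distrib)
    also have "\<dots> = \<epsilon>" using c unfolding c_def[symmetric] by simp
    finally show "(\<Sum>i<n. dist (h (u i)) (h (v i))) < \<epsilon>" .
  qed
qed

lemma abs_continuous_on_subinterval:
  assumes "abs_continuous_on a b f" "a \<le> c" "d \<le> b"
  shows "abs_continuous_on c d f"
  unfolding abs_continuous_on_def
proof (intro allI impI)
  fix \<epsilon> :: real assume e: "\<epsilon> > 0"
  obtain \<delta> where d: "\<delta> > 0" and D: "\<forall>(n::nat) u v.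
        (\<forall>i<n. a \<le> u i \<and> u i \<le> v i \<and> v i \<le> b) \<and>
        disjoint_family_on (\<lambda>i. {u i<..<v i}) {..<n} \<and>
        (\<Sum>i<n. v i - u i) < \<delta> \<longrightarrow>
        (\<Sum>i<n. dist (f (u i)) (f (v i))) < \<epsilon>"
    using assms(1) e unfolding abs_continuous_on_def by meson
  show "\<exists>\<delta>>0. \<forall>(n::nat) u v.
        (\<forall>i<n. c \<le> u i \<and> u i \<le> v i \<and> v i \<le> d) \<and>
        disjoint_family_on (\<lambda>i. {u i<..<v i}) {..<n} \<and>
        (\<Sum>i<n. v i - u i) < \<delta> \<longrightarrow>
        (\<Sum>i<n. dist (f (u i)) (f (v i))) < \<epsilon>"
  proof (intro exI[of _ \<delta>] conjI d allI impI)
    fix n :: nat and u v :: "nat \<Rightarrow> real"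
    assume A: "(\<forall>i<n. c \<le> u i \<and> u i \<le> v i \<and> v i \<le> d) \<and>
        disjoint_family_on (\<lambda>i. {u i<..<v i}) {..<n} \<and> (\<Sum>i<n. v i - u i) < \<delta>"
    then have "\<forall>i<n. a \<le> u i \<and> u i \<le> v i \<and> v i \<le> b" using assms(2,3) by (meson order_trans)
    with A D show "(\<Sum>i<n. dist (f (u i)) (f (v i))) < \<epsilon>" by blast
  qed
qed

lemma abs_continuous_on_imp_continuous_on:
  assumes f: "abs_continuous_on a b f"
  shows "continuous_on {a..b} f"
  unfolding continuous_on_iff
proof (intro ballI allI impI)
  fix x \<epsilon> :: real assume x: "x \<in> {a..b}" and e: "\<epsilon> > 0"
  obtain \<delta> where d: "\<delta> > 0" and D: "\<And>(I::unit set) u v. \<lbrakk>finite I; \<And>i. i \<in> I \<Longrightarrow> a \<le> u i \<and> u i \<le> v i \<and> v i \<le> b;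
        disjoint_family_on (\<lambda>i. {u i<..<v i}) I; (\<Sum>i\<in>I. v i - u i) < \<delta>\<rbrakk>
      \<Longrightarrow> (\<Sum>i\<in>I. dist (f (u i)) (f (v i))) < \<epsilon>"
    using abs_continuous_onD[OF f e] by blast
  have le: "dist (f s) (f t) < \<epsilon>" if "a \<le> s" "s \<le> t" "t \<le> b" "t - s < \<delta>" for s t
    using D[of UNIV "\<lambda>_. s" "\<lambda>_. t"] that by (simp add: disjoint_family_on_def)
  show "\<exists>d>0. \<forall>x'\<in>{a..b}. dist x' x < d \<longrightarrow> dist (f x') (f x) < \<epsilon>"
  proof (intro exI[of _ \<delta>] conjI d ballI impI)
    fix y assume y: "y \<in> {a..b}" "dist y x < \<delta>"
    show "dist (f y) (f x) < \<epsilon>"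
    proof (cases "x \<le> y")
      case True then show ?thesis using le[of x y] x y by (auto simp: dist_real_def dist_commute)
    next
      case False then show ?thesis using le[of y x] x y by (auto simp: dist_real_def)
    qed
  qed
qed

lemma abs_continuous_on_const: "abs_continuous_on a b (\<lambda>t. c)"
  unfolding abs_continuous_on_def by (auto intro: exI[of _ 1])

lemma abs_continuous_on_add:
  assumes f: "abs_continuous_on a b f" and g: "abs_continuous_on a b g"
  shows "abs_continuous_on a b (\<lambda>t. f t + g t)"
  by (rule abs_continuous_on_combine[OF f g, of _ 1])
    (simp add: dist_norm norm_diff_triangle_ineq)

lemma abs_continuous_on_bounded:
  assumes "abs_continuous_on a b f"
  shows "\<exists>B>0. \<forall>t\<in>{a..b}. norm (f t) \<le> B"
proof -
  have "compact (f ` {a..b})"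
    by (rule compact_continuous_image[OF abs_continuous_on_imp_continuous_on[OF assms]]) simp
  from bounded_pos[THEN iffD1, OF compact_imp_bounded[OF this]] show ?thesis by simp
qed

lemma abs_continuous_on_mult:
  assumes f: "abs_continuous_on a b f" and g: "abs_continuous_on a b g"
  shows "abs_continuous_on a b (\<lambda>t. f t * g t)"
proof -
  obtain A where A: "A > 0" "\<forall>t\<in>{a..b}. norm (f t) \<le> A" using abs_continuous_on_bounded[OF f] by blast
  obtain B where B: "B > 0" "\<forall>t\<in>{a..b}. norm (g t) \<le> B" using abs_continuous_on_bounded[OF g] by blast
  show ?thesis
  proof (rule abs_continuous_on_combine[OF f g, of _ "A + B"])
    fix s t assume st: "a \<le> s" "s \<le> t" "t \<le> b"
    have "dist (f s * g s) (f t * g t) = norm (f s * (g s - g t) + (f s - f t) * g t)"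
      by (simp add: dist_norm algebra_simps)
    also have "\<dots> \<le> norm (f s) * norm (g s - g t) + norm (f s - f t) * norm (g t)"
      using norm_triangle_ineq[of "f s * (g s - g t)" "(f s - f t) * g t"] by (simp add: norm_mult)
    also have "\<dots> \<le> A * norm (g s - g t) + norm (f s - f t) * B"
      using A(2)[rule_format, of s] B(2)[rule_format, of t] A(1) st by (intro add_mono mult_right_mono mult_left_mono) auto
    also have "\<dots> \<le> (A + B) * (dist (f s) (f t) + dist (g s) (g t))"
      using A(1) B(1) by (simp add: dist_norm algebra_simps)
    finally show "dist (f s * g s) (f t * g t) \<le> (A + B) * (dist (f s) (f t) + dist (g s) (g t))" .
  qed
qed

lemma abs_continuous_on_diff:
  assumes f: "abs_continuous_on a b f" and g: "abs_continuous_on a b g"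
  shows "abs_continuous_on a b (\<lambda>t. f t - g t)"
  using abs_continuous_on_add[OF f abs_continuous_on_mult[OF abs_continuous_on_const[of a b "-1"] g]] by simp

text \<open>The exceptional null set \<open>N\<close> is covered by an open set \<open>U\<close> of measure less than the \<open>\<delta>\<close> of absolute
continuity. By Cousin's lemma there is a tagged division whose intervals lie in \<open>U\<close> if their tag is in
\<open>N\<close>, and are so short that \<open>Re f\<close> grows by at most \<open>\<epsilon>\<close> times the length otherwise. The first group
contributes at most \<open>\<epsilon>\<close> by absolute continuity, the second at most \<open>\<epsilon> (b - a)\<close>.\<close>

lemma abs_continuous_on_Re_antimono:
  assumes ab: "a \<le> b" and f: "abs_continuous_on a b f"
    and D: "AE x in lebesgue. x \<in> {a..b} \<longrightarrow> (\<exists>D. (f has_vector_derivative D) (at x within {a..b}) \<and> Re D \<le> 0)"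
  shows "Re (f b) \<le> Re (f a)"
proof (rule field_le_epsilon)
  fix \<epsilon>' :: real assume e': "\<epsilon>' > 0"
  define \<epsilon> where "\<epsilon> = \<epsilon>' / (b - a + 1)"
  have e: "\<epsilon> > 0" using e' ab by (simp add: \<epsilon>_def)
  have ee: "\<epsilon> * (b - a) + \<epsilon> = \<epsilon>'" 
  proof -
    have "\<epsilon> * (b - a) + \<epsilon> = (b - a + 1) * \<epsilon>" by (simp add: algebra_simps)
    then show ?thesis using ab by (simp add: \<epsilon>_def)
  qed
  obtain \<delta> where d: "\<delta> > 0" and AC: "\<And>(I::(real \<times> real set) set) u v. \<lbrakk>finite I; \<And>i. i \<in> I \<Longrightarrow> a \<le> u i \<and> u i \<le> v i \<and> v i \<le> b;
        disjoint_family_on (\<lambda>i. {u i<..<v i}) I; (\<Sum>i\<in>I. v i - u i) < \<delta>\<rbrakk>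
      \<Longrightarrow> (\<Sum>i\<in>I. dist (f (u i)) (f (v i))) < \<epsilon>"
    by (rule abs_continuous_onD[OF f e]) blast
  obtain N where N: "N \<in> null_sets lebesgue"
    and ND: "\<And>x. x \<in> {a..b} \<Longrightarrow> x \<notin> N \<Longrightarrow> \<exists>D. (f has_vector_derivative D) (at x within {a..b}) \<and> Re D \<le> 0"
    using D by (rule AE_E3) auto
  obtain U where U: "open U" "N \<subseteq> U" "U - N \<in> lmeasurable" "emeasure lebesgue (U - N) < ennreal \<delta>"
    using sets_lebesgue_outer_open[of N \<delta>] N d by auto
  have UU: "U = (U - N) \<union> N" using U by auto
  have em: "emeasure lebesgue U = emeasure lebesgue (U - N)"
    using emeasure_Un_null_set[OF _ N, of "U - N"] U(3) UU by (metis fmeasurableD)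
  then have Um: "U \<in> lmeasurable" using U by (intro fmeasurableI) (auto simp: less_top[symmetric] intro: borel_open fmeasurableD2)
  have Ud: "measure lebesgue U < \<delta>"
    using U(4) d unfolding em[symmetric] by (simp add: emeasure_eq_measure2[OF Um] ennreal_less_iff)
  have "\<exists>S. open S \<and> x \<in> S \<and> (if x \<in> N then S \<subseteq> U else
      (\<forall>u v. a \<le> u \<and> u \<le> x \<and> x \<le> v \<and> v \<le> b \<and> {u..v} \<subseteq> S \<longrightarrow> Re (f v) - Re (f u) \<le> \<epsilon> * (v - u)))" for x
  proof (cases "x \<in> N \<or> x \<notin> {a..b}")
    case True
    show ?thesis
    proof (cases "x \<in> N")
      case True then show ?thesis using U by auto
    next
      case False
      then show ?thesis using True by (intro exI[of _ UNIV]) auto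
    qed
  next
    case False
    then obtain D where D: "(f has_vector_derivative D) (at x within {a..b})" and ReD: "Re D \<le> 0" using ND by blast
    from D e have "\<forall>\<^sub>F y in at x within {a..b}. norm (f y - f x - (y - x) *\<^sub>R D) \<le> \<epsilon> * norm (y - x)"
      unfolding has_vector_derivative_def has_derivative_within_alt2 by blast
    then obtain r where r: "r > 0" and R: "\<And>y. y \<in> {a..b} \<Longrightarrow> y \<noteq> x \<Longrightarrow> dist y x < r \<Longrightarrow> norm (f y - f x - (y - x) *\<^sub>R D) \<le> \<epsilon> * norm (y - x)"
      unfolding eventually_at by blast
    have R': "\<bar>Re (f y) - Re (f x) - (y - x) * Re D\<bar> \<le> \<epsilon> * \<bar>y - x\<bar>" if "y \<in> {a..b}" "dist y x < r" for y
    proof (cases "y = x")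
      case False
      have "\<bar>Re (f y - f x - (y - x) *\<^sub>R D)\<bar> \<le> norm (f y - f x - (y - x) *\<^sub>R D)" by (rule abs_Re_le_cmod)
      also have "\<dots> \<le> \<epsilon> * norm (y - x)" using R that False by blast
      finally show ?thesis by simp
    qed simp
    have main: "Re (f v) - Re (f u) \<le> \<epsilon> * (v - u)"
      if uv: "a \<le> u \<and> u \<le> x \<and> x \<le> v \<and> v \<le> b \<and> {u..v} \<subseteq> ball x r" for u v
    proof -
      have "u \<in> ball x r" "v \<in> ball x r" using uv by (meson atLeastAtMost_iff order_refl order_trans subsetD)+
      then have d: "dist u x < r" "dist v x < r" by (auto simp: dist_commute)
      have uvab: "u \<in> {a..b}" "v \<in> {a..b}" using uv by auto
      have "\<bar>Re (f v) - Re (f x) - (v - x) * Re D\<bar> \<le> \<epsilon> * (v - x)"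
        "\<bar>Re (f u) - Re (f x) - (u - x) * Re D\<bar> \<le> \<epsilon> * (x - u)"
        using R'[OF uvab(2) d(2)] R'[OF uvab(1) d(1)] uv by simp_all
      moreover have "(v - x) * Re D \<le> 0" "(u - x) * Re D \<ge> 0" using uv ReD
        by (auto intro: mult_nonneg_nonpos mult_nonpos_nonpos)
      ultimately have "Re (f v) - Re (f u) \<le> \<epsilon> * (v - x) + \<epsilon> * (x - u)" by linarith
      then show "Re (f v) - Re (f u) \<le> \<epsilon> * (v - u)" by (simp add: algebra_simps)
    qed
    show ?thesis
      by (rule exI[of _ "ball x r"]) (use False main r in simp)
  qed
  then have "\<forall>x. \<exists>S. open S \<and> x \<in> S \<and> (if x \<in> N then S \<subseteq> U else
      (\<forall>u v. a \<le> u \<and> u \<le> x \<and> x \<le> v \<and> v \<le> b \<and> {u..v} \<subseteq> S \<longrightarrow> Re (f v) - Re (f u) \<le> \<epsilon> * (v - u)))"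
    by blast
  from choice[OF this] obtain g where G: "\<And>x. open (g x) \<and> x \<in> g x \<and> (if x \<in> N then g x \<subseteq> U else
      (\<forall>u v. a \<le> u \<and> u \<le> x \<and> x \<le> v \<and> v \<le> b \<and> {u..v} \<subseteq> g x \<longrightarrow> Re (f v) - Re (f u) \<le> \<epsilon> * (v - u)))"
    by blast
  have g: "open (g x)" "x \<in> g x" "x \<in> N \<Longrightarrow> g x \<subseteq> U" for x using G[of x] by auto
  have gD: "Re (f v) - Re (f u) \<le> \<epsilon> * (v - u)"
    if "x \<notin> N" "a \<le> u" "u \<le> x" "x \<le> v" "v \<le> b" "{u..v} \<subseteq> g x" for x u v
    using G[of x] that by simp
  have "gauge g" using g by (auto simp: gauge_def)
  then obtain p where p: "p tagged_division_of {a..b}" and fine: "g fine p" by (rule fine_division_exists_real)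
  define P where "P = {i\<in>p. fst i \<in> N}"
  note pD = tagged_division_ofD[OF p]
  have fin: "finite p" "finite P" using pD(1) by (auto simp: P_def)
  have iK: "{Inf (snd i)..Sup (snd i)} = snd i \<and> a \<le> Inf (snd i) \<and> Inf (snd i) \<le> fst i \<and> fst i \<le> Sup (snd i) \<and> Sup (snd i) \<le> b \<and> snd i \<subseteq> g (fst i)"
    if "i \<in> p" for i
  proof -
    obtain x K where i: "i = (x,K)" by force
    have xK: "(x,K) \<in> p" using that i by simp
    obtain u v where "K = cbox u v" using pD(4)[OF xK] by blast
    then have K: "K = {u..v}" by simp
    have "x \<in> K" "K \<subseteq> {a..b}" using pD(2,3)[OF xK] by blast+
    then have "u \<le> v" "a \<le> u" "v \<le> b" "u \<le> x" "x \<le> v" using K by auto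
    then show ?thesis using fine that by (auto simp: i K fine_def)
  qed
  have disj: "disjoint_family_on (\<lambda>i. {Inf (snd i)<..<Sup (snd i)}) p"
    unfolding disjoint_family_on_def
  proof (intro ballI impI)
    fix i j assume ij: "i \<in> p" "j \<in> p" "i \<noteq> j"
    have "interior (snd i) \<inter> interior (snd j) = {}"
      using pD(5)[of "fst i" "snd i" "fst j" "snd j"] ij by auto
    moreover have "interior (snd i) = {Inf (snd i)<..<Sup (snd i)}" if "i \<in> p" for i
      using interior_atLeastAtMost_real[of "Inf (snd i)" "Sup (snd i)"] iK[OF that] by simp
    ultimately show "{Inf (snd i)<..<Sup (snd i)} \<inter> {Inf (snd j)<..<Sup (snd j)} = {}" using ij by auto
  qed
  have "(\<Sum>i\<in>P. dist (f (Inf (snd i))) (f (Sup (snd i)))) < \<epsilon>"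
  proof (rule AC[OF fin(2)])
    show "disjoint_family_on (\<lambda>i. {Inf (snd i)<..<Sup (snd i)}) P"
      using disj by (auto simp: P_def disjoint_family_on_def)
    show "a \<le> Inf (snd i) \<and> Inf (snd i) \<le> Sup (snd i) \<and> Sup (snd i) \<le> b" if "i \<in> P" for i
      using iK[of i] that by (auto simp: P_def)
    have "(\<Sum>i\<in>P. Sup (snd i) - Inf (snd i)) = (\<Sum>i\<in>P. measure lebesgue {Inf (snd i)<..<Sup (snd i)})"
    proof (rule sum.cong[OF refl])
      fix i assume "i \<in> P"
      then have "Inf (snd i) \<le> Sup (snd i)" using iK[of i] by (auto simp: P_def)
      then show "Sup (snd i) - Inf (snd i) = measure lebesgue {Inf (snd i)<..<Sup (snd i)}" by simp
    qed
    also have "\<dots> = measure lebesgue (\<Union>i\<in>P. {Inf (snd i)<..<Sup (snd i)})"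
      by (rule measure_UNION'[symmetric])
        (use fin disj in \<open>auto simp: P_def pairwise_def disjnt_def disjoint_family_on_def\<close>)
    also have "\<dots> \<le> measure lebesgue U"
    proof (rule measure_mono_fmeasurable[OF _ _ Um])
      show "(\<Union>i\<in>P. {Inf (snd i)<..<Sup (snd i)}) \<subseteq> U"
      proof (rule UN_least)
        fix i assume "i \<in> P"
        then have "i \<in> p" "g (fst i) \<subseteq> U" using g by (auto simp: P_def)
        then show "{Inf (snd i)<..<Sup (snd i)} \<subseteq> U"

          using iK[of i] greaterThanLessThan_subseteq_atLeastAtMost_iff[of "Inf (snd i)" "Sup (snd i)" "Inf (snd i)" "Sup (snd i)"] by auto
      qed
      show "(\<Union>i\<in>P. {Inf (snd i)<..<Sup (snd i)}) \<in> sets lebesgue"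
        by (rule sets.finite_UN[OF fin(2)]) simp
    qed
    finally show "(\<Sum>i\<in>P. Sup (snd i) - Inf (snd i)) < \<delta>" using Ud by simp
  qed
  moreover have "(\<Sum>i\<in>P. Re (f (Sup (snd i))) - Re (f (Inf (snd i)))) \<le> (\<Sum>i\<in>P. dist (f (Inf (snd i))) (f (Sup (snd i))))"
  proof (rule sum_mono)
    show "Re (f (Sup (snd i))) - Re (f (Inf (snd i))) \<le> dist (f (Inf (snd i))) (f (Sup (snd i)))" for i :: "real \<times> real set"
      using abs_Re_le_cmod[of "f (Sup (snd i)) - f (Inf (snd i))"] by (simp add: dist_norm norm_minus_commute)
  qed
  ultimately have 1: "(\<Sum>i\<in>P. Re (f (Sup (snd i))) - Re (f (Inf (snd i)))) \<le> \<epsilon>" by linarith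
  have "(\<Sum>i\<in>p-P. Re (f (Sup (snd i))) - Re (f (Inf (snd i)))) \<le> (\<Sum>i\<in>p-P. \<epsilon> * (Sup (snd i) - Inf (snd i)))"
  proof (rule sum_mono)
    fix i assume "i \<in> p - P"
    then have "i \<in> p" "fst i \<notin> N" by (auto simp: P_def)
    then show "Re (f (Sup (snd i))) - Re (f (Inf (snd i))) \<le> \<epsilon> * (Sup (snd i) - Inf (snd i))"
      using iK[of i] by (intro gD) auto
  qed
  also have "\<dots> \<le> (\<Sum>i\<in>p. \<epsilon> * (Sup (snd i) - Inf (snd i)))"
  proof (rule sum_mono2[OF fin(1)])
    fix i assume "i \<in> p - (p - P)"
    then have "Inf (snd i) \<le> Sup (snd i)" using iK[of i] by auto
    then show "0 \<le> \<epsilon> * (Sup (snd i) - Inf (snd i))" using e by simp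
  qed auto
  also have "\<dots> = \<epsilon> * (b - a)"
    using additive_tagged_division_1[OF ab p, of "\<lambda>x. x"] by (simp add: sum_distrib_left[symmetric] case_prod_beta)
  finally have 2: "(\<Sum>i\<in>p-P. Re (f (Sup (snd i))) - Re (f (Inf (snd i)))) \<le> \<epsilon> * (b - a)" .
  have "Re (f b) - Re (f a) = (\<Sum>i\<in>p. Re (f (Sup (snd i))) - Re (f (Inf (snd i))))"
    using additive_tagged_division_1[OF ab p, of "\<lambda>x. Re (f x)"] by (simp add: case_prod_beta)
  also have "\<dots> = (\<Sum>i\<in>p-P. Re (f (Sup (snd i))) - Re (f (Inf (snd i)))) + (\<Sum>i\<in>P. Re (f (Sup (snd i))) - Re (f (Inf (snd i))))"
    by (rule sum.subset_diff) (use fin in \<open>auto simp: P_def\<close>)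
  finally have "Re (f b) - Re (f a) \<le> \<epsilon> * (b - a) + \<epsilon>" using 1 2 by simp
  then show "Re (f b) \<le> Re (f a) + \<epsilon>'" using ee by simp
qed

text \<open>Split \<open>k\<close> into \<open>min k N\<close>, whose integral over a set is at most \<open>N\<close> times its measure, and a remainder
whose integral over the whole line is small when \<open>N\<close> is large.\<close>

lemma integral_small_on_small_intervals:
  fixes k :: "real \<Rightarrow> real"
  assumes k: "integrable lebesgue k" and k0: "\<And>t. 0 \<le> k t" and e: "\<epsilon> > 0"
  obtains \<delta> where "\<delta> > 0"
    "\<And>(n::nat) u v. \<lbrakk>\<And>i. i < n \<Longrightarrow> u i \<le> v i; disjoint_family_on (\<lambda>i. {u i<..<v i}) {..<n};
        (\<Sum>i<n. v i - u i) < \<delta>\<rbrakk> \<Longrightarrow> (\<Sum>i<n. primitive k (v i) - primitive k (u i)) < \<epsilon>"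
proof -
  define g where "g n t = k t - min (k t) (real n)" for n t
  have g0: "0 \<le> g n t" for n t by (simp add: g_def)
  have km: "k \<in> borel_measurable lebesgue" using k by (rule borel_measurable_integrable)
  have mm: "(\<lambda>t. min (k t) (real n)) \<in> borel_measurable lebesgue" for n
    by (intro borel_measurable_min km borel_measurable_const)
  have mi: "integrable lebesgue (\<lambda>t. min (k t) (real n))" for n
    by (rule Bochner_Integration.integrable_bound[OF k mm]) (use k0 in auto)
  have gi: "integrable lebesgue (g n)" for n
    unfolding g_def by (rule Bochner_Integration.integrable_diff[OF k mi])
  have "(\<lambda>n. LINT t|lebesgue. g n t) \<longlonglongrightarrow> (LINT t::real|lebesgue. (0::real))"
  proof (rule integral_dominated_convergence[where w=k])
    show "AE x in lebesgue. (\<lambda>n. g n x) \<longlonglongrightarrow> 0"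
    proof (rule AE_I2)
      fix x :: real
      obtain N where N: "k x \<le> real N" using real_arch_simple by blast
      have "\<forall>\<^sub>F n in sequentially. g n x = 0"
        using eventually_ge_at_top[of N]
      proof eventually_elim
        case (elim n)
        then have "k x \<le> real n" using N by (meson of_nat_le_iff order_trans)
        then show ?case by (simp add: g_def)
      qed
      then show "(\<lambda>n. g n x) \<longlonglongrightarrow> 0" by (rule tendsto_eventually)
    qed
    show "AE x in lebesgue. norm (g n x) \<le> k x" for n
      by (rule AE_I2) (use k0 in \<open>simp add: g_def\<close>)
  qed (use k gi in \<open>auto intro: borel_measurable_integrable\<close>)
  then have "(\<lambda>n. LINT t|lebesgue. g n t) \<longlonglongrightarrow> 0" by simp
  then have "\<forall>\<^sub>F n in sequentially. (LINT t|lebesgue. g n t) < \<epsilon> / 2"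
    using e by (intro order_tendstoD) auto
  then obtain N where N: "(LINT t|lebesgue. g N t) < \<epsilon> / 2" by (auto simp: eventually_sequentially)
  define \<delta> where "\<delta> = \<epsilon> / (2 * (real N + 1))"
  show thesis
  proof (rule that)
    show "\<delta> > 0" using e by (simp add: \<delta>_def)
    fix n :: nat and u v :: "nat \<Rightarrow> real"
    assume uv: "\<And>i. i < n \<Longrightarrow> u i \<le> v i" and dj: "disjoint_family_on (\<lambda>i. {u i<..<v i}) {..<n}"
      and len: "(\<Sum>i<n. v i - u i) < \<delta>"
    have gint: "integrable lebesgue (\<lambda>x. indicator {u i<..<v i} x *\<^sub>R g N x)" for i
      using set_integrable_of_integrable[OF gi, of "{u i<..<v i}" N] by (simp add: set_integrable_def)
    have "(\<Sum>i<n. primitive k (v i) - primitive k (u i)) \<le> (\<Sum>i<n. (LINT x:{u i<..<v i}|lebesgue. g N x) + real N * (v i - u i))"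
    proof (rule sum_mono)
      fix i assume i: "i \<in> {..<n}"
      have lm: "{u i<..<v i} \<in> lmeasurable" by (metis box_real(1) lmeasurable_box)
      have nint: "set_integrable lebesgue {u i<..<v i} (\<lambda>x. real N)"
        unfolding set_integrable_def
        by (rule integrable_scaleR_left) (rule integrable_real_indicator, use lm in \<open>auto simp: fmeasurable_def\<close>)
      have gsint: "set_integrable lebesgue {u i<..<v i} (g N)"
        by (rule set_integrable_of_integrable[OF gi]) simp
      have "primitive k (v i) - primitive k (u i) = (LINT x:{u i<..<v i}|lebesgue. k x)"
        using uv i by (intro primitive_diff(2)[OF k]) auto
      also have "\<dots> \<le> (LINT x:{u i<..<v i}|lebesgue. g N x + real N)"
      proof (rule set_integral_mono)
        show "set_integrable lebesgue {u i<..<v i} k" by (rule set_integrable_of_integrable[OF k]) simp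
        show "set_integrable lebesgue {u i<..<v i} (\<lambda>x. g N x + real N)" by (rule set_integral_add(1)[OF gsint nint])
        show "k x \<le> g N x + real N" for x by (simp add: g_def)
      qed
      also have "\<dots> = (LINT x:{u i<..<v i}|lebesgue. g N x) + (LINT x:{u i<..<v i}|lebesgue. real N)"
        by (rule set_integral_add(2)[OF gsint nint])
      also have "(LINT x:{u i<..<v i}|lebesgue. real N) = real N * (v i - u i)"
      proof -
        have "emeasure lebesgue {u i<..<v i} \<noteq> \<infinity>" using lm by (simp add: fmeasurable_def)
        then have "(LINT x:{u i<..<v i}|lebesgue. real N) = measure lebesgue {u i<..<v i} *\<^sub>R real N"
          by (intro set_integral_const) auto
        then show ?thesis using uv[of i] i by simp
      qed

      finally show "primitive k (v i) - primitive k (u i) \<le> (LINT x:{u i<..<v i}|lebesgue. g N x) + real N * (v i - u i)" .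
    qed
    also have "\<dots> = (\<Sum>i<n. LINT x:{u i<..<v i}|lebesgue. g N x) + real N * (\<Sum>i<n. v i - u i)"
      by (simp add: sum.distrib sum_distrib_left)
    also have "(\<Sum>i<n. LINT x:{u i<..<v i}|lebesgue. g N x) = (LINT x|lebesgue. (\<Sum>i<n. indicator {u i<..<v i} x *\<^sub>R g N x))"
      unfolding set_lebesgue_integral_def by (rule Bochner_Integration.integral_sum[symmetric]) (rule gint)
    also have "\<dots> \<le> (LINT x|lebesgue. g N x)"
    proof (rule integral_mono)
      fix x
      have "(\<Sum>i<n. indicator {u i<..<v i} x *\<^sub>R g N x) = (\<Sum>i<n. indicator {u i<..<v i} x) * g N x"
        by (simp add: sum_distrib_right)
      also have "(\<Sum>i<n. indicator {u i<..<v i} x) = indicat_real (\<Union>i<n. {u i<..<v i}) x"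
        by (rule indicator_UN_disjoint[symmetric]) (use dj in auto)
      finally show "(\<Sum>i<n. indicator {u i<..<v i} x *\<^sub>R g N x) \<le> g N x"
        using g0[of N x] by (auto simp: indicator_def)
    qed (rule Bochner_Integration.integrable_sum[OF gint], rule gi)
    also have "real N * (\<Sum>i<n. v i - u i) \<le> real N * \<delta>" using len by (intro mult_left_mono) auto
    also have "real N * \<delta> \<le> \<epsilon> / 2" using e by (simp add: \<delta>_def field_simps)
    finally show "(\<Sum>i<n. primitive k (v i) - primitive k (u i)) < \<epsilon>" using N by linarith
  qed
qed

lemma primitive_mono:
  fixes k :: "real \<Rightarrow> real"
  assumes k: "integrable lebesgue k" and k0: "\<And>t. 0 \<le> k t" and st: "s \<le> t"
  shows "primitive k s \<le> primitive k t"
proof -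
  have "0 \<le> (LINT x:{s..t}|lebesgue. k x)"
    unfolding set_lebesgue_integral_def
    by (rule Bochner_Integration.integral_nonneg) (simp add: k0)
  then show ?thesis using primitive_diff(1)[OF k st] by simp
qed

lemma norm_primitive_diff_le:
  fixes f :: "real \<Rightarrow> 'b::euclidean_space" and k :: "real \<Rightarrow> real"
  assumes f: "integrable lebesgue f" and k: "integrable lebesgue k"
    and le: "AE t in lebesgue. t \<in> {s..s'} \<longrightarrow> norm (f t) \<le> k t" and st: "s \<le> s'"
  shows "norm (primitive f s' - primitive f s) \<le> primitive k s' - primitive k s"
proof -
  have fi: "integrable lebesgue (\<lambda>x. indicator {s..s'} x *\<^sub>R f x)"
    using set_integrable_of_integrable[OF f, of "{s..s'}"] by (simp add: set_integrable_def)
  have ki: "integrable lebesgue (\<lambda>x. indicator {s..s'} x *\<^sub>R k x)"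
    using set_integrable_of_integrable[OF k, of "{s..s'}"] by (simp add: set_integrable_def)
  have "norm (LINT x:{s..s'}|lebesgue. f x) \<le> (LINT x|lebesgue. norm (indicat_real {s..s'} x *\<^sub>R f x))"
    unfolding set_lebesgue_integral_def by (rule integral_norm_bound)
  also have "\<dots> \<le> (LINT x:{s..s'}|lebesgue. k x)"
    unfolding set_lebesgue_integral_def
  proof (rule integral_mono_AE[OF integrable_norm[OF fi] ki])
    show "AE x in lebesgue. norm (indicat_real {s..s'} x *\<^sub>R f x) \<le> indicat_real {s..s'} x *\<^sub>R k x"
      using le by eventually_elim (auto simp: indicator_def)
  qed
  finally show ?thesis
    using primitive_diff(1)[OF f st] primitive_diff(1)[OF k st] by simp
qed

lemma abs_continuous_on_dominated:
  fixes k :: "real \<Rightarrow> real"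
  assumes k: "integrable lebesgue k" and k0: "\<And>t. 0 \<le> k t"
    and le: "\<And>s t. \<lbrakk>a \<le> s; s \<le> t; t \<le> b\<rbrakk> \<Longrightarrow> norm (f t - f s) \<le> primitive k t - primitive k s"
  shows "abs_continuous_on a b f"
  unfolding abs_continuous_on_def
proof (intro allI impI)
  fix \<epsilon> :: real assume e: "\<epsilon> > 0"
  obtain \<delta> where d: "\<delta> > 0" and D:
    "\<And>(n::nat) u v. \<lbrakk>\<And>i. i < n \<Longrightarrow> u i \<le> v i; disjoint_family_on (\<lambda>i. {u i<..<v i}) {..<n};
        (\<Sum>i<n. v i - u i) < \<delta>\<rbrakk> \<Longrightarrow> (\<Sum>i<n. primitive k (v i) - primitive k (u i)) < \<epsilon>"
    by (rule integral_small_on_small_intervals[OF k k0 e]) blast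
  show "\<exists>\<delta>>0. \<forall>(n::nat) u v.
        (\<forall>i<n. a \<le> u i \<and> u i \<le> v i \<and> v i \<le> b) \<and>
        disjoint_family_on (\<lambda>i. {u i<..<v i}) {..<n} \<and>
        (\<Sum>i<n. v i - u i) < \<delta> \<longrightarrow>
        (\<Sum>i<n. dist (f (u i)) (f (v i))) < \<epsilon>"
  proof (intro exI[of _ \<delta>] conjI d allI impI)
    fix n :: nat and u v :: "nat \<Rightarrow> real"
    assume A: "(\<forall>i<n. a \<le> u i \<and> u i \<le> v i \<and> v i \<le> b) \<and>
        disjoint_family_on (\<lambda>i. {u i<..<v i}) {..<n} \<and> (\<Sum>i<n. v i - u i) < \<delta>"
    have "(\<Sum>i<n. dist (f (u i)) (f (v i))) \<le> (\<Sum>i<n. primitive k (v i) - primitive k (u i))"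
    proof (rule sum_mono)
      fix i assume "i \<in> {..<n}"
      then show "dist (f (u i)) (f (v i)) \<le> primitive k (v i) - primitive k (u i)"
        using le[of "u i" "v i"] A by (simp add: dist_norm norm_minus_commute)
    qed
    also have "\<dots> < \<epsilon>" by (rule D) (use A in auto)
    finally show "(\<Sum>i<n. dist (f (u i)) (f (v i))) < \<epsilon>" .
  qed
qed

lemma abs_continuous_on_primitive:
  fixes f :: "real \<Rightarrow> complex"
  assumes f: "integrable lebesgue f"
  shows "abs_continuous_on a b (primitive f)"
  by (rule abs_continuous_on_dominated[where k="\<lambda>t. norm (f t)"])
    (auto intro!: norm_primitive_diff_le f integrable_norm)

lemma abs_continuous_on_of_real_primitive:
  fixes k :: "real \<Rightarrow> real"
  assumes k: "integrable lebesgue k" and k0: "\<And>t. 0 \<le> k t"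
  shows "abs_continuous_on a b (\<lambda>t. complex_of_real (primitive k t))"
proof (rule abs_continuous_on_dominated[OF k k0])
  fix s t assume "a \<le> s" "s \<le> t" "t \<le> b"
  then have "primitive k s \<le> primitive k t" by (intro primitive_mono k k0)
  then show "norm (complex_of_real (primitive k t) - complex_of_real (primitive k s)) \<le> primitive k t - primitive k s"
    by (simp add: of_real_diff[symmetric] del: of_real_diff)
qed

lemma continuous_on_UNIV_if_abs_continuous:
  assumes "\<And>a b. abs_continuous_on a b f"
  shows "continuous_on UNIV f"
proof -
  have "isCont f x" for x
  proof -
    have "continuous_on {x-1<..<x+1} f"
      by (rule continuous_on_subset[OF abs_continuous_on_imp_continuous_on[OF assms[of "x-1" "x+1"]]]) auto
    then show ?thesis by (simp add: continuous_on_eq_continuous_at)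
  qed
  then show ?thesis by (simp add: continuous_on_eq_continuous_at)
qed

lemma continuous_on_primitive:
  fixes k :: "real \<Rightarrow> real"
  assumes k: "integrable lebesgue k" and k0: "\<And>t. 0 \<le> k t"
  shows "continuous_on S (primitive k)"
proof -
  have "continuous_on UNIV (\<lambda>t. Re (complex_of_real (primitive k t)))"
    by (intro continuous_on_Re continuous_on_UNIV_if_abs_continuous abs_continuous_on_of_real_primitive k k0)
  then have "continuous_on UNIV (primitive k)" by simp
  then show ?thesis by (rule continuous_on_subset) simp
qed

text \<open>Monotonicity of the real part, applied to \<open>c * f\<close> for \<open>c = 1, -1, \<i>, -\<i>\<close>.\<close>

lemma abs_continuous_on_derivative_zero_imp_constant:
  assumes f: "abs_continuous_on a b f"
    and D: "AE x in lebesgue. x \<in> {a..b} \<longrightarrow> (f has_vector_derivative 0) (at x within {a..b})"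
    and st: "s \<in> {a..b}" "t \<in> {a..b}"
  shows "f s = f t"
proof -
  have main: "f p = f q" if pq: "a \<le> p" "p \<le> q" "q \<le> b" for p q
  proof -
    have le: "Re (c * f q) \<le> Re (c * f p)" if c: "norm c = 1" for c
    proof (rule abs_continuous_on_Re_antimono[OF pq(2)])
      show "abs_continuous_on p q (\<lambda>t. c * f t)"
        by (rule abs_continuous_on_mult[OF abs_continuous_on_const abs_continuous_on_subinterval[OF f pq(1,3)]])
      show "AE x in lebesgue. x \<in> {p..q} \<longrightarrow> (\<exists>D. ((\<lambda>t. c * f t) has_vector_derivative D) (at x within {p..q}) \<and> Re D \<le> 0)"
        using D
      proof eventually_elim
        case (elim x)
        show ?case
        proof
          assume x: "x \<in> {p..q}"
          then have "(f has_vector_derivative 0) (at x within {p..q})"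
            using elim pq by (auto intro: has_vector_derivative_within_subset)
          then have "((\<lambda>t. c * f t) has_vector_derivative c * 0) (at x within {p..q})"
            by (intro has_vector_derivative_mult_right)
          then show "\<exists>D. ((\<lambda>t. c * f t) has_vector_derivative D) (at x within {p..q}) \<and> Re D \<le> 0" by auto
        qed
      qed
    qed
    from le[of 1] le[of "-1"] le[of "\<i>"] le[of "-\<i>"] show ?thesis by (simp add: complex_eq_iff)
  qed
  show ?thesis
  proof (cases "s \<le> t")
    case True
    then show ?thesis using st by (intro main) auto
  next
    case False
    then have "f t = f s" using st by (intro main) auto
    then show ?thesis by (rule sym)
  qed
qed

text \<open>The fundamental theorem of calculus: \<open>f - primitive h\<close> is absolutely continuous and its derivative
vanishes almost everywhere.\<close>

lemma abs_continuous_on_eq_primitive: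
  assumes f: "abs_continuous_on a b f" and h: "integrable lebesgue h"
    and D: "AE x in lebesgue. x \<in> {a..b} \<longrightarrow> (f has_vector_derivative h x) (at x within {a..b})"
    and st: "s \<in> {a..b}" "t \<in> {a..b}"
  shows "f t - f s = primitive h t - primitive h s"
proof -
  have "f s - primitive h s = f t - primitive h t"
  proof (rule abs_continuous_on_derivative_zero_imp_constant[OF _ _ st, of "\<lambda>t. f t - primitive h t"])
    show "abs_continuous_on a b (\<lambda>t. f t - primitive h t)"
      by (rule abs_continuous_on_diff[OF f abs_continuous_on_primitive[OF h]])
    show "AE x in lebesgue. x \<in> {a..b} \<longrightarrow> ((\<lambda>t. f t - primitive h t) has_vector_derivative 0) (at x within {a..b})"
      using D AE_primitive_has_vector_derivative[OF h]
    proof eventually_elim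
      case (elim x)
      show ?case
      proof
        assume "x \<in> {a..b}"
        then have "((\<lambda>t. f t - primitive h t) has_vector_derivative h x - h x) (at x within {a..b})"
          using elim by (intro has_vector_derivative_diff) (auto intro: has_vector_derivative_at_within)
        then show "((\<lambda>t. f t - primitive h t) has_vector_derivative 0) (at x within {a..b})" by simp
      qed
    qed
  qed
  then show ?thesis by (simp add: algebra_simps)
qed

lemma abs_continuous_on_exp:
  assumes f: "abs_continuous_on a b f"
  shows "abs_continuous_on a b (\<lambda>t. exp (f t))"
proof -
  obtain A where A: "A > 0" "\<forall>t\<in>{a..b}. norm (f t) \<le> A" using abs_continuous_on_bounded[OF f] by blast
  show ?thesis
  proof (rule abs_continuous_on_combine[OF f f, of _ "exp A"])
    fix s t assume st: "a \<le> s" "s \<le> t" "t \<le> b"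
    have "norm (exp (f s) - exp (f t)) \<le> exp A * norm (f s - f t)"
    proof (rule field_differentiable_bound[of "cball 0 A" exp exp])
      show "(exp has_field_derivative exp z) (at z within cball 0 A)" for z :: complex
        by (rule DERIV_exp[THEN has_field_derivative_at_within])
      show "norm (exp z) \<le> exp A" if "z \<in> cball 0 A" for z :: complex
        using that norm_exp[of z] exp_le_cancel_iff[of "norm z" A] by (simp del: exp_le_cancel_iff)
    qed (use A st in auto)
    also have "\<dots> \<le> exp A * (dist (f s) (f t) + dist (f s) (f t))"
      by (intro mult_left_mono) (auto simp: dist_norm)
    finally show "dist (exp (f s)) (exp (f t)) \<le> exp A * (dist (f s) (f t) + dist (f s) (f t))"
      by (simp add: dist_norm)
  qed
qed

lemma measurable_continuous:
  fixes u :: "real \<Rightarrow> 'b::topological_space"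
  assumes "continuous_on UNIV u"
  shows "u \<in> borel_measurable lebesgue"
proof -
  have "u \<in> borel_measurable lborel"
    using borel_measurable_continuous_onI[OF assms] by simp
  then show ?thesis by (rule measurable_completion)
qed

lemma primitive_subtract:
  fixes f g :: "real \<Rightarrow> 'b::euclidean_space"
  assumes f: "integrable lebesgue f" and g: "integrable lebesgue g"
  shows "primitive (\<lambda>t. f t - g t) t = primitive f t - primitive g t"
  unfolding primitive_def
  by (rule set_integral_diff(2)) (intro set_integrable_of_integrable f g, simp)+

lemma primitive_of_real:
  "primitive (\<lambda>t. complex_of_real (k t)) t = complex_of_real (primitive k t)"
  unfolding primitive_def by (rule set_integral_complex_of_real)

lemma primitive_bounds:
  fixes k :: "real \<Rightarrow> real"
  assumes k: "integrable lebesgue k" and k0: "\<And>t. 0 \<le> k t"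
  shows "0 \<le> primitive k t" "primitive k t \<le> integral\<^sup>L lebesgue k"
proof -
  show "0 \<le> primitive k t"
    unfolding primitive_def set_lebesgue_integral_def
    by (rule Bochner_Integration.integral_nonneg) (simp add: k0)
  have i: "integrable lebesgue (\<lambda>x. indicat_real {..t} x *\<^sub>R k x)"
    using set_integrable_of_integrable[OF k, of "{..t}"] by (simp add: set_integrable_def)
  show "primitive k t \<le> integral\<^sup>L lebesgue k"
    unfolding primitive_def set_lebesgue_integral_def
    by (rule integral_mono[OF i k]) (simp add: k0 indicator_def)
qed

text \<open>By the chain rule \<open>exp (c * (primitive k s - r)) / c\<close> has derivative \<open>k s * exp (c * (primitive k s - r))\<close>
almost everywhere. Exponentials of this form are the weights that make the Picard operator a contraction.\<close>

lemma primitive_times_exp: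
  fixes k :: "real \<Rightarrow> real"
  assumes k: "integrable lebesgue k" and k0: "\<And>t. 0 \<le> k t" and c: "c \<noteq> 0"
  shows "integrable lebesgue (\<lambda>s. k s * exp (c * (primitive k s - r)))" (is "integrable lebesgue ?W")
    and "\<And>a b. a \<le> b \<Longrightarrow> primitive (\<lambda>s. k s * exp (c * (primitive k s - r))) b - primitive (\<lambda>s. k s * exp (c * (primitive k s - r))) a
        = (exp (c * (primitive k b - r)) - exp (c * (primitive k a - r))) / c"
proof -
  let ?K = "primitive k"
  define M where "M = integral\<^sup>L lebesgue k"
  have K: "\<bar>?K t\<bar> \<le> M" for t
    using primitive_bounds[OF k k0, of t] by (simp add: M_def)
  have kc: "continuous_on UNIV (\<lambda>s. exp (c * (?K s - r)))"
    by (intro continuous_intros continuous_on_primitive k k0)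
  then have em: "(\<lambda>s. exp (c * (?K s - r))) \<in> borel_measurable lebesgue"
    by (rule measurable_continuous)
  have eb: "exp (c * (?K s - r)) \<le> exp (\<bar>c\<bar> * (M + \<bar>r\<bar>))" for s
  proof -
    have "c * (?K s - r) \<le> \<bar>c\<bar> * \<bar>?K s - r\<bar>" by (metis abs_ge_self abs_mult)
    also have "\<dots> \<le> \<bar>c\<bar> * (M + \<bar>r\<bar>)" using K[of s] by (intro mult_left_mono) auto
    finally show ?thesis by simp
  qed
  show W: "integrable lebesgue ?W"
  proof (rule Bochner_Integration.integrable_bound)
    show "integrable lebesgue (\<lambda>s. k s * exp (\<bar>c\<bar> * (M + \<bar>r\<bar>)))" using k by simp
    show "?W \<in> borel_measurable lebesgue"
      using borel_measurable_integrable[OF k] em by (rule borel_measurable_times)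
    show "AE s in lebesgue. norm (?W s) \<le> norm (k s * exp (\<bar>c\<bar> * (M + \<bar>r\<bar>)))"
    proof (rule AE_I2)
      fix s
      have "k s * exp (c * (?K s - r)) \<le> k s * exp (\<bar>c\<bar> * (M + \<bar>r\<bar>))" using eb k0 by (rule mult_left_mono)
      then show "norm (?W s) \<le> norm (k s * exp (\<bar>c\<bar> * (M + \<bar>r\<bar>)))" using k0[of s] by simp
    qed
  qed
  fix a b :: real assume ab: "a \<le> b"
  define f where "f s = exp (of_real c * (complex_of_real (?K s) - of_real r)) / of_real c" for s
  have ACf: "abs_continuous_on a b f" unfolding f_def divide_inverse
    by (intro abs_continuous_on_mult abs_continuous_on_exp abs_continuous_on_diff abs_continuous_on_const
        abs_continuous_on_of_real_primitive k k0)
  have "f b - f a = primitive (\<lambda>s. complex_of_real (?W s)) b - primitive (\<lambda>s. complex_of_real (?W s)) a"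
  proof (rule abs_continuous_on_eq_primitive[OF ACf])
    show "integrable lebesgue (\<lambda>s. complex_of_real (?W s))" using W by (rule integrable_of_real)
    show "AE x in lebesgue. x \<in> {a..b} \<longrightarrow> (f has_vector_derivative complex_of_real (?W x)) (at x within {a..b})"
      using AE_primitive_has_vector_derivative[OF k]
    proof eventually_elim
      case (elim x)
      then have "(?K has_real_derivative k x) (at x)" by (simp add: has_real_derivative_iff_has_vector_derivative)
      then have "((\<lambda>s. exp (c * (?K s - r)) / c) has_real_derivative ?W x) (at x)"
        using c by (auto intro!: derivative_eq_intros)
      then have "((\<lambda>s. complex_of_real (exp (c * (?K s - r)) / c)) has_vector_derivative complex_of_real (?W x)) (at x)"
        by (rule has_vector_derivative_of_real)
      moreover have "(\<lambda>s. complex_of_real (exp (c * (?K s - r)) / c)) = f"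
        by (simp add: f_def fun_eq_iff exp_of_real[symmetric])
      ultimately show ?case by (auto intro: has_vector_derivative_at_within)
    qed
  qed (use ab in auto)
  moreover have "f s = complex_of_real (exp (c * (?K s - r)) / c)" for s
    by (simp add: f_def exp_of_real[symmetric])
  ultimately have "complex_of_real ((exp (c * (?K b - r)) - exp (c * (?K a - r))) / c) = complex_of_real (primitive ?W b - primitive ?W a)"
    unfolding primitive_of_real by (simp add: diff_divide_distrib)
  then show "primitive ?W b - primitive ?W a = (exp (c * (?K b - r)) - exp (c * (?K a - r))) / c"
    by (simp only: of_real_eq_iff)
qed

text \<open>After a rotation the increment \<open>f b - f a\<close> is a nonnegative real number; then
\<open>Re f - C * primitive k\<close> is decreasing. The derivative is bounded pointwise and never integrated, so the
lemma applies to solutions of the partial differential equation without any measurability in time of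
their \<open>z\<close>-derivatives.\<close>

lemma abs_continuous_on_derivative_bound:
  fixes k :: "real \<Rightarrow> real"
  assumes ab: "a \<le> b" and f: "abs_continuous_on a b f"
    and k: "integrable lebesgue k" and k0: "\<And>t. 0 \<le> k t"
    and D: "AE x in lebesgue. x \<in> {a..b} \<longrightarrow> (\<exists>D. (f has_vector_derivative D) (at x within {a..b}) \<and> norm D \<le> C * k x)"
  shows "norm (f b - f a) \<le> C * (primitive k b - primitive k a)"
proof -
  let ?K = "primitive k"
  have key: "Re (c * f b - of_real (C * ?K b)) \<le> Re (c * f a - of_real (C * ?K a))" if c: "norm c = 1" for c
  proof (rule abs_continuous_on_Re_antimono[OF ab])
    show "abs_continuous_on a b (\<lambda>t. c * f t - of_real (C * ?K t))"
      unfolding of_real_mult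
      by (intro abs_continuous_on_diff abs_continuous_on_mult abs_continuous_on_const f
          abs_continuous_on_of_real_primitive k k0)
    show "AE x in lebesgue. x \<in> {a..b} \<longrightarrow> (\<exists>D. ((\<lambda>t. c * f t - of_real (C * ?K t)) has_vector_derivative D) (at x within {a..b}) \<and> Re D \<le> 0)"
      using D AE_primitive_has_vector_derivative[OF k]
    proof eventually_elim
      case (elim x)
      show ?case
      proof
        assume "x \<in> {a..b}"
        then obtain D where D: "(f has_vector_derivative D) (at x within {a..b})" "norm D \<le> C * k x"
          using elim(1) by blast
        have "((\<lambda>t. of_real (C * ?K t)) has_vector_derivative (of_real (C * k x) :: complex)) (at x within {a..b})"
          using bounded_linear.has_vector_derivative[OF bounded_linear_of_real
              has_vector_derivative_mult_right[OF has_vector_derivative_at_within[OF elim(2)]]] by blast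
        then have "((\<lambda>t. c * f t - of_real (C * ?K t)) has_vector_derivative c * D - of_real (C * k x)) (at x within {a..b})"
          by (intro has_vector_derivative_diff has_vector_derivative_mult_right D(1))
        moreover have "Re (c * D) \<le> norm (c * D)" by (rule complex_Re_le_cmod)
        then have "Re (c * D - of_real (C * k x)) \<le> 0" using D(2) by (simp add: norm_mult c)
        ultimately show "\<exists>D. ((\<lambda>t. c * f t - of_real (C * ?K t)) has_vector_derivative D) (at x within {a..b}) \<and> Re D \<le> 0"
          by blast
      qed
    qed
  qed
  define v where "v = f b - f a"
  define c where "c = (if v = 0 then 1 else cnj v / of_real (norm v))"
  have c: "norm c = 1" by (simp add: c_def norm_divide)
  have "c * v = of_real (norm v)"
  proof (cases "v = 0")
    case False
    have "cnj v * v = of_real ((norm v)^2)" by (metis complex_norm_square mult.commute)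
    then show ?thesis using False by (simp add: c_def power2_eq_square)
  qed (simp add: c_def)
  then have "c * f b = c * f a + of_real (norm v)" by (simp add: v_def algebra_simps)
  then have "Re (c * f b) = Re (c * f a) + norm v" by simp
  then show ?thesis using key[OF c] by (simp add: v_def algebra_simps)
qed

lemma quadratic_bound_derivative_zero:
  fixes K :: "real \<Rightarrow> real"
  assumes K: "(K has_vector_derivative K') (at s)"
    and q: "\<forall>\<^sub>F t in at s within S. norm (h t - h s) \<le> C * (K t - K s)^2"
  shows "(h has_vector_derivative 0) (at s within S)"
proof -
  have K1: "(K has_field_derivative K') (at s within S)"
    using has_vector_derivative_at_within[OF K] by (simp add: has_real_derivative_iff_has_vector_derivative)
  have "((\<lambda>t. norm (h t - h s) / \<bar>t - s\<bar>) \<longlongrightarrow> 0) (at s within S)"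
  proof (rule Lim_null_comparison)
    show "\<forall>\<^sub>F t in at s within S. norm (norm (h t - h s) / \<bar>t - s\<bar>) \<le> C * (\<bar>(K t - K s) / (t - s)\<bar> * \<bar>K t - K s\<bar>)"
      using q
    proof eventually_elim
      case (elim t)
      have "C * (\<bar>(K t - K s) / (t - s)\<bar> * \<bar>K t - K s\<bar>) = C * (K t - K s)^2 / \<bar>t - s\<bar>"
      proof -
        have eq: "\<bar>(K t - K s) / (t - s)\<bar> * \<bar>K t - K s\<bar> = (K t - K s)^2 / \<bar>t - s\<bar>"
          by (metis abs_divide power2_eq_square power2_abs times_divide_eq_left)
        show ?thesis unfolding eq by simp
      qed
      moreover have "norm (h t - h s) / \<bar>t - s\<bar> \<le> C * (K t - K s)^2 / \<bar>t - s\<bar>"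
        using elim by (rule divide_right_mono) simp
      moreover have "norm (norm (h t - h s) / \<bar>t - s\<bar>) = norm (h t - h s) / \<bar>t - s\<bar>" by simp
      ultimately show ?case by (simp only:)
    qed
    have l1: "((\<lambda>t. (K t - K s) / (t - s)) \<longlongrightarrow> K') (at s within S)"
      using K1 by (simp add: has_field_derivative_iff)
    have "continuous (at s within S) K" using K1 by (rule DERIV_continuous)
    then have "((\<lambda>t. K t - K s) \<longlongrightarrow> 0) (at s within S)" by (intro LIM_zero) (simp add: continuous_within)
    then have "((\<lambda>t. C * (\<bar>(K t - K s) / (t - s)\<bar> * \<bar>K t - K s\<bar>)) \<longlongrightarrow> C * (\<bar>K'\<bar> * \<bar>0\<bar>)) (at s within S)"
      by (intro tendsto_mult tendsto_const tendsto_rabs l1)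
    then show "((\<lambda>t. C * (\<bar>(K t - K s) / (t - s)\<bar> * \<bar>K t - K s\<bar>)) \<longlongrightarrow> 0) (at s within S)" by simp
  qed
  then have "((\<lambda>t. norm (h t - h s - (t - s) *\<^sub>R 0) / norm (t - s)) \<longlongrightarrow> 0) (at s within S)" by simp
  then show ?thesis
    unfolding has_vector_derivative_def has_derivative_iff_norm by (simp add: bounded_linear_zero)
qed

text \<open>An estimate that is quadratic in the increments of \<open>primitive k\<close> replaces the computation of a
derivative: \<open>h\<close> is absolutely continuous, and its derivative vanishes wherever \<open>primitive k\<close> is
differentiable.\<close>

lemma quadratic_bound_imp_constant:
  fixes k :: "real \<Rightarrow> real" and h :: "real \<Rightarrow> complex"
  assumes ab: "a \<le> b" and k: "integrable lebesgue k" and k0: "\<And>t. 0 \<le> k t" and C: "0 \<le> C"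
    and q: "\<And>s t. \<lbrakk>a \<le> s; s \<le> t; t \<le> b\<rbrakk> \<Longrightarrow> norm (h t - h s) \<le> C * (primitive k t - primitive k s)^2"
  shows "h a = h b"
proof -
  let ?K = "primitive k"
  define M where "M = integral\<^sup>L lebesgue k"
  have Kd: "0 \<le> ?K t - ?K s" "?K t - ?K s \<le> M" if "s \<le> t" for s t
    using primitive_mono[OF k k0 that] primitive_bounds[OF k k0, of t] primitive_bounds[OF k k0, of s]
    by (auto simp: M_def)
  have q': "norm (h t - h s) \<le> C * (?K t - ?K s)^2" if "s \<in> {a..b}" "t \<in> {a..b}" for s t
  proof (cases "s \<le> t")
    case True
    then show ?thesis using that by (intro q) auto
  next
    case False
    then have "norm (h s - h t) \<le> C * (?K s - ?K t)^2" using that by (intro q) auto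
    then show ?thesis by (simp only: norm_minus_commute power2_commute)
  qed
  show ?thesis
  proof (rule abs_continuous_on_derivative_zero_imp_constant[where f=h and a=a and b=b and s=a and t=b])
    show "abs_continuous_on a b h"
    proof (rule abs_continuous_on_combine[OF abs_continuous_on_of_real_primitive[OF k k0] abs_continuous_on_of_real_primitive[OF k k0], where C="C * M"])
      fix s t assume st: "a \<le> s" "s \<le> t" "t \<le> b"
      have "dist (h s) (h t) \<le> C * ((?K t - ?K s) * (?K t - ?K s))"
        using q[OF st] by (simp add: dist_norm norm_minus_commute power2_eq_square)
      also have "\<dots> \<le> C * (M * (?K t - ?K s))"
        using Kd[OF st(2)] C by (intro mult_left_mono mult_right_mono) auto
      also have "?K t - ?K s = dist (complex_of_real (?K s)) (of_real (?K t))"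
        using Kd(1)[OF st(2)] by (simp add: dist_norm norm_minus_commute flip: of_real_diff)
      finally have "dist (h s) (h t) \<le> C * (M * dist (complex_of_real (?K s)) (of_real (?K t)))" .
      also have "\<dots> \<le> C * (M * (dist (complex_of_real (?K s)) (of_real (?K t)) + dist (complex_of_real (?K s)) (of_real (?K t))))"
        using C Kd[OF order_refl] by (intro mult_left_mono) auto
      finally show "dist (h s) (h t) \<le> C * M * (dist (complex_of_real (?K s)) (of_real (?K t)) + dist (complex_of_real (?K s)) (of_real (?K t)))"
        by (simp only: mult.assoc)
    qed
    show "AE x in lebesgue. x \<in> {a..b} \<longrightarrow> (h has_vector_derivative 0) (at x within {a..b})"
      using AE_primitive_has_vector_derivative[OF k]
    proof eventually_elim
      case (elim x)
      show ?case
      proof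
        assume "x \<in> {a..b}"
        then show "(h has_vector_derivative 0) (at x within {a..b})"
          by (intro quadratic_bound_derivative_zero[OF elim, where C=C])
            (auto simp: eventually_at_filter intro!: always_eventually q')
      qed
    qed
  qed (use ab in auto)
qed

section \<open>Caratheodory differential equations\<close>

text \<open>One function \<open>k\<close>, integrable over the whole line, serves both as a bound and as a Lipschitz constant.
Solutions then exist for all times, in both directions.\<close>

locale caratheodory_field =
  fixes V :: "complex \<Rightarrow> real \<Rightarrow> complex" and k :: "real \<Rightarrow> real"
  assumes k_integrable: "integrable lebesgue k" and k_nonneg: "0 \<le> k t"
    and V_measurable: "V z \<in> borel_measurable lebesgue"
    and V_bound: "norm (V z t) \<le> k t"
    and V_lipschitz: "norm (V z t - V w t) \<le> k t * norm (z - w)"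
begin

text \<open>For a simple function \<open>u\<close> this is a countable case distinction; the general case follows by pointwise
approximation, since \<open>V\<close> is continuous in its first argument.\<close>

lemma superposition_measurable:
  assumes u: "u \<in> borel_measurable lebesgue"
  shows "(\<lambda>t. V (u t) t) \<in> borel_measurable lebesgue"
proof -
  obtain F where F: "\<And>i::nat. simple_function lebesgue (F i)" "\<And>x. (\<lambda>i. F i x) \<longlonglongrightarrow> u x"
    using borel_measurable_implies_sequence_metric[OF u, of 0] by auto
  show ?thesis
  proof (rule borel_measurable_LIMSEQ_metric[where f="\<lambda>i t. V (F i t) t"])
    fix i
    show "(\<lambda>t. V (F i t) t) \<in> borel_measurable lebesgue"
    proof (rule measurable_compose_countable'[where f=V and g="F i" and I="range (F i)"])
      have fin: "finite (range (F i))" using F(1)[of i] by (simp add: simple_function_def)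
      then show "countable (range (F i))" by (rule countable_finite)
      show "F i \<in> lebesgue \<rightarrow>\<^sub>M count_space (range (F i))"
        using F(1)[of i] fin by (subst measurable_count_space_eq2) (auto simp: simple_function_def)
    qed (rule V_measurable)
  next
    fix t
    show "(\<lambda>i. V (F i t) t) \<longlonglongrightarrow> V (u t) t"
    proof (rule LIM_zero_cancel, rule Lim_null_comparison)
      show "\<forall>\<^sub>F i in sequentially. norm (V (F i t) t - V (u t) t) \<le> k t * norm (F i t - u t)"
        by (rule always_eventually) (use V_lipschitz in blast)
      have "(\<lambda>i. norm (F i t - u t)) \<longlonglongrightarrow> 0"
        using F(2)[of t] by (intro tendsto_norm_zero LIM_zero)
      then show "(\<lambda>i. k t * norm (F i t - u t)) \<longlonglongrightarrow> 0" by (rule tendsto_mult_right_zero)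
    qed
  qed
qed

lemma superposition_integrable:
  assumes u: "u \<in> borel_measurable lebesgue"
  shows "integrable lebesgue (\<lambda>t. V (u t) t)"
  by (rule Bochner_Integration.integrable_bound[OF k_integrable superposition_measurable[OF u]])
    (simp add: V_bound k_nonneg)

text \<open>With \<open>K = primitive k\<close> and \<open>m t = |K t - K t0|\<close>, the Picard operator is a contraction with factor
\<open>1/2\<close> for the norm \<open>sup |u t| exp (- 2 m t)\<close>, because \<open>\<integral>k exp (2 m)\<close> from \<open>t0\<close> to \<open>t\<close> is at most
\<open>exp (2 m t) / 2\<close> in absolute value. The weight is absorbed into the operator \<open>T\<close>, which then acts on
bounded continuous functions with the ordinary supremum norm.\<close>

lemma solution_exists:
  "\<exists>u. continuous_on UNIV u \<and> u t0 = z \<and>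
     (\<forall>s t. u t - u s = primitive (\<lambda>t. V (u t) t) t - primitive (\<lambda>t. V (u t) t) s)"
proof -
  let ?K = "primitive k"
  define M where "M = integral\<^sup>L lebesgue k"
  have K: "0 \<le> ?K t" "?K t \<le> M" for t
    using primitive_bounds[OF k_integrable k_nonneg, of t] by (simp_all add: M_def)
  define m where "m t = \<bar>?K t - ?K t0\<bar>" for t
  have m: "0 \<le> m t" "m t \<le> M" for t using K[of t] K[of t0] by (auto simp: m_def)
  have mc: "continuous_on UNIV m" unfolding m_def
    by (intro continuous_intros continuous_on_primitive k_integrable k_nonneg)
  define N where "N f t = V (exp (2 * m t) *\<^sub>R f t) t" for f t
  define T where "T f t = exp (- 2 * m t) *\<^sub>R (z + (primitive (N f) t - primitive (N f) t0))" for f t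
  have efc: "continuous_on UNIV (\<lambda>t. exp (2 * m t) *\<^sub>R f t)" if "continuous_on UNIV f" for f :: "real \<Rightarrow> complex"
    using that mc by (intro continuous_intros)
  have Ni: "integrable lebesgue (N f)" if "continuous_on UNIV f" for f
    unfolding N_def by (rule superposition_integrable) (intro measurable_continuous efc that)
  have Pc: "continuous_on UNIV (primitive (N f))" if "continuous_on UNIV f" for f
    by (rule continuous_on_UNIV_if_abs_continuous) (rule abs_continuous_on_primitive[OF Ni[OF that]])
  have Pb: "norm (primitive (N f) t - primitive (N f) t0) \<le> m t" if f: "continuous_on UNIV f" for f t
  proof (cases "t0 \<le> t")
    case True
    have "norm (primitive (N f) t - primitive (N f) t0) \<le> ?K t - ?K t0"
      by (rule norm_primitive_diff_le[OF Ni[OF f] k_integrable _ True]) (simp add: N_def V_bound)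
    then show ?thesis by (simp add: m_def)
  next
    case False
    then have le: "t \<le> t0" by simp
    have "norm (primitive (N f) t0 - primitive (N f) t) \<le> ?K t0 - ?K t"
      by (rule norm_primitive_diff_le[OF Ni[OF f] k_integrable _ le]) (simp add: N_def V_bound)
    then show ?thesis by (simp add: m_def norm_minus_commute)
  qed
  have Tb: "T f \<in> bcontfun" if f: "continuous_on UNIV f" for f
    unfolding bcontfun_def mem_Collect_eq
  proof
    show "continuous_on UNIV (T f)" unfolding T_def by (intro continuous_intros mc Pc f)
    have "norm (T f t) \<le> norm z + M" for t
    proof -
      have "norm (T f t) = exp (- 2 * m t) * norm (z + (primitive (N f) t - primitive (N f) t0))"
        by (simp add: T_def)
      also have "\<dots> \<le> 1 * (norm z + M)"
      proof (rule mult_mono)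
        show "exp (- 2 * m t) \<le> 1" using m(1)[of t] by simp
        show "norm (z + (primitive (N f) t - primitive (N f) t0)) \<le> norm z + M"
          using Pb[OF f, of t] m(2)[of t] norm_triangle_ineq[of z "primitive (N f) t - primitive (N f) t0"] by linarith
      qed auto
      finally show ?thesis by simp
    qed
    then show "bounded (range (T f))" unfolding bounded_iff by blast
  qed
  define TT where "TT f = Bcontfun (T (apply_bcontfun f))" for f
  have TT: "apply_bcontfun (TT f) = T (apply_bcontfun f)" for f
    unfolding TT_def by (rule Bcontfun_inverse) (rule Tb, simp)
  have contr: "dist (TT f) (TT g) \<le> 1/2 * dist f g" for f g
  proof (rule dist_bound)
    fix t
    let ?f = "apply_bcontfun f" and ?g = "apply_bcontfun g"
    let ?d = "dist f g"
    have fc: "continuous_on UNIV ?f" "continuous_on UNIV ?g" by simp_all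
    have NN: "norm (N ?f s - N ?g s) \<le> ?d * (k s * exp (2 * m s))" for s
    proof -
      have "norm (N ?f s - N ?g s) \<le> k s * norm (exp (2 * m s) *\<^sub>R ?f s - exp (2 * m s) *\<^sub>R ?g s)"
        unfolding N_def by (rule V_lipschitz)
      also have "\<dots> = k s * (exp (2 * m s) * norm (?f s - ?g s))"
        by (simp add: scaleR_right_diff_distrib[symmetric])
      also have "\<dots> \<le> k s * (exp (2 * m s) * ?d)"
        using dist_bounded[of f s g] by (intro mult_left_mono k_nonneg) (auto simp: dist_norm)
      finally show ?thesis by (simp add: algebra_simps)
    qed
    have di: "integrable lebesgue (\<lambda>s. N ?f s - N ?g s)"
      by (intro Bochner_Integration.integrable_diff Ni fc)
    have key: "norm (primitive (\<lambda>s. N ?f s - N ?g s) t - primitive (\<lambda>s. N ?f s - N ?g s) t0) \<le> ?d * (exp (2 * m t) / 2)"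
    proof (cases "t0 \<le> t")
      case True
      let ?W = "\<lambda>s. k s * exp (2 * (?K s - ?K t0))"
      have W: "integrable lebesgue ?W" by (rule primitive_times_exp(1)[OF k_integrable k_nonneg]) simp
      have mt: "m s = ?K s - ?K t0" if "t0 \<le> s" for s
        using primitive_mono[OF k_integrable k_nonneg that] by (simp add: m_def)
      have "norm (primitive (\<lambda>s. N ?f s - N ?g s) t - primitive (\<lambda>s. N ?f s - N ?g s) t0)
        \<le> primitive (\<lambda>s. ?d * ?W s) t - primitive (\<lambda>s. ?d * ?W s) t0"
      proof (rule norm_primitive_diff_le[OF di _ _ True])
        show "integrable lebesgue (\<lambda>s. ?d * ?W s)" using W by simp
        show "AE s in lebesgue. s \<in> {t0..t} \<longrightarrow> norm (N ?f s - N ?g s) \<le> ?d * ?W s"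
          using NN mt by (intro AE_I2) (metis atLeastAtMost_iff)
      qed
      also have "\<dots> = ?d * (primitive ?W t - primitive ?W t0)"
        unfolding primitive_def by (simp add: right_diff_distrib)
      also have "primitive ?W t - primitive ?W t0 = (exp (2 * (?K t - ?K t0)) - exp (2 * (?K t0 - ?K t0))) / 2"
        by (rule primitive_times_exp(2)[OF k_integrable k_nonneg _ True]) simp
      also have "?d * \<dots> \<le> ?d * (exp (2 * m t) / 2)"
        using mt[OF True] by (intro mult_left_mono) auto
      finally show ?thesis .
    next
      case False
      then have tt: "t \<le> t0" by simp
      let ?W = "\<lambda>s. k s * exp (-2 * (?K s - ?K t0))"
      have W: "integrable lebesgue ?W" by (rule primitive_times_exp(1)[OF k_integrable k_nonneg]) simp
      have mt: "m s = - (?K s - ?K t0)" if "s \<le> t0" for s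
        using primitive_mono[OF k_integrable k_nonneg that] by (simp add: m_def)
      have "norm (primitive (\<lambda>s. N ?f s - N ?g s) t0 - primitive (\<lambda>s. N ?f s - N ?g s) t)
        \<le> primitive (\<lambda>s. ?d * ?W s) t0 - primitive (\<lambda>s. ?d * ?W s) t"
      proof (rule norm_primitive_diff_le[OF di _ _ tt])
        show "integrable lebesgue (\<lambda>s. ?d * ?W s)" using W by simp
        show "AE s in lebesgue. s \<in> {t..t0} \<longrightarrow> norm (N ?f s - N ?g s) \<le> ?d * ?W s"
        proof (rule AE_I2, rule impI)
          fix s assume "s \<in> {t..t0}"
          then have "2 * m s = -2 * (?K s - ?K t0)" using mt by simp
          then show "norm (N ?f s - N ?g s) \<le> ?d * ?W s" using NN[of s] by (simp only:)
        qed
      qed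
      also have "\<dots> = ?d * (primitive ?W t0 - primitive ?W t)"
        unfolding primitive_def by (simp add: right_diff_distrib)
      also have "primitive ?W t0 - primitive ?W t = (exp (-2 * (?K t0 - ?K t0)) - exp (-2 * (?K t - ?K t0))) / (-2)"
        by (rule primitive_times_exp(2)[OF k_integrable k_nonneg _ tt]) simp
      also have "?d * \<dots> \<le> ?d * (exp (2 * m t) / 2)"
      proof (intro mult_left_mono)
        have eq: "exp (-2 * (?K t - ?K t0)) = exp (2 * m t)" using mt[OF tt] by simp
        show "(exp (-2 * (?K t0 - ?K t0)) - exp (-2 * (?K t - ?K t0))) / (-2) \<le> exp (2 * m t) / 2"
          unfolding eq by (simp add: field_simps)
      qed simp
      finally show ?thesis by (simp only: norm_minus_commute)
    qed
    have "dist (T ?f t) (T ?g t) = exp (- 2 * m t) * norm (primitive (\<lambda>s. N ?f s - N ?g s) t - primitive (\<lambda>s. N ?f s - N ?g s) t0)"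
    proof -
      let ?p = "primitive (N ?f) t - primitive (N ?f) t0" and ?q = "primitive (N ?g) t - primitive (N ?g) t0"
      have "T ?f t - T ?g t = exp (- 2 * m t) *\<^sub>R ((z + ?p) - (z + ?q))"
        unfolding T_def by (rule scaleR_right_diff_distrib[symmetric])
      also have "(z + ?p) - (z + ?q) = primitive (N ?f) t - primitive (N ?g) t - (primitive (N ?f) t0 - primitive (N ?g) t0)"
        by (simp add: algebra_simps)
      finally show ?thesis
        unfolding dist_norm primitive_subtract[OF Ni[OF fc(1)] Ni[OF fc(2)]] by simp
    qed
    also have "\<dots> \<le> exp (- 2 * m t) * (?d * (exp (2 * m t) / 2))"
      using key by (rule mult_left_mono) simp
    also have "\<dots> = 1/2 * ?d * (exp (- 2 * m t) * exp (2 * m t))" by simp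
    also have "\<dots> = 1/2 * ?d" by (simp add: exp_minus)
    finally show "dist (apply_bcontfun (TT f) t) (apply_bcontfun (TT g) t) \<le> 1/2 * dist f g"
      unfolding TT .
  qed
  obtain f where f: "TT f = f"
    using banach_fix_type[of "1/2" TT] contr by auto
  define u where "u t = exp (2 * m t) *\<^sub>R apply_bcontfun f t" for t
  have Nu: "N (apply_bcontfun f) = (\<lambda>t. V (u t) t)" by (simp add: N_def u_def fun_eq_iff)
  have u: "u t = z + (primitive (\<lambda>t. V (u t) t) t - primitive (\<lambda>t. V (u t) t) t0)" for t
  proof -
    have "apply_bcontfun f t = T (apply_bcontfun f) t" using TT[of f] f by simp
    then have "u t = exp (2 * m t) *\<^sub>R T (apply_bcontfun f) t" by (simp add: u_def)
    also have "\<dots> = z + (primitive (N (apply_bcontfun f)) t - primitive (N (apply_bcontfun f)) t0)"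
      by (simp add: T_def exp_add[symmetric])
    finally show ?thesis unfolding Nu .
  qed
  show ?thesis
  proof (intro exI[of _ u] conjI allI)
    show "continuous_on UNIV u" unfolding u_def by (rule efc) simp
    show "u t0 = z" using u[of t0] by simp
    fix s t show "u t - u s = primitive (\<lambda>t. V (u t) t) t - primitive (\<lambda>t. V (u t) t) s"
      using u[of t] u[of s] by simp
  qed
qed

end

definition caratheodory_solution ::
    "(complex \<Rightarrow> real \<Rightarrow> complex) \<Rightarrow> real \<Rightarrow> real \<Rightarrow> (real \<Rightarrow> complex) \<Rightarrow> bool" where
  "caratheodory_solution V a b u \<longleftrightarrow> abs_continuous_on a b u \<and>
     (AE t in lebesgue. t \<in> {a..b} \<longrightarrow> (u has_vector_derivative V (u t) t) (at t within {a..b}))"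

lemma caratheodory_solution_subinterval:
  assumes u: "caratheodory_solution V a b u" and le: "a \<le> c" "d \<le> b"
  shows "caratheodory_solution V c d u"
  unfolding caratheodory_solution_def
proof
  show "abs_continuous_on c d u"
    using u unfolding caratheodory_solution_def by (intro abs_continuous_on_subinterval[OF _ le]) blast
  have "AE t in lebesgue. t \<in> {a..b} \<longrightarrow> (u has_vector_derivative V (u t) t) (at t within {a..b})"
    using u by (simp add: caratheodory_solution_def)
  then show "AE t in lebesgue. t \<in> {c..d} \<longrightarrow> (u has_vector_derivative V (u t) t) (at t within {c..d})"
  proof eventually_elim
    case (elim t)
    show ?case
    proof
      assume "t \<in> {c..d}"
      moreover from this have "t \<in> {a..b}" using le by auto
      ultimately show "(u has_vector_derivative V (u t) t) (at t within {c..d})"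
        using elim by (rule_tac has_vector_derivative_within_subset[of u _ t "{a..b}" "{c..d}"]) (use le in simp_all)
    qed
  qed
qed

lemma caratheodory_solution_continuous_on:
  "caratheodory_solution V a b u \<Longrightarrow> continuous_on {a..b} u"
  unfolding caratheodory_solution_def by (blast intro: abs_continuous_on_imp_continuous_on)

context caratheodory_field
begin

lemma integral_solution:
  assumes u: "continuous_on UNIV u"
    and eq: "\<And>s t. u t - u s = primitive (\<lambda>t. V (u t) t) t - primitive (\<lambda>t. V (u t) t) s"
  shows "caratheodory_solution V a b u"
    and "\<And>s t. s \<le> t \<Longrightarrow> norm (u t - u s) \<le> primitive k t - primitive k s"
proof -
  have i: "integrable lebesgue (\<lambda>t. V (u t) t)"
    by (rule superposition_integrable[OF measurable_continuous[OF u]])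
  show le: "norm (u t - u s) \<le> primitive k t - primitive k s" if "s \<le> t" for s t
    unfolding eq by (rule norm_primitive_diff_le[OF i k_integrable _ that]) (simp add: V_bound)
  have "abs_continuous_on a b u"
    by (rule abs_continuous_on_dominated[OF k_integrable k_nonneg]) (rule le)
  moreover have "AE t in lebesgue. t \<in> {a..b} \<longrightarrow> (u has_vector_derivative V (u t) t) (at t within {a..b})"
    using AE_primitive_has_vector_derivative[OF i]
  proof eventually_elim
    case (elim t)
    have "u = (\<lambda>s. u t - primitive (\<lambda>t. V (u t) t) t + primitive (\<lambda>t. V (u t) t) s)"
      using eq[of _ t] by (auto simp: fun_eq_iff algebra_simps)
    moreover have "((\<lambda>s. u t - primitive (\<lambda>t. V (u t) t) t + primitive (\<lambda>t. V (u t) t) s) has_vector_derivative 0 + V (u t) t) (at t)"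
      by (intro has_vector_derivative_add has_vector_derivative_const elim)
    ultimately show ?case by (simp add: has_vector_derivative_at_within)
  qed
  ultimately show "caratheodory_solution V a b u" by (simp add: caratheodory_solution_def)
qed

text \<open>The coefficient of the linear equation that is satisfied by the difference of two solutions. Where the
solutions coincide, the quotient is \<open>0\<close> because division by zero yields zero.\<close>

definition slope :: "real \<Rightarrow> real \<Rightarrow> (real \<Rightarrow> complex) \<Rightarrow> (real \<Rightarrow> complex) \<Rightarrow> real \<Rightarrow> complex" where
  "slope a b u1 u2 t = indicator {a..b} t *\<^sub>R ((V (u1 t) t - V (u2 t) t) / (u1 t - u2 t))"

lemma norm_slope_le: "norm (slope a b u1 u2 t) \<le> k t"
proof (cases "u1 t = u2 t")
  case False
  then have "norm ((V (u1 t) t - V (u2 t) t) / (u1 t - u2 t)) \<le> k t"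
    using V_lipschitz[of "u1 t" t "u2 t"] by (simp add: norm_divide divide_le_eq)
  then show ?thesis using k_nonneg[of t] by (simp add: slope_def indicator_def)
qed (simp add: slope_def k_nonneg)

lemma slope_integrable:
  assumes u: "continuous_on {a..b} u1" "continuous_on {a..b} u2"
  shows "integrable lebesgue (slope a b u1 u2)"
proof (rule Bochner_Integration.integrable_bound[OF k_integrable])
  have ind: "(\<lambda>t. indicator {a..b} t *\<^sub>R f t) \<in> borel_measurable lebesgue"
    if "continuous_on {a..b} f" for f :: "real \<Rightarrow> complex"
    by (rule measurable_completion)
      (use borel_measurable_continuous_on_indicator[OF _ that] in simp)
  let ?v1 = "\<lambda>t. indicator {a..b} t *\<^sub>R u1 t" and ?v2 = "\<lambda>t. indicator {a..b} t *\<^sub>R u2 t"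
  have "(\<lambda>t. indicator {a..b} t *\<^sub>R ((V (?v1 t) t - V (?v2 t) t) / (?v1 t - ?v2 t))) \<in> borel_measurable lebesgue"
    by (intro borel_measurable_scaleR borel_measurable_divide borel_measurable_diff superposition_measurable ind u
        borel_measurable_indicator) simp
  also have "(\<lambda>t. indicator {a..b} t *\<^sub>R ((V (?v1 t) t - V (?v2 t) t) / (?v1 t - ?v2 t))) = slope a b u1 u2"
    by (auto simp: slope_def fun_eq_iff indicator_def)
  finally show "slope a b u1 u2 \<in> borel_measurable lebesgue" .
qed (simp add: norm_slope_le k_nonneg)

text \<open>Writing \<open>Q\<close> for the slope, \<open>u1 - u2\<close> has derivative \<open>Q * (u1 - u2)\<close> almost everywhere, so its product
with \<open>exp (- primitive Q)\<close> is constant.\<close>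

lemma solution_difference:
  assumes u1: "caratheodory_solution V a b u1" and u2: "caratheodory_solution V a b u2"
    and st: "s \<in> {a..b}" "t \<in> {a..b}"
  shows "u1 t - u2 t = (u1 s - u2 s) * exp (primitive (slope a b u1 u2) t - primitive (slope a b u1 u2) s)"
proof -
  let ?Q = "slope a b u1 u2"
  let ?P = "primitive ?Q"
  have Q: "integrable lebesgue ?Q"
    using u1 u2 by (intro slope_integrable caratheodory_solution_continuous_on)
  have AC: "abs_continuous_on a b u1" "abs_continuous_on a b u2"
    using u1 u2 by (auto simp: caratheodory_solution_def)
  have ACd: "abs_continuous_on a b (\<lambda>t. u1 t - u2 t)"
    by (rule abs_continuous_on_diff[OF AC])
  have ACm: "abs_continuous_on a b (\<lambda>t. - ?P t)"
    using abs_continuous_on_diff[OF abs_continuous_on_const[of a b 0] abs_continuous_on_primitive[OF Q]] by simp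
  let ?f = "\<lambda>t. (u1 t - u2 t) * exp (- ?P t)"
  have "?f s = ?f t"
  proof (rule abs_continuous_on_derivative_zero_imp_constant[OF _ _ st, of ?f])
    show "abs_continuous_on a b ?f"
      by (rule abs_continuous_on_mult[OF ACd abs_continuous_on_exp[OF ACm]])
    have D: "AE t in lebesgue. t \<in> {a..b} \<longrightarrow> (u1 has_vector_derivative V (u1 t) t) (at t within {a..b})"
       "AE t in lebesgue. t \<in> {a..b} \<longrightarrow> (u2 has_vector_derivative V (u2 t) t) (at t within {a..b})"
      using u1 u2 by (auto simp: caratheodory_solution_def)
    show "AE x in lebesgue. x \<in> {a..b} \<longrightarrow> (?f has_vector_derivative 0) (at x within {a..b})"
      using D AE_primitive_has_vector_derivative[OF Q]
    proof eventually_elim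
      case (elim x)
      show ?case
      proof
        assume x: "x \<in> {a..b}"
        have d1: "((\<lambda>t. u1 t - u2 t) has_vector_derivative V (u1 x) x - V (u2 x) x) (at x within {a..b})"
          using elim x by (intro has_vector_derivative_diff) auto
        have "((\<lambda>t. - ?P t) has_vector_derivative - ?Q x) (at x within {a..b})"
          using elim(3) by (intro has_vector_derivative_minus) (rule has_vector_derivative_at_within)
        from field_vector_diff_chain_within[OF this, of exp "exp (- ?P x)"]
        have d2: "((\<lambda>t. exp (- ?P t)) has_vector_derivative - ?Q x * exp (- ?P x)) (at x within {a..b})"
          by (simp add: o_def DERIV_exp has_field_derivative_at_within)
        have Qx: "(u1 x - u2 x) * ?Q x = V (u1 x) x - V (u2 x) x"
          using x by (simp add: slope_def)
        have "(u1 x - u2 x) * (- ?Q x * exp (- ?P x)) + (V (u1 x) x - V (u2 x) x) * exp (- ?P x) = 0"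
          unfolding Qx[symmetric] by (simp add: algebra_simps)
        then show "(?f has_vector_derivative 0) (at x within {a..b})"
          using has_vector_derivative_mult[OF d1 d2] by simp
      qed
    qed
  qed
  then have "(u1 t - u2 t) * exp (- ?P t) * exp (?P t) = (u1 s - u2 s) * exp (- ?P s) * exp (?P t)" by simp
  then show ?thesis by (simp add: mult.assoc exp_add[symmetric])
qed

lemma solution_unique:
  assumes "caratheodory_solution V a b u1" "caratheodory_solution V a b u2"
    "s \<in> {a..b}" "t \<in> {a..b}" "u1 s = u2 s"
  shows "u1 t = u2 t"
  using solution_difference[OF assms(1-4)] assms(5) by simp

lemma solution_lipschitz:
  assumes u1: "caratheodory_solution V a b u1" and u2: "caratheodory_solution V a b u2"
    and st: "s \<in> {a..b}" "t \<in> {a..b}"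
  shows "norm (u1 t - u2 t) \<le> norm (u1 s - u2 s) * exp (integral\<^sup>L lebesgue k)"
proof -
  let ?Q = "slope a b u1 u2"
  have Q: "integrable lebesgue ?Q"
    using u1 u2 by (intro slope_integrable caratheodory_solution_continuous_on)
  have le: "norm (primitive ?Q q - primitive ?Q p) \<le> integral\<^sup>L lebesgue k" if "p \<le> q" for p q
  proof -
    have "norm (primitive ?Q q - primitive ?Q p) \<le> primitive k q - primitive k p"
      by (rule norm_primitive_diff_le[OF Q k_integrable _ that]) (simp add: norm_slope_le)
    also have "\<dots> \<le> integral\<^sup>L lebesgue k"
      using primitive_bounds[OF k_integrable k_nonneg, of q] primitive_bounds[OF k_integrable k_nonneg, of p] by linarith
    finally show ?thesis .
  qed
  have "norm (primitive ?Q t - primitive ?Q s) \<le> integral\<^sup>L lebesgue k"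
    by (cases "s \<le> t") (use le[of s t] le[of t s] in \<open>auto simp: norm_minus_commute\<close>)
  then have "norm (exp (primitive ?Q t - primitive ?Q s)) \<le> exp (integral\<^sup>L lebesgue k)"
    using norm_exp[of "primitive ?Q t - primitive ?Q s"] by (meson exp_le_cancel_iff order_trans)
  then show ?thesis
    unfolding solution_difference[OF assms] norm_mult by (rule mult_left_mono) simp
qed

text \<open>The difference quotient in the initial value is \<open>exp\<close> of an integral of the slope of \<open>V\<close> along two
neighbouring solutions. The slopes are dominated by \<open>k\<close> and converge to the derivative of \<open>V\<close> along
the solution through \<open>z0\<close>.\<close>

lemma flow_field_differentiable:
  assumes u: "\<And>z. z \<in> A \<Longrightarrow> caratheodory_solution V a b (u z)" and u0: "\<And>z. z \<in> A \<Longrightarrow> u z t0 = z"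
    and A: "open A" "z0 \<in> A" and st: "t0 \<in> {a..b}" "s \<in> {a..b}"
    and D: "AE t in lebesgue. t \<in> {a..b} \<longrightarrow> ((\<lambda>z. V z t) has_field_derivative D t) (at (u z0 t))"
  shows "(\<lambda>z. u z s) field_differentiable (at z0)"
proof -
  define Q where "Q z = slope a b (u z) (u z0)" for z
  have Qi: "integrable lebesgue (Q z)" if "z \<in> A" for z
    unfolding Q_def using u[OF that] u[OF A(2)] by (intro slope_integrable caratheodory_solution_continuous_on)
  have du: "u z t - u z0 t = (z - z0) * exp (primitive (Q z) t - primitive (Q z) t0)"
    if "z \<in> A" "t \<in> {a..b}" for z t
    using solution_difference[OF u[OF that(1)] u[OF A(2)] st(1) that(2)]
    by (simp add: Q_def u0 that A)
  have lim: "AE t in lebesgue. (\<lambda>n. Q (h n) t) \<longlonglongrightarrow> indicator {a..b} t *\<^sub>R D t"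
    if h: "\<And>n. h n \<in> A" "\<And>n. h n \<noteq> z0" "h \<longlonglongrightarrow> z0" for h :: "nat \<Rightarrow> complex"
    using D
  proof eventually_elim
    case (elim t)
    show ?case
    proof (cases "t \<in> {a..b}")
      case False
      then show ?thesis by (simp add: Q_def slope_def)
    next
      case t: True
      have ne: "u (h n) t \<noteq> u z0 t" for n
        using du[OF h(1) t, of n] h(2)[of n] by auto
      have "(\<lambda>n. u (h n) t - u z0 t) \<longlonglongrightarrow> 0"
      proof (rule Lim_null_comparison)
        show "\<forall>\<^sub>F n in sequentially. norm (u (h n) t - u z0 t) \<le> norm (h n - z0) * exp (integral\<^sup>L lebesgue k)"
          using solution_lipschitz[OF u[OF h(1)] u[OF A(2)] st(1) t] by (simp add: u0 h(1) A(2))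
        show "(\<lambda>n. norm (h n - z0) * exp (integral\<^sup>L lebesgue k)) \<longlonglongrightarrow> 0"
          using h(3) by (intro tendsto_mult_left_zero tendsto_norm_zero LIM_zero)
      qed
      then have "(\<lambda>n. u (h n) t) \<longlonglongrightarrow> u z0 t" by (rule LIM_zero_cancel)
      moreover have "((\<lambda>y. (V y t - V (u z0 t) t) / (y - u z0 t)) \<longlongrightarrow> D t) (at (u z0 t))"
        using elim t by (simp add: has_field_derivative_iff)
      ultimately have "(\<lambda>n. (V (u (h n) t) t - V (u z0 t) t) / (u (h n) t - u z0 t)) \<longlonglongrightarrow> D t"
        unfolding tendsto_at_iff_sequentially using ne by (auto simp: o_def)
      then show ?thesis using t by (simp add: Q_def slope_def)
    qed
  qed
  \<comment> \<open>The limit \<open>E\<close> along one fixed sequence is a measurable function that equals \<open>D\<close> almost everywhere.\<close>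
  obtain r where r: "r > 0" "ball z0 r \<subseteq> A" using A open_contains_ball by blast
  define h0 where "h0 n = z0 + of_real (r / 2 * inverse (real (Suc n)))" for n
  have h0A: "h0 n \<in> A" and h0n: "h0 n \<noteq> z0" for n
  proof -
    have pos: "0 < inverse (real (Suc n))" and "inverse (real (Suc n)) \<le> 1"
      by (simp, simp add: inverse_le_1_iff)
    then have "r / 2 * inverse (real (Suc n)) \<le> r / 2 * 1" using r(1) by (intro mult_left_mono) auto
    then have "r / 2 * inverse (real (Suc n)) < r" using r(1) by linarith
    moreover have "norm (h0 n - z0) = r / 2 * inverse (real (Suc n))"
      unfolding h0_def add_diff_cancel_left' norm_of_real using r(1) pos by simp
    ultimately have "h0 n \<in> ball z0 r" by (simp add: dist_norm norm_minus_commute)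
    then show "h0 n \<in> A" using r by blast
    have "r / 2 * inverse (real (Suc n)) \<noteq> 0" using r(1) pos by simp
    then show "h0 n \<noteq> z0" unfolding h0_def by (metis add_cancel_left_right of_real_eq_0_iff)
  qed
  have "(\<lambda>n. complex_of_real (r / 2 * inverse (real (Suc n)))) \<longlonglongrightarrow> of_real (r / 2 * 0)"
    by (intro tendsto_of_real tendsto_mult tendsto_const LIMSEQ_inverse_real_of_nat)
  then have "h0 \<longlonglongrightarrow> z0 + of_real (r / 2 * 0)" unfolding h0_def by (intro tendsto_add tendsto_const)
  then have h0l: "h0 \<longlonglongrightarrow> z0" by simp
  define E where "E t = lim (\<lambda>n. Q (h0 n) t)" for t
  have Em: "E \<in> borel_measurable lebesgue"
    unfolding E_def by (rule borel_measurable_lim_metric) (rule borel_measurable_integrable[OF Qi[OF h0A]])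
  have ED: "AE t in lebesgue. E t = indicator {a..b} t *\<^sub>R D t"
    using lim[OF h0A h0n h0l] unfolding E_def by eventually_elim (rule limI)
  have Plim: "(\<lambda>n. primitive (Q (h n)) t) \<longlonglongrightarrow> primitive E t"
    if h: "\<And>n. h n \<in> A" "\<And>n. h n \<noteq> z0" "h \<longlonglongrightarrow> z0" for h :: "nat \<Rightarrow> complex" and t
    unfolding primitive_def set_lebesgue_integral_def
  proof (rule integral_dominated_convergence[where w=k])
    show "(\<lambda>s. indicat_real {..t} s *\<^sub>R E s) \<in> borel_measurable lebesgue"
      by (intro borel_measurable_scaleR borel_measurable_indicator Em) simp
    show "(\<lambda>s. indicat_real {..t} s *\<^sub>R Q (h n) s) \<in> borel_measurable lebesgue" for n
      by (intro borel_measurable_scaleR borel_measurable_indicator borel_measurable_integrable[OF Qi[OF h(1)]]) simp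
    show "integrable lebesgue k" by (rule k_integrable)
    show "AE s in lebesgue. (\<lambda>n. indicat_real {..t} s *\<^sub>R Q (h n) s) \<longlonglongrightarrow> indicat_real {..t} s *\<^sub>R E s"
      using lim[OF h] ED
    proof eventually_elim
      case (elim s)
      then show ?case by (intro tendsto_scaleR tendsto_const) simp
    qed
    show "AE s in lebesgue. norm (indicat_real {..t} s *\<^sub>R Q (h n) s) \<le> k s" for n
      by (rule AE_I2) (simp add: Q_def norm_slope_le k_nonneg indicator_def)
  qed
  have "((\<lambda>z. (u z s - u z0 s) / (z - z0)) \<longlongrightarrow> exp (primitive E s - primitive E t0)) (at z0)"
    unfolding tendsto_at_iff_sequentially
  proof (intro allI impI)
    fix h :: "nat \<Rightarrow> complex" assume hn: "\<forall>i. h i \<in> UNIV - {z0}" and hl: "h \<longlonglongrightarrow> z0"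
    have "\<forall>\<^sub>F n in sequentially. h n \<in> A" using hl A by (rule topological_tendstoD)
    then obtain N where N: "\<And>n. n \<ge> N \<Longrightarrow> h n \<in> A" by (auto simp: eventually_sequentially)
    let ?h = "\<lambda>n. h (n + N)"
    have h': "\<And>n. ?h n \<in> A" "\<And>n. ?h n \<noteq> z0" "?h \<longlonglongrightarrow> z0"
      using N hn LIMSEQ_ignore_initial_segment[OF hl] by auto
    have "(\<lambda>n. exp (primitive (Q (?h n)) s - primitive (Q (?h n)) t0)) \<longlonglongrightarrow> exp (primitive E s - primitive E t0)"
      by (intro tendsto_exp tendsto_diff Plim[OF h'])
    moreover have "(u (?h n) s - u z0 s) / (?h n - z0) = exp (primitive (Q (?h n)) s - primitive (Q (?h n)) t0)" for n
      unfolding du[OF h'(1) st(2)] using h'(2)[of n] by simp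
    ultimately have "(\<lambda>n. (u (?h n) s - u z0 s) / (?h n - z0)) \<longlonglongrightarrow> exp (primitive E s - primitive E t0)"
      by simp
    then have "(\<lambda>n. ((\<lambda>z. (u z s - u z0 s) / (z - z0)) \<circ> h) (n + N)) \<longlonglongrightarrow> exp (primitive E s - primitive E t0)"
      by (simp add: o_def)
    then show "((\<lambda>z. (u z s - u z0 s) / (z - z0)) \<circ> h) \<longlonglongrightarrow> exp (primitive E s - primitive E t0)"
      by (rule LIMSEQ_offset)
  qed
  then show ?thesis unfolding field_differentiable_def has_field_derivative_iff by blast
qed

lemma V_integrable: "integrable lebesgue (V z)"
  using superposition_integrable[of "\<lambda>_. z"] by simp

text \<open>Along a solution that stays within \<open>\<delta>\<close> of \<open>y\<close>, the field may be evaluated at \<open>y\<close> instead, at the cost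
of an error of \<open>\<delta>\<close> times the increment of \<open>primitive k\<close>.\<close>

lemma solution_increment_frozen:
  assumes u: "caratheodory_solution V a b u" and st: "a \<le> s" "s \<le> t" "t \<le> b"
    and \<delta>: "\<And>\<tau>. \<tau> \<in> {s..t} \<Longrightarrow> norm (u \<tau> - y) \<le> \<delta>"
  shows "norm (u t - u s - (primitive (V y) t - primitive (V y) s)) \<le> \<delta> * (primitive k t - primitive k s)"
proof -
  have u': "caratheodory_solution V s t u" by (rule caratheodory_solution_subinterval[OF u st(1,3)])
  then have ACu: "abs_continuous_on s t u" by (simp add: caratheodory_solution_def)
  have AC: "abs_continuous_on s t (\<lambda>\<tau>. u \<tau> - primitive (V y) \<tau>)"
    by (rule abs_continuous_on_diff[OF ACu abs_continuous_on_primitive[OF V_integrable]])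
  have "norm ((u t - primitive (V y) t) - (u s - primitive (V y) s)) \<le> \<delta> * (primitive k t - primitive k s)"
  proof (rule abs_continuous_on_derivative_bound[OF st(2) AC k_integrable k_nonneg])
    have "AE x in lebesgue. x \<in> {s..t} \<longrightarrow> (u has_vector_derivative V (u x) x) (at x within {s..t})"
      using u' by (simp add: caratheodory_solution_def)
    then show "AE x in lebesgue. x \<in> {s..t} \<longrightarrow> (\<exists>D. ((\<lambda>\<tau>. u \<tau> - primitive (V y) \<tau>) has_vector_derivative D) (at x within {s..t}) \<and> norm D \<le> \<delta> * k x)"
      using AE_primitive_has_vector_derivative[OF V_integrable[of y]]
    proof eventually_elim
      case (elim x)
      show ?case
      proof
        assume x: "x \<in> {s..t}"
        then have "((\<lambda>\<tau>. u \<tau> - primitive (V y) \<tau>) has_vector_derivative V (u x) x - V y x) (at x within {s..t})"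
          by (intro has_vector_derivative_diff has_vector_derivative_at_within[OF elim(2)] elim(1)[rule_format])
        moreover have "norm (V (u x) x - V y x) \<le> \<delta> * k x"
          using V_lipschitz[of "u x" x y] mult_left_mono[OF \<delta>[OF x] k_nonneg[of x]] by (simp add: mult.commute)
        ultimately show "\<exists>D. ((\<lambda>\<tau>. u \<tau> - primitive (V y) \<tau>) has_vector_derivative D) (at x within {s..t}) \<and> norm D \<le> \<delta> * k x"
          by blast
      qed
    qed
  qed
  then show ?thesis by (simp add: algebra_simps)
qed

lemma solution_increment_bound:
  assumes u: "caratheodory_solution V a b u" and st: "a \<le> s" "s \<le> t" "t \<le> b"
  shows "norm (u t - u s) \<le> primitive k t - primitive k s"
proof -
  have u': "caratheodory_solution V s t u" by (rule caratheodory_solution_subinterval[OF u st(1,3)])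
  have "norm (u t - u s) \<le> 1 * (primitive k t - primitive k s)"
  proof (rule abs_continuous_on_derivative_bound[OF st(2) _ k_integrable k_nonneg])
    show "abs_continuous_on s t u" using u' by (simp add: caratheodory_solution_def)
    have "AE x in lebesgue. x \<in> {s..t} \<longrightarrow> (u has_vector_derivative V (u x) x) (at x within {s..t})"
      using u' by (simp add: caratheodory_solution_def)
    then show "AE x in lebesgue. x \<in> {s..t} \<longrightarrow> (\<exists>D. (u has_vector_derivative D) (at x within {s..t}) \<and> norm D \<le> 1 * k x)"
      by eventually_elim (use V_bound in auto)
  qed
  then show ?thesis by simp
qed

end

section \<open>Cauchy estimates and infinitesimal generators\<close>

lemma deriv_bound_disc:
  assumes f: "f holomorphic_on ball 0 1" and B: "\<And>x. x \<in> cball 0 R' \<Longrightarrow> norm (f x) \<le> B"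
    and R: "R < R'" "R' < 1" and z: "z \<in> cball 0 R"
  shows "norm (deriv f z) \<le> B / (R' - R)"
proof -
  have sub: "cball z (R' - R) \<subseteq> cball 0 R'"
  proof
    fix x assume "x \<in> cball z (R' - R)"
    then have "norm (x - z) \<le> R' - R" by (simp add: dist_norm norm_minus_commute)
    then have "norm x \<le> R'" using z norm_triangle_ineq[of "x - z" z] by simp
    then show "x \<in> cball 0 R'" by simp
  qed
  have sub1: "cball z (R' - R) \<subseteq> ball 0 1" using sub R(2) by (force simp: subset_iff)
  have "norm ((deriv ^^ 1) f z) \<le> fact 1 * B / (R' - R) ^ 1"
  proof (rule Cauchy_inequality)
    show "f holomorphic_on ball z (R' - R)"
      using f by (rule holomorphic_on_subset) (use sub1 ball_subset_cball in blast)
    show "continuous_on (cball z (R' - R)) f"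
      using holomorphic_on_imp_continuous_on[OF f] sub1 by (rule continuous_on_subset)
    show "0 < R' - R" using R by simp
    fix x assume "norm (z - x) = R' - R"
    then have "x \<in> cball z (R' - R)" by (simp add: dist_norm)
    then show "norm (f x) \<le> B" using sub B by blast
  qed
  then show ?thesis by simp
qed

lemma lipschitz_disc:
  assumes f: "f holomorphic_on ball 0 1" and B: "\<And>x. x \<in> cball 0 R' \<Longrightarrow> norm (f x) \<le> B"
    and R: "R < R'" "R' < 1" and z: "z \<in> cball 0 R" and w: "w \<in> cball 0 R"
  shows "norm (f z - f w) \<le> B / (R' - R) * norm (z - w)"
proof (rule field_differentiable_bound[of "cball 0 R" f "deriv f"])
  fix x :: complex assume x: "x \<in> cball 0 R"
  then have "x \<in> ball 0 1" using R by simp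
  then show "(f has_field_derivative deriv f x) (at x within cball 0 R)"
    using holomorphic_derivI[OF f open_ball] has_field_derivative_at_within by blast
  show "norm (deriv f x) \<le> B / (R' - R)" by (rule deriv_bound_disc[OF f B R x])
qed (use z w in auto)

lemma taylor_disc:
  assumes f: "f holomorphic_on ball 0 1" and B: "\<And>x. x \<in> cball 0 R' \<Longrightarrow> norm (f x) \<le> B"
    and R: "R < R1" "R1 < R'" "R' < 1" and z: "z \<in> cball 0 R" and w: "w \<in> cball 0 R"
  shows "norm (f w - f z - deriv f z * (w - z)) \<le> B / (R' - R1) / (R1 - R) * norm (w - z)^2"
proof -
  let ?C = "B / (R' - R1) / (R1 - R)"
  have "z \<in> cball 0 R'" using z R by simp
  then have B0: "0 \<le> B" using B[of z] norm_ge_zero[of "f z"] by linarith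
  then have C: "0 \<le> ?C" using R by simp
  have df: "deriv f holomorphic_on ball 0 1" using f by (rule holomorphic_deriv) simp
  have seg: "closed_segment z w \<subseteq> cball 0 R"
    using z w convex_cball by (rule closed_segment_subset)
  have "norm ((\<lambda>x. f x - deriv f z * x) w - (\<lambda>x. f x - deriv f z * x) z) \<le> (?C * norm (w - z)) * norm (w - z)"
  proof (rule field_differentiable_bound[of "closed_segment z w" _ "\<lambda>x. deriv f x - deriv f z"])
    fix x assume x: "x \<in> closed_segment z w"
    then have xR: "x \<in> cball 0 R" using seg by blast
    then have "x \<in> ball 0 1" using R by simp
    then have "(f has_field_derivative deriv f x) (at x within closed_segment z w)"
      using holomorphic_derivI[OF f open_ball] has_field_derivative_at_within by blast
    then show "((\<lambda>x. f x - deriv f z * x) has_field_derivative deriv f x - deriv f z) (at x within closed_segment z w)"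
      by (auto intro!: derivative_eq_intros)
    have "norm (deriv f x - deriv f z) \<le> ?C * norm (x - z)"
      by (rule lipschitz_disc[OF df _ R(1) _ xR z])
        (use deriv_bound_disc[OF f B R(2,3)] R in auto)
    also have "\<dots> \<le> ?C * norm (w - z)"
      using segment_bound(1)[OF x] C by (intro mult_left_mono) (auto simp: norm_minus_commute)
    finally show "norm (deriv f x - deriv f z) \<le> ?C * norm (w - z)" .
  qed auto
  moreover have "(\<lambda>x. f x - deriv f z * x) w - (\<lambda>x. f x - deriv f z * x) z = f w - f z - deriv f z * (w - z)"
    by (simp add: algebra_simps)
  ultimately show ?thesis by (simp add: power2_eq_square mult.assoc)
qed

text \<open>The Schwarz lemma for \<open>f\<close> followed by the automorphism of the disc that takes \<open>f 0\<close> to \<open>0\<close>.\<close>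

lemma Schwarz_Pick_origin:
  assumes f: "f holomorphic_on ball 0 1" and fd: "f ` ball 0 1 \<subseteq> ball 0 1" and z: "z \<in> ball 0 1"
  shows "(1 - (norm z)^2) * (norm (1 - cnj (f 0) * f z))^2 \<le> (1 - (norm (f z))^2) * (1 - (norm (f 0))^2)"
proof -
  let ?M = "Moebius_function 0 (f 0)"
  have f1: "norm (f x) < 1" if "norm x < 1" for x using fd that by (auto simp: image_subset_iff)
  have f0: "norm (f 0) < 1" using f1 by simp
  have "norm ((?M \<circ> f) z) \<le> norm z"
  proof (rule Schwarz_Lemma(1))
    show "(?M \<circ> f) holomorphic_on ball 0 1"
      by (rule holomorphic_on_compose_gen[OF f Moebius_function_holomorphic[OF f0] fd])
    show "(?M \<circ> f) 0 = 0" by (simp add: Moebius_function_eq_zero)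
    show "norm ((?M \<circ> f) x) < 1" if "norm x < 1" for x
      using Moebius_function_norm_lt_1[OF f0 f1[OF that]] by simp
  qed (use z in simp)
  then have le: "norm ((f z - f 0) / (1 - cnj (f 0) * f z)) \<le> norm z" by (simp add: Moebius_function_simple)
  have "norm (cnj (f 0) * f z) < 1"
    using f0 f1[of z] z by (simp add: norm_mult) (metis mult_strict_mono' mult_1 norm_ge_zero)
  then have nz: "1 - cnj (f 0) * f z \<noteq> 0" by auto
  have "norm (f z - f 0) \<le> norm z * norm (1 - cnj (f 0) * f z)"
    using le nz by (simp add: norm_divide divide_le_eq)
  then have "(norm (f z - f 0))^2 \<le> (norm z * norm (1 - cnj (f 0) * f z))^2"
    by (rule power_mono) simp
  moreover have "(norm (1 - cnj (f 0) * f z))^2 - (norm (f z - f 0))^2 = (1 - (norm (f z))^2) * (1 - (norm (f 0))^2)"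
    unfolding cmod_power2 by (simp add: algebra_simps power2_eq_square)
  ultimately show ?thesis by (simp add: algebra_simps power_mult_distrib)
qed

lemma right_derivative_nonneg:
  fixes g :: "real \<Rightarrow> real"
  assumes D: "(g has_vector_derivative D) (at 0 within {0..})"
    and g0: "g 0 = 0" and pos: "\<And>t. 0 \<le> t \<Longrightarrow> 0 \<le> g t"
  shows "0 \<le> D"
proof -
  have "(g has_real_derivative D) (at 0 within {0..})"
    using D by (simp add: has_real_derivative_iff_has_vector_derivative)
  then have "((\<lambda>y. (g y - g 0) / (y - 0)) \<longlongrightarrow> D) (at 0 within {0..})"
    by (simp add: has_field_derivative_iff)
  then have lim: "((\<lambda>y. g y / y) \<longlongrightarrow> D) (at_right 0)"
    by (simp add: g0 at_within_Ici_at_right)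
  show ?thesis
  proof (rule tendsto_lowerbound[OF lim])
    show "\<forall>\<^sub>F y in at_right 0. 0 \<le> g y / y"
      unfolding eventually_at_right_field by (intro exI[of _ 1]) (simp add: pos)
  qed simp
qed

text \<open>Apply the Schwarz-Pick inequality to the maps of the semigroup. At time \<open>0\<close> it is an equality, so the
derivative at time \<open>0\<close> of the difference of its two sides has a sign.\<close>

lemma generator_inequality:
  assumes H: "infinitesimal_generator H" and z: "z \<in> disc"
  shows "Re (cnj z * H z) \<le> (1 - (norm z)^2) * norm (H 0)"
proof -
  obtain \<phi> where semi: "one_param_semigroup \<phi>" and gen: "generator_of H \<phi>"
    using H by (auto simp: infinitesimal_generator_def)
  define a where "a t = \<phi> t 0" for t
  define b where "b t = \<phi> t z" for t
  have a0: "a 0 = 0" and b0: "b 0 = z" using gen z by (auto simp: generator_of_def a_def b_def)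
  have da: "(a has_vector_derivative H 0) (at 0 within {0..})"
    using gen a0 unfolding generator_of_def a_def by (metis centre_in_ball order_refl zero_less_one)
  have db: "(b has_vector_derivative H z) (at 0 within {0..})"
    using gen b0 z unfolding generator_of_def b_def by (metis order_refl)
  let ?c = "complex_of_real (1 - (norm z)^2)"
  define h where "h t = (1 - b t * cnj (b t)) * (1 - a t * cnj (a t)) - ?c * ((1 - cnj (a t) * b t) * (1 - a t * cnj (b t)))" for t
  have dca: "((\<lambda>t. cnj (a t)) has_vector_derivative cnj (H 0)) (at 0 within {0..})"
    using bounded_linear.has_vector_derivative[OF bounded_linear_cnj da] .
  have dcb: "((\<lambda>t. cnj (b t)) has_vector_derivative cnj (H z)) (at 0 within {0..})"
    using bounded_linear.has_vector_derivative[OF bounded_linear_cnj db] .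
  let ?D = "- (z * cnj (H z) + H z * cnj z) - ?c * (- (H 0 * cnj z) - cnj (H 0) * z)"
  have "(h has_vector_derivative ?D) (at 0 within {0..})"
    unfolding h_def by (rule derivative_eq_intros da db dca dcb refl)+ (simp add: a0 b0)
  then have dRe: "((\<lambda>t. Re (h t)) has_vector_derivative Re ?D) (at 0 within {0..})"
    using bounded_linear.has_vector_derivative[OF bounded_linear_Re] by blast
  have cc: "w * cnj w = of_real ((norm w)^2)" for w
    by (rule complex_norm_square[symmetric])
  have "0 \<le> Re ?D"
  proof (rule right_derivative_nonneg[OF dRe])
    show "Re (h 0) = 0" unfolding h_def a0 b0 cc by simp
    fix t :: real assume t: "0 \<le> t"
    have "(1 - (norm z)^2) * (norm (1 - cnj (a t) * b t))^2 \<le> (1 - (norm (b t))^2) * (1 - (norm (a t))^2)"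
      unfolding a_def b_def
    proof (rule Schwarz_Pick_origin[OF _ _ z])
      show "\<phi> t holomorphic_on disc" "\<phi> t ` disc \<subseteq> disc"
        using semi t unfolding one_param_semigroup_def by blast+
    qed
    moreover have "h t = of_real ((1 - (norm (b t))^2) * (1 - (norm (a t))^2) - (1 - (norm z)^2) * (norm (1 - cnj (a t) * b t))^2)"
    proof -
      have "(1 - cnj (a t) * b t) * (1 - a t * cnj (b t)) = of_real ((norm (1 - cnj (a t) * b t))^2)"
        unfolding cc[symmetric] by simp
      then show ?thesis unfolding h_def cc by simp
    qed
    ultimately show "0 \<le> Re (h t)" by simp
  qed
  moreover have "Re ?D = 2 * ((1 - (norm z)^2) * Re (cnj (H 0) * z) - Re (cnj z * H z))"
    by (simp add: algebra_simps)
  ultimately have "Re (cnj z * H z) \<le> (1 - (norm z)^2) * Re (cnj (H 0) * z)" by simp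
  also have "\<dots> \<le> (1 - (norm z)^2) * norm (H 0)"
  proof (rule mult_left_mono)
    have "Re (cnj (H 0) * z) \<le> norm (H 0) * norm z"
      using complex_Re_le_cmod[of "cnj (H 0) * z"] by (simp add: norm_mult)
    also have "\<dots> \<le> norm (H 0) * 1" using z by (intro mult_left_mono) auto
    finally show "Re (cnj (H 0) * z) \<le> norm (H 0)" by simp
    show "0 \<le> 1 - (norm z)^2" using z by (simp add: power_le_one)
  qed
  finally show ?thesis .
qed

text \<open>On an interval of finite length, \<open>k \<le> 1 + k powr d\<close> gives integrability for finite \<open>d\<close>.\<close>

lemma Lp_on_imp_integrable:
  assumes d: "1 \<le> d" and k: "Lp_on d {0..T} k" and k0: "\<And>t. t \<in> {0..T} \<Longrightarrow> 0 \<le> k t"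
  shows "integrable lebesgue (\<lambda>t. indicator {0..T} t *\<^sub>R k t)"
proof -
  let ?M = "lebesgue_on {0..T}"
  have km: "k \<in> borel_measurable ?M" using k by (simp add: Lp_on_def)
  have "emeasure ?M (space ?M) < \<infinity>"
    by (simp add: emeasure_restrict_space) (metis emeasure_lborel_Icc_eq ennreal_less_top)
  then interpret finite_measure ?M by (intro finite_measureI) (simp add: less_top)
  have "integrable ?M k"
  proof (cases "d = \<infinity>")
    case True
    then obtain C where C: "AE t in ?M. \<bar>k t\<bar> \<le> C" using k by (auto simp: Lp_on_def)
    show ?thesis by (rule integrable_const_bound[OF _ km, of C]) (use C in simp)
  next
    case False
    then obtain r where r: "d = ereal r" using d by (cases d) auto
    then have r1: "1 \<le> r" using d by (simp add: one_ereal_def)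
    have i: "integrable ?M (\<lambda>t. \<bar>k t\<bar> powr r)" using k r by (simp add: Lp_on_def)
    show ?thesis
    proof (rule Bochner_Integration.integrable_bound[OF Bochner_Integration.integrable_add[OF integrable_const[of 1] i] km], rule AE_I2)
      fix t
      have "\<bar>k t\<bar> \<le> 1 + \<bar>k t\<bar> powr r"
      proof (cases "\<bar>k t\<bar> \<le> 1")
        case True then show ?thesis by (simp add: add_increasing2)
      next
        case False
        then have "\<bar>k t\<bar> powr 1 \<le> \<bar>k t\<bar> powr r" using r1 by (intro powr_mono) auto
        then show ?thesis using False by simp
      qed
      then show "norm (k t) \<le> norm (1 + \<bar>k t\<bar> powr r)" by simp
    qed
  qed
  then show ?thesis by (subst (asm) integrable_restrict_space) auto
qed

lemma Lp_on_scale: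
  assumes k: "Lp_on d S k"
  shows "Lp_on d S (\<lambda>t. c * k t)"
proof (cases "d = \<infinity>")
  case True
  then obtain C where km: "k \<in> borel_measurable (lebesgue_on S)" and C: "AE t in lebesgue_on S. \<bar>k t\<bar> \<le> C"
    using k by (auto simp: Lp_on_def)
  have "AE t in lebesgue_on S. \<bar>c * k t\<bar> \<le> \<bar>c\<bar> * C"
    using C by eventually_elim (simp add: abs_mult mult_left_mono)
  then show ?thesis using km True by (auto simp: Lp_on_def)
next
  case False
  then have "k \<in> borel_measurable (lebesgue_on S)" "integrable (lebesgue_on S) (\<lambda>t. \<bar>k t\<bar> powr real_of_ereal d)"
    using k by (auto simp: Lp_on_def)
  then show ?thesis using False by (auto simp: Lp_on_def abs_mult powr_mult)
qed

section \<open>Truncated Herglotz vector fields\<close>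

locale herglotz_field =
  fixes d :: ereal and G :: "complex \<Rightarrow> real \<Rightarrow> complex"
  assumes d_ge_1: "1 \<le> d" and herglotz: "herglotz_vector_field d G"
begin

abbreviation mG :: "complex \<Rightarrow> real \<Rightarrow> complex" where "mG \<equiv> (\<lambda>z t. - G z t)"

lemma G_holomorphic: "0 \<le> t \<Longrightarrow> (\<lambda>z. G z t) holomorphic_on disc"
  using herglotz by (simp add: herglotz_vector_field_def)

lemma G_measurable: "z \<in> disc \<Longrightarrow> (\<lambda>t. indicator {0..} t *\<^sub>R G z t) \<in> borel_measurable lebesgue"
proof -
  assume "z \<in> disc"
  then have "G z \<in> borel_measurable (lebesgue_on {0..})"
    using herglotz by (simp add: herglotz_vector_field_def)
  then show ?thesis by (subst (asm) borel_measurable_restrict_space_iff) auto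
qed

lemma G_generator: "AE t in lebesgue. 0 \<le> t \<longrightarrow> infinitesimal_generator (\<lambda>z. G z t)"
proof -
  have "AE t in lebesgue_on {0..}. infinitesimal_generator (\<lambda>z. G z t)"
    using herglotz unfolding herglotz_vector_field_def by blast
  then show ?thesis by (subst (asm) AE_restrict_space_iff) auto
qed

lemma G_majorant:
  assumes K: "compact K" "K \<subseteq> disc" and T: "0 < T"
  shows "\<exists>k. (\<forall>t\<in>{0..T}. 0 \<le> k t) \<and> Lp_on d {0..T} k \<and>
    integrable lebesgue (\<lambda>t. indicator {0..T} t *\<^sub>R k t) \<and>
    (AE t in lebesgue. t \<in> {0..T} \<longrightarrow> (\<forall>z\<in>K. norm (G z t) \<le> k t))"
proof -
  obtain k where k: "\<forall>t\<in>{0..T}. 0 \<le> k t" "Lp_on d {0..T} k"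
    and ae: "AE t in lebesgue_on {0..T}. \<forall>z\<in>K. norm (G z t) \<le> k t"
    using herglotz K T unfolding herglotz_vector_field_def by meson
  have "AE t in lebesgue. t \<in> {0..T} \<longrightarrow> (\<forall>z\<in>K. norm (G z t) \<le> k t)"
    using ae by (subst (asm) AE_restrict_space_iff) auto
  moreover have "integrable lebesgue (\<lambda>t. indicator {0..T} t *\<^sub>R k t)"
    using Lp_on_imp_integrable[OF d_ge_1 k(2)] k(1) by blast
  ultimately show ?thesis using k by blast
qed

text \<open>The field \<open>- G\<close> is replaced by a Caratheodory field that agrees with it on a smaller closed disc and up
to time \<open>T\<close>, for almost every time.\<close>

definition truncation :: "real \<Rightarrow> real \<Rightarrow> (complex \<Rightarrow> real \<Rightarrow> complex) \<Rightarrow> (real \<Rightarrow> real) \<Rightarrow> bool" where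
  "truncation T R V k \<longleftrightarrow> caratheodory_field V k \<and>
     (AE t in lebesgue. t \<in> {0..T} \<longrightarrow> (\<forall>z\<in>cball 0 R. V z t = - G z t \<and> norm (G z t) \<le> k t))"

text \<open>\<open>G\<close> is composed with the nearest-point projection \<open>\<rho>\<close> onto \<open>cball 0 R\<close>, which is \<open>1\<close>-Lipschitz, and set to
zero at the exceptional times and outside \<open>{0..T}\<close>. Cauchy's estimate on a slightly larger disc turns
the majorant of \<open>G\<close> into a Lipschitz constant.\<close>

lemma truncation_exists:
  assumes R: "0 < R" "R < 1" and T: "0 < T"
  obtains V k kp where "truncation T R V k" "Lp_on d {0..T} kp" "\<And>t. t \<in> {0..T} \<Longrightarrow> 0 \<le> kp t"
    "k = (\<lambda>t. indicator {0..T} t *\<^sub>R kp t)"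
proof -
  define R' where "R' = (1 + R) / 2"
  have R': "R < R'" "R' < 1" using R by (auto simp: R'_def)
  have "cball 0 R' \<subseteq> disc" using R' by auto
  then obtain k0 where k0: "\<forall>t\<in>{0..T}. 0 \<le> k0 t" "Lp_on d {0..T} k0"
      "integrable lebesgue (\<lambda>t. indicator {0..T} t *\<^sub>R k0 t)"
    and ae: "AE t in lebesgue. t \<in> {0..T} \<longrightarrow> (\<forall>z\<in>cball 0 R'. norm (G z t) \<le> k0 t)"
    using G_majorant[OF compact_cball _ T] by blast
  define C where "C = 1 / (R' - R)"
  have "R' - R < 1" using R R' by linarith
  then have C: "1 \<le> C" using R' by (simp add: C_def field_simps)
  define kp where "kp t = C * k0 t" for t
  define k where "k t = indicator {0..T} t *\<^sub>R kp t" for t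
  obtain N where N: "N \<in> null_sets lebesgue"
    and bd: "\<And>t. t \<in> {0..T} \<Longrightarrow> t \<notin> N \<Longrightarrow> \<forall>z\<in>cball 0 R'. norm (G z t) \<le> k0 t"
    using ae by (rule AE_E3) auto
  define \<rho> where "\<rho> = closest_point (cball (0::complex) R)"
  have \<rho>R: "\<rho> z \<in> cball 0 R" for z
    unfolding \<rho>_def by (rule closest_point_in_set) (use R in auto)
  have \<rho>l: "norm (\<rho> z - \<rho> w) \<le> norm (z - w)" for z w
    using closest_point_lipschitz[of "cball (0::complex) R" z w] R by (simp add: \<rho>_def dist_norm)
  have \<rho>s: "\<rho> z = z" if "z \<in> cball 0 R" for z unfolding \<rho>_def by (rule closest_point_self[OF that])
  define V where "V z t = indicator ({0..T} - N) t *\<^sub>R (- (indicator {0..} t *\<^sub>R G (\<rho> z) t))" for z t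
  have Gb: "norm (G z t) \<le> kp t" if t: "t \<in> {0..T}" "t \<notin> N" and z: "z \<in> cball 0 R" for z t
  proof -
    have "z \<in> cball 0 R'" using z R' by simp
    then have "norm (G z t) \<le> k0 t" using bd[OF t] by blast
    also have "\<dots> \<le> C * k0 t" using C k0(1) t by (metis mult_1 mult_right_mono)
    finally show ?thesis by (simp add: kp_def)
  qed
  have Gl: "norm (G z t - G w t) \<le> kp t * norm (z - w)"
    if t: "t \<in> {0..T}" "t \<notin> N" and z: "z \<in> cball 0 R" "w \<in> cball 0 R" for z w t
  proof -
    have "norm (G z t - G w t) \<le> k0 t / (R' - R) * norm (z - w)"
      by (rule lipschitz_disc[OF G_holomorphic _ R' z]) (use t bd in auto)
    then show ?thesis by (simp add: kp_def C_def)
  qed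
  have kp0: "0 \<le> kp t" if "t \<in> {0..T}" for t using k0(1) C that by (simp add: kp_def)
  have kk: "k t = kp t" if "t \<in> {0..T}" for t using that by (simp add: k_def)
  have carath: "caratheodory_field V k"
  proof
    have "integrable lebesgue (\<lambda>t. C * (indicator {0..T} t *\<^sub>R k0 t))" using k0(3) by (rule integrable_mult_right)
    moreover have "(\<lambda>t. C * (indicator {0..T} t *\<^sub>R k0 t)) = k" by (auto simp: k_def kp_def fun_eq_iff)
    ultimately show "integrable lebesgue k" by (simp only:)
    show "0 \<le> k t" for t using kp0[of t] by (auto simp: k_def indicator_def)
    fix z
    have "\<rho> z \<in> disc" using \<rho>R[of z] R by simp
    moreover have "{0..T} - N \<in> sets lebesgue" using N by (intro sets.Diff) auto
    ultimately show "V z \<in> borel_measurable lebesgue" unfolding V_def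
      by (intro borel_measurable_scaleR borel_measurable_uminus borel_measurable_indicator G_measurable)
    fix t
    show "norm (V z t) \<le> k t"
      by (cases "t \<in> {0..T} - N") (use Gb[OF _ _ \<rho>R] kp0 kk in \<open>auto simp: V_def k_def indicator_def\<close>)
    fix w
    show "norm (V z t - V w t) \<le> k t * norm (z - w)"
    proof (cases "t \<in> {0..T} - N")
      case True
      then have t: "t \<in> {0..T}" "t \<notin> N" by auto
      have "norm (V z t - V w t) = norm (G (\<rho> z) t - G (\<rho> w) t)" using True by (simp add: V_def norm_minus_commute)
      also have "\<dots> \<le> kp t * norm (\<rho> z - \<rho> w)" by (rule Gl[OF t \<rho>R \<rho>R])
      also have "\<dots> \<le> kp t * norm (z - w)" using \<rho>l kp0[OF t(1)] by (rule mult_left_mono)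
      finally show ?thesis using kk[OF t(1)] by simp
    next
      case False
      then have "V z t - V w t = 0" by (simp add: V_def)
      moreover have "0 \<le> k t" using kp0[of t] by (auto simp: k_def indicator_def)
      ultimately show ?thesis by simp
    qed
  qed
  have aeN: "AE t in lebesgue. t \<notin> N" using N by (rule AE_not_in)
  have "truncation T R V k" unfolding truncation_def
  proof (intro conjI carath)
    show "AE t in lebesgue. t \<in> {0..T} \<longrightarrow> (\<forall>z\<in>cball 0 R. V z t = - G z t \<and> norm (G z t) \<le> k t)"
      using aeN
    proof eventually_elim
      case (elim t)
      show ?case
      proof (intro impI ballI conjI)
        fix z :: complex assume t: "t \<in> {0..T}" and z: "z \<in> cball 0 R"
        show "V z t = - G z t" using t elim \<rho>s[OF z] by (simp add: V_def)
        show "norm (G z t) \<le> k t" using Gb[OF t elim z] kk[OF t] by simp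
      qed
    qed
  qed
  then show thesis
    by (rule that[OF _ Lp_on_scale[OF k0(2), of C]]) (use kp0 in \<open>auto simp: k_def kp_def fun_eq_iff\<close>)
qed

lemma truncation_solution_iff:
  assumes V: "truncation T R V k" and ab: "0 \<le> a" "b \<le> T"
    and w: "\<And>t. t \<in> {a..b} \<Longrightarrow> w t \<in> cball 0 R"
  shows "caratheodory_solution V a b w \<longleftrightarrow> caratheodory_solution mG a b w"
proof -
  have "AE t in lebesgue. t \<in> {0..T} \<longrightarrow> (\<forall>z\<in>cball 0 R. V z t = - G z t \<and> norm (G z t) \<le> k t)"
    using V by (simp add: truncation_def)
  then have eq: "AE t in lebesgue. t \<in> {a..b} \<longrightarrow> V (w t) t = - G (w t) t"
  proof eventually_elim
    case (elim t)
    show ?case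
    proof
      assume t: "t \<in> {a..b}"
      then have "t \<in> {0..T}" using ab by auto
      then show "V (w t) t = - G (w t) t" using elim w[OF t] by blast
    qed
  qed
  have "(AE t in lebesgue. t \<in> {a..b} \<longrightarrow> (w has_vector_derivative V (w t) t) (at t within {a..b})) \<longleftrightarrow>
    (AE t in lebesgue. t \<in> {a..b} \<longrightarrow> (w has_vector_derivative - G (w t) t) (at t within {a..b}))"
  proof
    assume "AE t in lebesgue. t \<in> {a..b} \<longrightarrow> (w has_vector_derivative V (w t) t) (at t within {a..b})"
    then show "AE t in lebesgue. t \<in> {a..b} \<longrightarrow> (w has_vector_derivative - G (w t) t) (at t within {a..b})"
      using eq by eventually_elim simp
  next
    assume "AE t in lebesgue. t \<in> {a..b} \<longrightarrow> (w has_vector_derivative - G (w t) t) (at t within {a..b})"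
    then show "AE t in lebesgue. t \<in> {a..b} \<longrightarrow> (w has_vector_derivative V (w t) t) (at t within {a..b})"
      using eq by eventually_elim simp
  qed
  then show ?thesis by (simp add: caratheodory_solution_def)
qed

lemma compact_in_disc_bound:
  assumes "compact K" "K \<subseteq> disc"
  shows "\<exists>r. 0 < r \<and> r < 1 \<and> K \<subseteq> cball 0 r"
proof (cases "K = {}")
  case True
  then show ?thesis by (intro exI[of _ "1/2"]) auto
next
  case False
  obtain x where x: "x \<in> K" "\<And>y. y \<in> K \<Longrightarrow> norm y \<le> norm x"
    using continuous_attains_sup[OF assms(1) False, of norm] continuous_on_norm_id by blast
  have "norm x < 1" using x(1) assms(2) by auto
  show ?thesis
  proof (intro exI conjI)
    show "0 < (1 + norm x) / 2" by (simp add: add_pos_nonneg)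
    show "(1 + norm x) / 2 < 1" using \<open>norm x < 1\<close> by simp
    show "K \<subseteq> cball 0 ((1 + norm x) / 2)"
    proof
      fix y assume "y \<in> K"
      then have "norm y \<le> norm x" by (rule x(2))
      then show "y \<in> cball 0 ((1 + norm x) / 2)" using \<open>norm x < 1\<close> by simp
    qed
  qed
qed

lemma mG_solution_unique:
  assumes w: "caratheodory_solution mG a b w1" "caratheodory_solution mG a b w2"
    and range: "w1 ` {a..b} \<subseteq> disc" "w2 ` {a..b} \<subseteq> disc"
    and a: "0 \<le> a" and st: "s \<in> {a..b}" "t \<in> {a..b}" and eq: "w1 s = w2 s"
  shows "w1 t = w2 t"
proof -
  have "compact (w1 ` {a..b} \<union> w2 ` {a..b})"
    by (intro compact_Un compact_continuous_image caratheodory_solution_continuous_on[OF w(1)]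
        caratheodory_solution_continuous_on[OF w(2)] compact_Icc)
  then obtain R where R: "0 < R" "R < 1" "w1 ` {a..b} \<union> w2 ` {a..b} \<subseteq> cball 0 R"
    using compact_in_disc_bound[OF _ Un_least[OF range]] by blast
  have "0 < b + 1" using a st by auto
  then obtain V k and kp :: "real \<Rightarrow> real" where V: "truncation (b + 1) R V k" by (rule truncation_exists[OF R(1,2)])
  interpret caratheodory_field V k using V by (simp add: truncation_def)
  have "caratheodory_solution V a b w1" "caratheodory_solution V a b w2"
    by (rule truncation_solution_iff[THEN iffD2, OF V a _ _ w(1)], use R(3) in \<open>simp, blast\<close>)
      (rule truncation_solution_iff[THEN iffD2, OF V a _ _ w(2)], use R(3) in \<open>simp, blast\<close>)
  from solution_unique[OF this st eq] show ?thesis .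
qed

text \<open>By the inequality for generators, \<open>(1 - |w|^2) exp (- 2 \<integral>\<gamma>)\<close> is decreasing along solutions, where \<open>\<gamma>\<close>
majorizes \<open>|G 0|\<close>.\<close>

lemma a_priori_bound:
  assumes T: "0 < T"
  obtains \<Gamma> where "0 \<le> \<Gamma>"
    "\<And>a b w. \<lbrakk>0 \<le> a; a \<le> b; b \<le> T; caratheodory_solution mG a b w; w ` {a..b} \<subseteq> disc\<rbrakk>
       \<Longrightarrow> (1 - (norm (w b))^2) * exp (- \<Gamma>) \<le> 1 - (norm (w a))^2"
proof -
  obtain k where k: "\<forall>t\<in>{0..T}. 0 \<le> k t"
      "integrable lebesgue (\<lambda>t. indicator {0..T} t *\<^sub>R k t)"
    and ae: "AE t in lebesgue. t \<in> {0..T} \<longrightarrow> (\<forall>z\<in>{0}. norm (G z t) \<le> k t)"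
    using G_majorant[of "{0}", OF _ _ T] by auto
  define \<gamma> where "\<gamma> t = indicator {0..T} t *\<^sub>R k t" for t
  have \<gamma>: "integrable lebesgue \<gamma>" unfolding \<gamma>_def by (rule k(2))
  have \<gamma>0: "0 \<le> \<gamma> t" for t using k(1) by (auto simp: \<gamma>_def indicator_def)
  let ?P = "primitive \<gamma>"
  define \<Gamma> where "\<Gamma> = 2 * integral\<^sup>L lebesgue \<gamma>"
  show thesis
  proof (rule that[of \<Gamma>])
    show "0 \<le> \<Gamma>" unfolding \<Gamma>_def using primitive_bounds[OF \<gamma> \<gamma>0, of 0] by simp
    fix a b w assume ab: "0 \<le> a" "a \<le> b" "b \<le> T" and sol: "caratheodory_solution mG a b w" and disc: "w ` {a..b} \<subseteq> disc"
    have ACw: "abs_continuous_on a b w" using sol by (simp add: caratheodory_solution_def)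
    have ACc: "abs_continuous_on a b (\<lambda>t. cnj (w t))"
      by (rule abs_continuous_on_combine[OF ACw ACw, of _ 1]) (simp add: dist_norm flip: complex_cnj_diff)
    have ACm: "abs_continuous_on a b (\<lambda>t. w t * cnj (w t))" by (rule abs_continuous_on_mult[OF ACw ACc])
    have ACy: "abs_continuous_on a b (\<lambda>t. 1 - w t * cnj (w t))"
      by (rule abs_continuous_on_diff[OF abs_continuous_on_const ACm])
    have ACP: "abs_continuous_on a b (\<lambda>t. complex_of_real (?P t))" by (rule abs_continuous_on_of_real_primitive[OF \<gamma> \<gamma>0])
    have ACP2: "abs_continuous_on a b (\<lambda>t. -2 * complex_of_real (?P t))"
      by (rule abs_continuous_on_mult[OF abs_continuous_on_const ACP])
    let ?E = "\<lambda>t. exp (-2 * complex_of_real (?P t))"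
    let ?f = "\<lambda>t. (1 - w t * cnj (w t)) * ?E t"
    have "Re (?f b) \<le> Re (?f a)"
    proof (rule abs_continuous_on_Re_antimono[OF ab(2)])
      show "abs_continuous_on a b ?f" by (rule abs_continuous_on_mult[OF ACy abs_continuous_on_exp[OF ACP2]])
      have D: "AE t in lebesgue. t \<in> {a..b} \<longrightarrow> (w has_vector_derivative - G (w t) t) (at t within {a..b})"
        using sol by (simp add: caratheodory_solution_def)
      show "AE x in lebesgue. x \<in> {a..b} \<longrightarrow> (\<exists>D. (?f has_vector_derivative D) (at x within {a..b}) \<and> Re D \<le> 0)"
        using D ae G_generator AE_primitive_has_vector_derivative[OF \<gamma>]
      proof eventually_elim
        case (elim x)
        show ?case
        proof
          assume x: "x \<in> {a..b}"
          then have x0: "0 \<le> x" "x \<in> {0..T}" using ab by auto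
          have wx: "w x \<in> disc" using disc x by blast
          have dw: "(w has_vector_derivative - G (w x) x) (at x within {a..b})" using elim(1) x by blast
          have dc: "((\<lambda>t. cnj (w t)) has_vector_derivative cnj (- G (w x) x)) (at x within {a..b})"
            using bounded_linear.has_vector_derivative[OF bounded_linear_cnj dw] .
          let ?y' = "- (w x * cnj (- G (w x) x) + (- G (w x) x) * cnj (w x))"
          have dy: "((\<lambda>t. 1 - w t * cnj (w t)) has_vector_derivative 0 - (w x * cnj (- G (w x) x) + (- G (w x) x) * cnj (w x))) (at x within {a..b})"
            by (intro has_vector_derivative_diff has_vector_derivative_const has_vector_derivative_mult dw dc)
          have "(?P has_vector_derivative \<gamma> x) (at x within {a..b})" using elim(4) by (rule has_vector_derivative_at_within)
          then have "((\<lambda>t. complex_of_real (?P t)) has_vector_derivative of_real (\<gamma> x)) (at x within {a..b})"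
            using bounded_linear.has_vector_derivative[OF bounded_linear_of_real] by blast
          then have "((\<lambda>t. -2 * complex_of_real (?P t)) has_vector_derivative -2 * of_real (\<gamma> x)) (at x within {a..b})"
            by (rule has_vector_derivative_mult_right)
          from field_vector_diff_chain_within[OF this, of exp "?E x"]
          have dE: "(?E has_vector_derivative -2 * of_real (\<gamma> x) * ?E x) (at x within {a..b})"
            by (simp add: o_def DERIV_exp has_field_derivative_at_within)
          let ?D = "(1 - w x * cnj (w x)) * (-2 * of_real (\<gamma> x) * ?E x) + (0 - (w x * cnj (- G (w x) x) + (- G (w x) x) * cnj (w x))) * ?E x"
          have dD: "(?f has_vector_derivative ?D) (at x within {a..b})"
            by (rule has_vector_derivative_mult[OF dy dE])
          have Ex: "?E x = of_real (exp (-2 * ?P x))" by (simp add: exp_of_real[symmetric])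
          have c1: "w x * cnj (G (w x) x) + G (w x) x * cnj (w x) = of_real (2 * Re (cnj (w x) * G (w x) x))"
            by (simp add: complex_eq_iff)
          have c2: "1 - w x * cnj (w x) = of_real (1 - (norm (w x))^2)"
            unfolding complex_norm_square[symmetric] by simp
          have "?D = of_real (exp (-2 * ?P x)) * ((w x * cnj (G (w x) x) + G (w x) x * cnj (w x)) - 2 * of_real (\<gamma> x) * (1 - w x * cnj (w x)))"
            unfolding Ex by (simp add: algebra_simps)
          then have eqD: "?D = of_real (exp (-2 * ?P x) * (2 * Re (cnj (w x) * G (w x) x) - 2 * \<gamma> x * (1 - (norm (w x))^2)))"
            unfolding c1 c2 by (simp only: of_real_mult of_real_diff of_real_numeral)
          have "Re ?D = exp (-2 * ?P x) * (2 * Re (cnj (w x) * G (w x) x) - 2 * \<gamma> x * (1 - (norm (w x))^2))"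
            unfolding eqD by (rule Re_complex_of_real)
          moreover have "2 * Re (cnj (w x) * G (w x) x) - 2 * \<gamma> x * (1 - (norm (w x))^2) \<le> 0"
          proof -
            have "Re (cnj (w x) * G (w x) x) \<le> (1 - (norm (w x))^2) * norm (G 0 x)"
              using generator_inequality[OF _ wx] elim(3) x0 by blast
            also have "\<dots> \<le> (1 - (norm (w x))^2) * \<gamma> x"
            proof (rule mult_left_mono)
              show "norm (G 0 x) \<le> \<gamma> x" using elim(2) x0 by (simp add: \<gamma>_def)
              show "0 \<le> 1 - (norm (w x))^2" using wx by (simp add: power_le_one)
            qed
            finally show ?thesis by (simp add: algebra_simps)
          qed
          ultimately have "Re ?D \<le> 0" by (simp only: mult_nonneg_nonpos exp_ge_zero)
          then show "\<exists>D. (?f has_vector_derivative D) (at x within {a..b}) \<and> Re D \<le> 0" using dD by blast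
        qed
      qed
    qed
    moreover have "?f t = of_real ((1 - (norm (w t))^2) * exp (-2 * ?P t))" for t
    proof -
      have "1 - w t * cnj (w t) = of_real (1 - (norm (w t))^2)" unfolding complex_norm_square[symmetric] by simp
      moreover have "?E t = of_real (exp (-2 * ?P t))" by (simp add: exp_of_real[symmetric])
      ultimately show ?thesis by (simp only: of_real_mult)
    qed
    ultimately have le: "(1 - (norm (w b))^2) * exp (-2 * ?P b) \<le> (1 - (norm (w a))^2) * exp (-2 * ?P a)"
      by (simp only: Re_complex_of_real)
    have y: "0 \<le> 1 - (norm (w t))^2" if "t \<in> {a..b}" for t
      using disc that by (auto simp: power_le_one image_subset_iff less_imp_le)
    have "(1 - (norm (w b))^2) * exp (- \<Gamma>) \<le> (1 - (norm (w b))^2) * exp (-2 * ?P b)"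
      using primitive_bounds[OF \<gamma> \<gamma>0, of b] y[of b] ab by (intro mult_left_mono) (auto simp: \<Gamma>_def)
    also note le
    also have "(1 - (norm (w a))^2) * exp (-2 * ?P a) \<le> (1 - (norm (w a))^2) * 1"
      using primitive_bounds[OF \<gamma> \<gamma>0, of a] y[of a] ab by (intro mult_left_mono) auto
    finally show "(1 - (norm (w b))^2) * exp (- \<Gamma>) \<le> 1 - (norm (w a))^2" by simp
  qed
qed

section \<open>The backward flow\<close>

definition backward_solution :: "real \<Rightarrow> complex \<Rightarrow> (real \<Rightarrow> complex) \<Rightarrow> bool" where
  "backward_solution t z w \<longleftrightarrow> caratheodory_solution mG 0 t w \<and> w ` {0..t} \<subseteq> disc \<and> w t = z"

definition backflow :: "real \<Rightarrow> complex \<Rightarrow> real \<Rightarrow> complex" where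
  "backflow t z = (SOME w. backward_solution t z w)"

text \<open>The radius \<open>R\<close> is chosen slightly larger than the a priori bound permits a solution of the original
equation to reach. If a solution of the truncated equation met the circle of radius \<open>R\<close>, then after the
last time at which it does so it would solve the original equation, contradicting that bound.\<close>

lemma truncated_solution_stays_inside:
  assumes T: "0 < T" and r: "0 < r" "r < 1"
  shows "\<exists>R>r. R < 1 \<and> (\<forall>V k t u. truncation T R V k \<longrightarrow> 0 \<le> t \<longrightarrow> t \<le> T \<longrightarrow> u t \<in> cball 0 r \<longrightarrow>
    caratheodory_solution V 0 t u \<longrightarrow> (\<forall>s\<in>{0..t}. u s \<in> ball 0 R))"
proof -
  obtain \<Gamma> where \<Gamma>: "0 \<le> \<Gamma>"
    "\<And>a b w. \<lbrakk>0 \<le> a; a \<le> b; b \<le> T; caratheodory_solution mG a b w; w ` {a..b} \<subseteq> disc\<rbrakk>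
       \<Longrightarrow> (1 - (norm (w b))^2) * exp (- \<Gamma>) \<le> 1 - (norm (w a))^2"
    by (rule a_priori_bound[OF T]) blast
  define q where "q = (1 - r^2) * exp (- \<Gamma>)"
  have r2: "0 < 1 - r^2" using r by (simp add: power_less_one_iff)
  have q: "0 < q" "q \<le> 1 - r^2"
  proof -
    show "0 < q" using r2 by (simp add: q_def)
    have "(1 - r^2) * exp (- \<Gamma>) \<le> (1 - r^2) * 1" using r2 \<Gamma>(1) by (intro mult_left_mono) auto
    then show "q \<le> 1 - r^2" by (simp add: q_def)
  qed
  define R where "R = sqrt (1 - q / 2)"
  have q1: "0 \<le> 1 - q / 2" using q r by (smt (verit) field_sum_of_halves zero_le_power2)
  have R2: "R^2 = 1 - q / 2" using q1 by (simp add: R_def)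
  have R0: "0 \<le> R" using q1 by (simp add: R_def)
  show ?thesis
  proof (intro exI[of _ R] conjI allI impI)
    show rR: "r < R"
    proof (rule power2_less_imp_less[OF _ R0])
      show "r^2 < R^2" unfolding R2 using q by linarith
    qed
    show R1: "R < 1"
    proof (rule power2_less_imp_less)
      show "R^2 < 1^2" unfolding R2 using q by simp
    qed simp
    fix V k t u
    assume V: "truncation T R V k" and t: "0 \<le> t" "t \<le> T" and ut: "u t \<in> cball 0 r"
      and sol: "caratheodory_solution V 0 t u"
    have cont: "continuous_on {0..t} u" by (rule caratheodory_solution_continuous_on[OF sol])
    define S where "S = {s\<in>{0..t}. R \<le> norm (u s)}"
    have "S = {}"
    proof (rule ccontr)
      assume ne: "S \<noteq> {}"
      have "closed S" unfolding S_def
        using continuous_on_closed_Collect_le[OF continuous_on_const continuous_on_norm[OF cont] closed_atLeastAtMost] by simp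
      then have "compact S" using compact_Icc
        by (metis (no_types, lifting) S_def bounded_subset bounded_closed_interval compact_eq_bounded_closed mem_Collect_eq subsetI)
      \<comment> \<open>\<open>s1\<close> is the last time at which the solution is outside \<open>ball 0 R\<close>.\<close>
      then obtain s1 where s1: "s1 \<in> S" "\<And>s. s \<in> S \<Longrightarrow> s \<le> s1"
        using compact_attains_sup[OF _ ne] by blast
      have s1t: "0 \<le> s1" "s1 < t" "R \<le> norm (u s1)"
        using s1(1) ut rR by (auto simp: S_def less_le)
      have inside: "norm (u s) < R" if "s1 < s" "s \<le> t" for s
        using s1(2)[of s] that s1t by (force simp: S_def)
      have "((\<lambda>s. norm (u s)) \<longlongrightarrow> norm (u s1)) (at s1 within {0..t})"
        using cont s1t by (intro tendsto_norm) (simp add: continuous_on_def)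
      then have "((\<lambda>s. norm (u s)) \<longlongrightarrow> norm (u s1)) (at s1 within {s1<..t})"
        by (rule tendsto_within_subset) (use s1t in auto)
      moreover have "at s1 within {s1<..t} \<noteq> bot"
        using s1t by (simp add: at_within_eq_bot_iff)
      moreover have "\<forall>\<^sub>F s in at s1 within {s1<..t}. norm (u s) \<le> R"
        unfolding eventually_at_filter using inside by (intro always_eventually) (auto intro: less_imp_le)
      ultimately have us1: "norm (u s1) \<le> R" by (intro tendsto_upperbound)
      have inR: "u s \<in> cball 0 R" if "s \<in> {s1..t}" for s
        using inside[of s] us1 that by (cases "s = s1") auto
      have "caratheodory_solution V s1 t u" by (rule caratheodory_solution_subinterval[OF sol]) (use s1t in auto)
      then have "caratheodory_solution mG s1 t u"
        by (rule truncation_solution_iff[THEN iffD1, OF V s1t(1) t(2), rotated]) (rule inR)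
      moreover have "u ` {s1..t} \<subseteq> disc"
      proof (rule image_subsetI)
        fix s assume "s \<in> {s1..t}"
        from inR[OF this] show "u s \<in> disc" using R1 by simp
      qed
      ultimately have "(1 - (norm (u t))^2) * exp (- \<Gamma>) \<le> 1 - (norm (u s1))^2"
        using s1t t by (intro \<Gamma>(2)) auto
      moreover have "(1 - r^2) * exp (- \<Gamma>) \<le> (1 - (norm (u t))^2) * exp (- \<Gamma>)"
      proof (rule mult_right_mono)
        have "(norm (u t))^2 \<le> r^2" using ut by (intro power_mono) auto
        then show "1 - r^2 \<le> 1 - (norm (u t))^2" by simp
      qed simp
      moreover have "R^2 \<le> (norm (u s1))^2" using s1t R0 by (intro power_mono)
      ultimately have "q \<le> q / 2" using R2 q_def by linarith
      then show False using q by simp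
    qed
    then have "\<not> R \<le> norm (u s)" if "s \<in> {0..t}" for s using that by (auto simp: S_def)
    then show "\<forall>s\<in>{0..t}. u s \<in> ball 0 R" by (simp add: not_le)
  qed
qed

lemma backward_solution_unique:
  assumes "backward_solution t z w1" "backward_solution t z w2" "s \<in> {0..t}"
  shows "w1 s = w2 s"
proof (rule mG_solution_unique)
  show "caratheodory_solution mG 0 t w1" "caratheodory_solution mG 0 t w2" "w1 ` {0..t} \<subseteq> disc" "w2 ` {0..t} \<subseteq> disc"
    "w1 t = w2 t"
    using assms(1,2) by (simp_all add: backward_solution_def)
  show "t \<in> {0..t}" using assms(3) by simp
qed (use assms(3) in simp_all)

lemma backward_solutionD:
  assumes "backward_solution t z w"
  shows "caratheodory_solution mG 0 t w" "w ` {0..t} \<subseteq> disc" "\<And>s. s \<in> {0..t} \<Longrightarrow> w s \<in> disc" "w t = z"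
  using assms unfolding backward_solution_def by blast+

text \<open>Bundles the data that serve all starting points in \<open>cball 0 r\<close> and all times up to \<open>T\<close>: the backward flow
remains in \<open>ball 0 R\<close>, solves the truncated equation there, and its increments are bounded by those of
\<open>primitive k\<close>. The function \<open>kp\<close> is the representative of \<open>k\<close> whose membership in \<open>L^d\<close> is recorded.\<close>

definition flow_majorant where
  "flow_majorant T r R V k kp \<longleftrightarrow> 0 < R \<and> r < R \<and> R < 1 \<and> truncation T R V k \<and>
    Lp_on d {0..T} kp \<and> (\<forall>t\<in>{0..T}. 0 \<le> kp t) \<and> k = (\<lambda>t. indicator {0..T} t *\<^sub>R kp t) \<and>
    (\<forall>t z. 0 \<le> t \<longrightarrow> t \<le> T \<longrightarrow> z \<in> cball 0 r \<longrightarrow>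
      backward_solution t z (backflow t z) \<and> (\<forall>s\<in>{0..t}. backflow t z s \<in> ball 0 R) \<and> caratheodory_solution V 0 t (backflow t z) \<and>
      (\<forall>s s'. 0 \<le> s \<longrightarrow> s \<le> s' \<longrightarrow> s' \<le> t \<longrightarrow> norm (backflow t z s' - backflow t z s) \<le> primitive k s' - primitive k s))"

lemma flow_majorant_exists:
  assumes T: "0 < T" and r: "0 < r" "r < 1"
  shows "\<exists>R V k kp. flow_majorant T r R V k kp"
proof -
  obtain R where R: "r < R" "R < 1"
    and stay: "\<forall>V k t u. truncation T R V k \<longrightarrow> 0 \<le> t \<longrightarrow> t \<le> T \<longrightarrow> u t \<in> cball 0 r \<longrightarrow>
    caratheodory_solution V 0 t u \<longrightarrow> (\<forall>s\<in>{0..t}. u s \<in> ball 0 R)"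
    using truncated_solution_stays_inside[OF T r] by blast
  have R0: "0 < R" using r R by simp
  obtain V k kp where V: "truncation T R V k" and kp: "Lp_on d {0..T} kp" "\<And>t. t \<in> {0..T} \<Longrightarrow> 0 \<le> kp t"
    "k = (\<lambda>t. indicator {0..T} t *\<^sub>R kp t)"
    by (rule truncation_exists[OF R0 R(2) T]) blast
  interpret caratheodory_field V k using V by (simp add: truncation_def)
  have main: "backward_solution t z (backflow t z) \<and> (\<forall>s\<in>{0..t}. backflow t z s \<in> ball 0 R) \<and> caratheodory_solution V 0 t (backflow t z) \<and>
      (\<forall>s s'. 0 \<le> s \<longrightarrow> s \<le> s' \<longrightarrow> s' \<le> t \<longrightarrow> norm (backflow t z s' - backflow t z s) \<le> primitive k s' - primitive k s)"
    if t: "0 \<le> t" "t \<le> T" and z: "z \<in> cball 0 r" for t z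
  proof -
    obtain u where u: "continuous_on UNIV u" "u t = z"
      "\<And>s t. u t - u s = primitive (\<lambda>t. V (u t) t) t - primitive (\<lambda>t. V (u t) t) s"
      using solution_exists[of t z] by blast
    have sol: "caratheodory_solution V 0 t u" by (rule integral_solution(1)[OF u(1,3)])
    have stays: "\<forall>s\<in>{0..t}. u s \<in> ball 0 R"
      using stay V t u(2) z sol by blast
    then have inR: "u s \<in> cball 0 R" if "s \<in> {0..t}" for s using that ball_subset_cball by blast
    have "caratheodory_solution mG 0 t u"
      by (rule truncation_solution_iff[THEN iffD1, OF V order_refl t(2) _ sol]) (rule inR)
    moreover have "ball 0 R \<subseteq> disc" using R(2) by (intro subset_ball) simp
    ultimately have bu: "backward_solution t z u"
      using stays u(2) unfolding backward_solution_def by blast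
    then have b: "backward_solution t z (backflow t z)" unfolding backflow_def by (rule someI[of "backward_solution t z"])
    have eq: "backflow t z s = u s" if "s \<in> {0..t}" for s by (rule backward_solution_unique[OF b bu that])
    have inR': "backflow t z s \<in> cball 0 R" if "s \<in> {0..t}" for s using eq[OF that] inR[OF that] by simp
    have "caratheodory_solution V 0 t (backflow t z)"
      by (rule truncation_solution_iff[THEN iffD2, OF V order_refl t(2) _ backward_solutionD(1)[OF b]]) (rule inR')
    moreover have "\<forall>s\<in>{0..t}. backflow t z s \<in> ball 0 R" using eq stays by simp
    moreover have "norm (backflow t z s' - backflow t z s) \<le> primitive k s' - primitive k s"
      if "0 \<le> s" "s \<le> s'" "s' \<le> t" for s s'
      using integral_solution(2)[OF u(1,3) that(2)] eq[of s] eq[of s'] that by simp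
    ultimately show ?thesis using b by blast
  qed
  have kp0: "\<forall>t\<in>{0..T}. 0 \<le> kp t" using kp(2) by blast
  show ?thesis
    unfolding flow_majorant_def
    by (intro exI[of _ R] exI[of _ V] exI[of _ k] exI[of _ kp] conjI R0 R V kp(1,3) kp0 allI impI)
      (intro main[THEN conjunct1] main[THEN conjunct2, THEN conjunct1] main[THEN conjunct2, THEN conjunct2, THEN conjunct1]
        main[THEN conjunct2, THEN conjunct2, THEN conjunct2, rule_format]; assumption)+
qed

lemma flow_majorantD:
  assumes "flow_majorant T r R V k kp"
  shows "0 < R" "r < R" "R < 1" "truncation T R V k" "caratheodory_field V k"
    "Lp_on d {0..T} kp" "\<And>t. t \<in> {0..T} \<Longrightarrow> 0 \<le> kp t" "k = (\<lambda>t. indicator {0..T} t *\<^sub>R kp t)"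
    "\<And>t z. \<lbrakk>0 \<le> t; t \<le> T; z \<in> cball 0 r\<rbrakk> \<Longrightarrow> backward_solution t z (backflow t z)"
    "\<And>t z s. \<lbrakk>0 \<le> t; t \<le> T; z \<in> cball 0 r; s \<in> {0..t}\<rbrakk> \<Longrightarrow> backflow t z s \<in> ball 0 R"
    "\<And>t z. \<lbrakk>0 \<le> t; t \<le> T; z \<in> cball 0 r\<rbrakk> \<Longrightarrow> caratheodory_solution V 0 t (backflow t z)"
    "\<And>t z s s'. \<lbrakk>0 \<le> s; s \<le> s'; s' \<le> t; t \<le> T; z \<in> cball 0 r\<rbrakk>
       \<Longrightarrow> norm (backflow t z s' - backflow t z s) \<le> primitive k s' - primitive k s"
proof -
  show "caratheodory_field V k" using assms unfolding flow_majorant_def truncation_def by blast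
  show "norm (backflow t z s' - backflow t z s) \<le> primitive k s' - primitive k s"
    if "0 \<le> s" "s \<le> s'" "s' \<le> t" "t \<le> T" "z \<in> cball 0 r" for t z s s'
  proof -
    have "0 \<le> t" using that by linarith
    then show ?thesis using assms that unfolding flow_majorant_def by blast
  qed
qed (use assms in \<open>unfold flow_majorant_def, blast\<close>)+

lemma disc_radius:
  assumes "z \<in> disc"
  shows "\<exists>r. 0 < r \<and> r < 1 \<and> z \<in> ball 0 r"
proof (intro exI conjI)
  show "0 < (1 + norm z) / 2" by (simp add: add_pos_nonneg)
qed (use assms in auto)

lemma backflow_solution:
  assumes t: "0 \<le> t" and z: "z \<in> disc"
  shows "backward_solution t z (backflow t z)"
proof -
  obtain r where r: "0 < r" "r < 1" "z \<in> ball 0 r" using disc_radius[OF z] by blast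
  have "0 < t + 1" using t by simp
  then obtain R V k kp where "flow_majorant (t + 1) r R V k kp"
    using flow_majorant_exists[OF _ r(1,2)] by blast
  then show ?thesis by (rule flow_majorantD(9)) (use t r in auto)
qed

lemma backflow_end: "\<lbrakk>0 \<le> t; z \<in> disc\<rbrakk> \<Longrightarrow> backflow t z t = z"
  by (rule backward_solutionD(4)[OF backflow_solution])

lemma backflow_in_disc: "\<lbrakk>0 \<le> s; s \<le> t; z \<in> disc\<rbrakk> \<Longrightarrow> backflow t z s \<in> disc"
  by (rule backward_solutionD(3)[OF backflow_solution]) auto

lemma backward_solution_restrict:
  assumes w: "backward_solution t z w" and s: "0 \<le> s" "s \<le> t"
  shows "backward_solution s (w s) w"
  unfolding backward_solution_def
proof (intro conjI)
  show "caratheodory_solution mG 0 s w"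
    by (rule caratheodory_solution_subinterval[OF backward_solutionD(1)[OF w] order_refl s(2)])
  show "w ` {0..s} \<subseteq> disc" using backward_solutionD(3)[OF w] s by (intro image_subsetI) auto
qed simp

lemma backflow_cocycle:
  assumes "0 \<le> s" "s \<le> s'" "s' \<le> t" "z \<in> disc"
  shows "backflow s' (backflow t z s') s = backflow t z s"
proof -
  have "backward_solution s' (backflow t z s') (backflow t z)"
    using assms by (intro backward_solution_restrict[OF backflow_solution]) auto
  moreover have "backward_solution s' (backflow t z s') (backflow s' (backflow t z s'))"
    using assms by (intro backflow_solution backflow_in_disc) auto
  ultimately show ?thesis using assms by (intro backward_solution_unique) auto
qed

lemma backflow_inj:
  assumes t: "0 \<le> t" and z: "z1 \<in> disc" "z2 \<in> disc" and s: "s \<in> {0..t}" and eq: "backflow t z1 s = backflow t z2 s"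
  shows "z1 = z2"
proof -
  have "backflow t z1 t = backflow t z2 t"
    by (rule mG_solution_unique[OF backward_solutionD(1)[OF backflow_solution[OF t z(1)]] backward_solutionD(1)[OF backflow_solution[OF t z(2)]]
          backward_solutionD(2)[OF backflow_solution[OF t z(1)]] backward_solutionD(2)[OF backflow_solution[OF t z(2)]] order_refl s _ eq])
      (use t in simp)
  then show ?thesis using t z by (simp add: backflow_end)
qed

text \<open>A truncated field agrees with \<open>- G\<close> near the solution, hence is complex differentiable there for almost
every time.\<close>

lemma backflow_holomorphic:
  assumes s: "0 \<le> s" "s \<le> t"
  shows "(\<lambda>z. backflow t z s) holomorphic_on disc"
  unfolding holomorphic_on_open[OF open_ball]
proof
  fix z0 :: complex assume z0: "z0 \<in> disc"
  obtain r where r: "0 < r" "r < 1" "z0 \<in> ball 0 r" using disc_radius[OF z0] by blast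
  have T: "0 < t + 1" using s by simp
  obtain R V k kp where F: "flow_majorant (t + 1) r R V k kp" using flow_majorant_exists[OF T r(1,2)] by blast
  note R = flow_majorantD(2,3)[OF F] and V = flow_majorantD(4)[OF F] and bR = flow_majorantD(10)[OF F]
    and bV = flow_majorantD(11)[OF F]
  interpret caratheodory_field V k using V by (simp add: truncation_def)
  have t: "0 \<le> t" using s by simp
  have "(\<lambda>z. backflow t z s) field_differentiable (at z0)"
  proof (rule flow_field_differentiable[where A="ball 0 r" and a=0 and b=t and ?t0.0=t])
    show "caratheodory_solution V 0 t (backflow t z)" if "z \<in> ball 0 r" for z using that t by (intro bV) auto
    show "backflow t z t = z" if "z \<in> ball 0 r" for z using that r by (intro backflow_end t) auto
    have "AE \<tau> in lebesgue. \<tau> \<in> {0..t + 1} \<longrightarrow> (\<forall>z\<in>cball 0 R. V z \<tau> = - G z \<tau> \<and> norm (G z \<tau>) \<le> k \<tau>)"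
      using V by (simp add: truncation_def)
    then show "AE \<tau> in lebesgue. \<tau> \<in> {0..t} \<longrightarrow>
      ((\<lambda>z. V z \<tau>) has_field_derivative deriv (\<lambda>z. - G z \<tau>) (backflow t z0 \<tau>)) (at (backflow t z0 \<tau>))"
    proof eventually_elim
      case (elim \<tau>)
      show ?case
      proof
        assume \<tau>: "\<tau> \<in> {0..t}"
        have b: "backflow t z0 \<tau> \<in> ball 0 R" by (rule bR[OF _ _ _ \<tau>]) (use r t in auto)
        have "(\<lambda>z. - G z \<tau>) holomorphic_on disc" using \<tau> by (intro holomorphic_on_minus G_holomorphic) auto
        moreover have "backflow t z0 \<tau> \<in> disc" using b R by simp
        ultimately have "((\<lambda>z. - G z \<tau>) has_field_derivative deriv (\<lambda>z. - G z \<tau>) (backflow t z0 \<tau>)) (at (backflow t z0 \<tau>))"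
          by (intro holomorphic_derivI[OF _ open_ball])
        then show "((\<lambda>z. V z \<tau>) has_field_derivative deriv (\<lambda>z. - G z \<tau>) (backflow t z0 \<tau>)) (at (backflow t z0 \<tau>))"
          by (rule has_field_derivative_transform_within_open[OF _ open_ball b]) (use elim \<tau> in auto)
      qed
    qed
  qed (use r s in auto)
  then show "\<exists>f'. ((\<lambda>z. backflow t z s) has_field_derivative f') (at z0)" by (simp add: field_differentiable_def)
qed

text \<open>The solution of a truncated equation through \<open>\<zeta>\<close> at time \<open>t\<close> exists for all times and stays inside the
truncation radius a little longer than \<open>t\<close>. So every trajectory that reaches \<open>t\<close> can be continued.\<close>

lemma forward_extension:
  assumes t: "0 \<le> t" and \<zeta>: "\<zeta> \<in> disc"
  shows "\<exists>t'>t. \<exists>\<zeta>'\<in>disc. backflow t' \<zeta>' 0 = backflow t \<zeta> 0"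
proof -
  have w: "caratheodory_solution mG 0 t (backflow t \<zeta>)" "backflow t \<zeta> ` {0..t} \<subseteq> disc"
    using backward_solutionD(1,2)[OF backflow_solution[OF t \<zeta>]] .
  have "compact (backflow t \<zeta> ` {0..t})"
    by (intro compact_continuous_image caratheodory_solution_continuous_on[OF w(1)] compact_Icc)
  then obtain R0 where R0: "0 < R0" "R0 < 1" "backflow t \<zeta> ` {0..t} \<subseteq> cball 0 R0"
    using compact_in_disc_bound[OF _ w(2)] by blast
  define R where "R = (1 + R0) / 2"
  have R: "0 < R" "R < 1" "R0 < R" using R0 by (auto simp: R_def)
  have T: "0 < t + 1" using t by simp
  obtain V k and kp :: "real \<Rightarrow> real" where V: "truncation (t + 1) R V k" by (rule truncation_exists[OF R(1,2) T])
  interpret caratheodory_field V k using V by (simp add: truncation_def)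
  obtain u where u: "continuous_on UNIV u" "u t = \<zeta>"
    "\<And>s t. u t - u s = primitive (\<lambda>t. V (u t) t) t - primitive (\<lambda>t. V (u t) t) s"
    using solution_exists[of t \<zeta>] by blast
  have sol: "caratheodory_solution V a b u" for a b by (rule integral_solution(1)[OF u(1,3)])
  have bR0: "backflow t \<zeta> s \<in> cball 0 R0" if "s \<in> {0..t}" for s using that R0(3) by blast
  have bR: "backflow t \<zeta> s \<in> cball 0 R" if "s \<in> {0..t}" for s using bR0[OF that] R(3) by simp
  have "t \<le> t + 1" by simp
  then have wV: "caratheodory_solution V 0 t (backflow t \<zeta>)"
    by (rule truncation_solution_iff[THEN iffD2, OF V order_refl _ _ w(1)]) (rule bR)
  have eq: "u s = backflow t \<zeta> s" if "s \<in> {0..t}" for s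
    by (rule solution_unique[OF sol wV _ that, of t]) (use t u(2) backflow_end[OF t \<zeta>] in auto)
  have "u t \<in> ball 0 R" using bR0[of t] R t eq[of t] by simp
  then have "\<forall>\<^sub>F s in at t. u s \<in> ball 0 R"
    using u(1) by (intro topological_tendstoD[OF _ open_ball]) (auto simp: continuous_on_def)
  then obtain \<delta> where \<delta>: "\<delta> > 0" "\<And>s. s \<noteq> t \<Longrightarrow> dist s t < \<delta> \<Longrightarrow> u s \<in> ball 0 R"
    unfolding eventually_at by auto
  define t' where "t' = t + min 1 (\<delta> / 2)"
  have t': "t < t'" "t' \<le> t + 1" "t' - t < \<delta>" using \<delta>(1) by (auto simp: t'_def min_def)
  have inR: "u s \<in> cball 0 R" if "s \<in> {0..t'}" for s
  proof (cases "s \<le> t")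
    case True
    then have "s \<in> {0..t}" using that by simp
    then show ?thesis using eq bR by simp
  next
    case False
    then have "u s \<in> ball 0 R" using that t' by (intro \<delta>(2)) (auto simp: dist_real_def)
    then show ?thesis by simp
  qed
  have "caratheodory_solution mG 0 t' u"
    by (rule truncation_solution_iff[THEN iffD1, OF V order_refl t'(2) _ sol]) (rule inR)
  moreover have "cball 0 R \<subseteq> disc" using R(2) by auto
  ultimately have bs: "backward_solution t' (u t') u"
    using inR unfolding backward_solution_def by blast
  have ut': "u t' \<in> disc" using inR[of t'] t t' R by simp
  have "backflow t' (u t') 0 = u 0"
    by (rule backward_solution_unique[OF backflow_solution[OF _ ut'] bs]) (use t t' in auto)
  then have "backflow t' (u t') 0 = backflow t \<zeta> 0" using eq[of 0] t by simp
  then show ?thesis using t'(1) ut' by blast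
qed

section \<open>The decreasing Loewner chain\<close>

text \<open>The constant does not depend on \<open>s\<close>, since all the maps \<open>f_s\<close> send the disc into itself.\<close>

lemma transition_bounds:
  assumes R: "0 < R" "R < 1"
  shows "\<exists>L>0. \<forall>s\<ge>0. (\<forall>z\<in>cball 0 R. norm (deriv (\<lambda>z. backflow s z 0) z) \<le> L) \<and>
    (\<forall>z\<in>cball 0 R. \<forall>w\<in>cball 0 R. norm (backflow s z 0 - backflow s w 0) \<le> L * norm (z - w) \<and>
      norm (backflow s w 0 - backflow s z 0 - deriv (\<lambda>z. backflow s z 0) z * (w - z)) \<le> L * norm (w - z)^2)"
proof -
  define R1 where "R1 = R + (1 - R) / 3"
  define R' where "R' = R + 2 * (1 - R) / 3"
  have RR: "R < R1" "R1 < R'" "R' < 1" "R < R'" using R by (auto simp: R1_def R'_def field_simps)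
  define L1 where "L1 = 1 / (R' - R)"
  define L2 where "L2 = 1 / (R' - R1) / (R1 - R)"
  have L: "0 < L1" "0 < L2" using RR by (auto simp: L1_def L2_def)
  show ?thesis
  proof (intro exI[of _ "L1 + L2"] conjI allI impI)
    show "0 < L1 + L2" using L by simp
    fix s :: real assume s: "0 \<le> s"
    have hol: "(\<lambda>z. backflow s z 0) holomorphic_on ball 0 1" by (rule backflow_holomorphic) (use s in auto)
    have B: "norm (backflow s x 0) \<le> 1" if "x \<in> cball 0 R'" for x
      using backflow_in_disc[of 0 s x] that s RR by simp
    show "\<forall>z\<in>cball 0 R. norm (deriv (\<lambda>z. backflow s z 0) z) \<le> L1 + L2"
      using deriv_bound_disc[OF hol B RR(4,3)] L unfolding L1_def[symmetric] by force
    show "\<forall>z\<in>cball 0 R. \<forall>w\<in>cball 0 R. norm (backflow s z 0 - backflow s w 0) \<le> (L1 + L2) * norm (z - w) \<and>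
      norm (backflow s w 0 - backflow s z 0 - deriv (\<lambda>z. backflow s z 0) z * (w - z)) \<le> (L1 + L2) * norm (w - z)^2"
    proof (intro ballI conjI)
      fix z w :: complex assume zw: "z \<in> cball 0 R" "w \<in> cball 0 R"
      have "norm (backflow s z 0 - backflow s w 0) \<le> L1 * norm (z - w)"
        unfolding L1_def by (rule lipschitz_disc[OF hol B RR(4,3) zw])
      also have "\<dots> \<le> (L1 + L2) * norm (z - w)" using L by (intro mult_right_mono) auto
      finally show "norm (backflow s z 0 - backflow s w 0) \<le> (L1 + L2) * norm (z - w)" .
      have "norm (backflow s w 0 - backflow s z 0 - deriv (\<lambda>z. backflow s z 0) z * (w - z)) \<le> L2 * norm (w - z)^2"
        unfolding L2_def by (rule taylor_disc[OF hol B RR(1-3) zw])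
      also have "\<dots> \<le> (L1 + L2) * norm (w - z)^2" using L by (intro mult_right_mono) auto
      finally show "norm (backflow s w 0 - backflow s z 0 - deriv (\<lambda>z. backflow s z 0) z * (w - z)) \<le> (L1 + L2) * norm (w - z)^2" .
    qed
  qed
qed

text \<open>Since \<open>f_t(z) = f_s(backflow t z s)\<close>, the increment of the chain is that of \<open>f_s\<close> between \<open>z\<close> and a point
at distance at most \<open>primitive k t - primitive k s\<close> from \<open>z\<close>.\<close>

lemma chain_increment_bound:
  assumes F: "flow_majorant T r R V k kp"
    and L: "\<And>s z w. \<lbrakk>0 \<le> s; z \<in> cball 0 R; w \<in> cball 0 R\<rbrakk> \<Longrightarrow> norm (backflow s z 0 - backflow s w 0) \<le> L * norm (z - w)" "0 < L"
    and st: "0 \<le> s" "s \<le> t" "t \<le> T" and z: "z \<in> cball 0 r" and r: "r < 1"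
  shows "norm (backflow s z 0 - backflow t z 0) \<le> L * (primitive k t - primitive k s)"
proof -
  have zd: "z \<in> disc" using z r by simp
  have t: "0 \<le> t" using st by linarith
  have c: "backflow t z 0 = backflow s (backflow t z s) 0" using backflow_cocycle[OF order_refl st(1,2) zd] by simp
  have "backflow t z s \<in> ball 0 R" by (rule flow_majorantD(10)[OF F t st(3) z]) (use st in auto)
  then have "norm (backflow s z 0 - backflow t z 0) \<le> L * norm (z - backflow t z s)"
    unfolding c using z flow_majorantD(2)[OF F] by (intro L st(1)) auto
  also have "\<dots> = L * norm (backflow t z t - backflow t z s)" using backflow_end[OF t zd] by simp
  also have "\<dots> \<le> L * (primitive k t - primitive k s)"
    using flow_majorantD(12)[OF F st(1,2) order_refl st(3) z] L(2) by (intro mult_left_mono) auto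
  finally show ?thesis .
qed

text \<open>Adds Cauchy's estimates, up to second order and uniform in time, for the maps \<open>f_s\<close> on the disc that
contains the backward flow.\<close>

definition flow_estimates where
  "flow_estimates T r R V k kp L \<longleftrightarrow> flow_majorant T r R V k kp \<and> 0 < L \<and>
     (\<forall>s\<ge>0. \<forall>z\<in>cball 0 R. norm (deriv (\<lambda>z. backflow s z 0) z) \<le> L) \<and>
     (\<forall>s\<ge>0. \<forall>z\<in>cball 0 R. \<forall>w\<in>cball 0 R. norm (backflow s z 0 - backflow s w 0) \<le> L * norm (z - w)) \<and>
     (\<forall>s\<ge>0. \<forall>z\<in>cball 0 R. \<forall>w\<in>cball 0 R. norm (backflow s w 0 - backflow s z 0 - deriv (\<lambda>z. backflow s z 0) z * (w - z)) \<le> L * norm (w - z)^2) \<and>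
     (\<forall>s t z. 0 \<le> s \<longrightarrow> s \<le> t \<longrightarrow> t \<le> T \<longrightarrow> z \<in> cball 0 r \<longrightarrow> norm (backflow s z 0 - backflow t z 0) \<le> L * (primitive k t - primitive k s))"

lemma flow_estimatesD:
  assumes "flow_estimates T r R V k kp L"
  shows "flow_majorant T r R V k kp" "0 < L"
    "\<And>s z. \<lbrakk>0 \<le> s; z \<in> cball 0 R\<rbrakk> \<Longrightarrow> norm (deriv (\<lambda>z. backflow s z 0) z) \<le> L"
    "\<And>s z w. \<lbrakk>0 \<le> s; z \<in> cball 0 R; w \<in> cball 0 R\<rbrakk> \<Longrightarrow> norm (backflow s z 0 - backflow s w 0) \<le> L * norm (z - w)"
    "\<And>s z w. \<lbrakk>0 \<le> s; z \<in> cball 0 R; w \<in> cball 0 R\<rbrakk>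
       \<Longrightarrow> norm (backflow s w 0 - backflow s z 0 - deriv (\<lambda>z. backflow s z 0) z * (w - z)) \<le> L * norm (w - z)^2"
    "\<And>s t z. \<lbrakk>0 \<le> s; s \<le> t; t \<le> T; z \<in> cball 0 r\<rbrakk>
       \<Longrightarrow> norm (backflow s z 0 - backflow t z 0) \<le> L * (primitive k t - primitive k s)"
proof -
  note X = assms[unfolded flow_estimates_def]
  show "flow_majorant T r R V k kp" "0 < L"
    by (rule X[THEN conjunct1], rule X[THEN conjunct2, THEN conjunct1])
  show "norm (deriv (\<lambda>z. backflow s z 0) z) \<le> L" if "0 \<le> s" "z \<in> cball 0 R" for s z
    by (rule X[THEN conjunct2, THEN conjunct2, THEN conjunct1, rule_format, OF that])
  show "norm (backflow s z 0 - backflow s w 0) \<le> L * norm (z - w)" if "0 \<le> s" "z \<in> cball 0 R" "w \<in> cball 0 R" for s z w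
    by (rule X[THEN conjunct2, THEN conjunct2, THEN conjunct2, THEN conjunct1, rule_format, OF that])
  show "norm (backflow s w 0 - backflow s z 0 - deriv (\<lambda>z. backflow s z 0) z * (w - z)) \<le> L * norm (w - z)^2"
    if "0 \<le> s" "z \<in> cball 0 R" "w \<in> cball 0 R" for s z w
    by (rule X[THEN conjunct2, THEN conjunct2, THEN conjunct2, THEN conjunct2, THEN conjunct1, rule_format, OF that])
  show "norm (backflow s z 0 - backflow t z 0) \<le> L * (primitive k t - primitive k s)"
    if "0 \<le> s" "s \<le> t" "t \<le> T" "z \<in> cball 0 r" for s t z
    by (rule X[THEN conjunct2, THEN conjunct2, THEN conjunct2, THEN conjunct2, THEN conjunct2, rule_format, OF that])
qed

lemma flow_estimates_exist:
  assumes T: "0 < T" and r: "0 < r" "r < 1"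
  shows "\<exists>R V k kp L. flow_estimates T r R V k kp L"
proof -
  obtain R V k kp where F: "flow_majorant T r R V k kp" using flow_majorant_exists[OF T r] by blast
  obtain L where L: "0 < L" and bounds: "\<forall>s\<ge>0. (\<forall>z\<in>cball 0 R. norm (deriv (\<lambda>z. backflow s z 0) z) \<le> L) \<and>
    (\<forall>z\<in>cball 0 R. \<forall>w\<in>cball 0 R. norm (backflow s z 0 - backflow s w 0) \<le> L * norm (z - w) \<and>
      norm (backflow s w 0 - backflow s z 0 - deriv (\<lambda>z. backflow s z 0) z * (w - z)) \<le> L * norm (w - z)^2)"
    using transition_bounds[OF flow_majorantD(1,3)[OF F]] by blast
  have lip: "norm (backflow s z 0 - backflow s w 0) \<le> L * norm (z - w)" if "0 \<le> s" "z \<in> cball 0 R" "w \<in> cball 0 R" for s z w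
    using bounds that by blast
  have b1: "\<forall>s\<ge>0. \<forall>z\<in>cball 0 R. norm (deriv (\<lambda>z. backflow s z 0) z) \<le> L"
    and b2: "\<forall>s\<ge>0. \<forall>z\<in>cball 0 R. \<forall>w\<in>cball 0 R. norm (backflow s z 0 - backflow s w 0) \<le> L * norm (z - w)"
    and b3: "\<forall>s\<ge>0. \<forall>z\<in>cball 0 R. \<forall>w\<in>cball 0 R. norm (backflow s w 0 - backflow s z 0 - deriv (\<lambda>z. backflow s z 0) z * (w - z)) \<le> L * norm (w - z)^2"
    using bounds by simp_all
  have b4: "\<forall>s t z. 0 \<le> s \<longrightarrow> s \<le> t \<longrightarrow> t \<le> T \<longrightarrow> z \<in> cball 0 r \<longrightarrow> norm (backflow s z 0 - backflow t z 0) \<le> L * (primitive k t - primitive k s)"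
  proof (intro allI impI)
    fix s t :: real and z :: complex assume st: "0 \<le> s" "s \<le> t" "t \<le> T" "z \<in> cball 0 r"
    show "norm (backflow s z 0 - backflow t z 0) \<le> L * (primitive k t - primitive k s)"
    proof (rule chain_increment_bound[OF F])
      show "norm (backflow s z 0 - backflow s w 0) \<le> L * norm (z - w)" if "0 \<le> s" "z \<in> cball 0 R" "w \<in> cball 0 R" for s z w
        by (rule lip[OF that])
    qed (fact L st r(2))+
  qed
  show ?thesis
    unfolding flow_estimates_def
    by (intro exI[of _ R] exI[of _ V] exI[of _ k] exI[of _ kp] exI[of _ L] conjI F L b1 b2 b3 b4)
qed

lemma backflow_decreasing_loewner_chain: "decreasing_loewner_chain d (\<lambda>t z. backflow t z 0)"
  unfolding decreasing_loewner_chain_def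
proof (intro conjI allI impI ballI)
  fix t :: real assume t: "0 \<le> t"
  show "(\<lambda>z. backflow t z 0) holomorphic_on disc" by (rule backflow_holomorphic) (use t in auto)
  show "(\<lambda>z. backflow t z 0) ` disc \<subseteq> disc" using backflow_in_disc[OF order_refl t] by blast
  show "inj_on (\<lambda>z. backflow t z 0) disc"
    by (rule inj_onI, rule backflow_inj[OF t, of _ _ 0]) (use t in auto)
next
  fix z :: complex assume "z \<in> disc"
  then show "backflow 0 z 0 = z" by (intro backflow_end) auto
next
  fix s t :: real assume st: "0 \<le> s \<and> s \<le> t"
  show "(\<lambda>z. backflow t z 0) ` disc \<subseteq> (\<lambda>z. backflow s z 0) ` disc"
  proof (rule image_subsetI)
    fix z :: complex assume z: "z \<in> disc"
    have "backflow t z 0 = backflow s (backflow t z s) 0" using backflow_cocycle[of 0 s t z] st z by simp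
    moreover have "backflow t z s \<in> disc" using st z by (intro backflow_in_disc) auto
    ultimately show "backflow t z 0 \<in> (\<lambda>z. backflow s z 0) ` disc" by blast
  qed
next
  fix K :: "complex set" and T :: real assume KT: "compact K \<and> K \<subseteq> disc \<and> 0 < T"
  obtain r where r: "0 < r" "r < 1" "K \<subseteq> cball 0 r" using compact_in_disc_bound KT by blast
  have T: "0 < T" using KT by simp
  obtain R V k kp L where E: "flow_estimates T r R V k kp L"
    using flow_estimates_exist[OF T r(1,2)] by blast
  note F = flow_estimatesD(1)[OF E] and L = flow_estimatesD(2)[OF E] and der = flow_estimatesD(3)[OF E]
    and lip = flow_estimatesD(4)[OF E] and tay = flow_estimatesD(5)[OF E] and inc = flow_estimatesD(6)[OF E]
  interpret caratheodory_field V k by (rule flow_majorantD(5)[OF F])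
  have LINT: "L * (primitive k t - primitive k s) = (LINT \<xi>:{s..t}|lebesgue. L * kp \<xi>)" if st: "0 \<le> s" "s \<le> t" "t \<le> T" for s t
  proof -
    have "L * (primitive k t - primitive k s) = L * (LINT \<xi>:{s..t}|lebesgue. k \<xi>)"
      using primitive_diff(1)[OF k_integrable st(2)] by simp
    also have "\<dots> = (LINT \<xi>:{s..t}|lebesgue. L * k \<xi>)" by simp
    also have "\<dots> = (LINT \<xi>:{s..t}|lebesgue. L * kp \<xi>)"
    proof (rule set_lebesgue_integral_cong)
      have "k \<xi> = indicator {0..T} \<xi> *\<^sub>R kp \<xi>" for \<xi> using flow_majorantD(8)[OF F] by metis
      then show "\<forall>\<xi>. \<xi> \<in> {s..t} \<longrightarrow> L * k \<xi> = L * kp \<xi>" using st by simp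
    qed simp
    finally show ?thesis .
  qed
  show "\<exists>k. (\<forall>t\<in>{0..T}. 0 \<le> k t) \<and> Lp_on d {0..T} k \<and>
             (\<forall>z\<in>K. \<forall>s t. 0 \<le> s \<and> s \<le> t \<and> t \<le> T \<longrightarrow>
                norm (backflow s z 0 - backflow t z 0) \<le> (LINT \<xi>:{s..t}|lebesgue. k \<xi>))"
  proof (intro exI[of _ "\<lambda>t. L * kp t"] conjI ballI allI impI)
    show "0 \<le> L * kp t" if "t \<in> {0..T}" for t using flow_majorantD(7)[OF F that] L by simp
    show "Lp_on d {0..T} (\<lambda>t. L * kp t)" by (rule Lp_on_scale[OF flow_majorantD(6)[OF F]])
    fix z s t assume "z \<in> K" and st: "0 \<le> s \<and> s \<le> t \<and> t \<le> T"
    then have "z \<in> cball 0 r" using r(3) by blast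
    then have "norm (backflow s z 0 - backflow t z 0) \<le> L * (primitive k t - primitive k s)" using st by (intro inc) auto
    then show "norm (backflow s z 0 - backflow t z 0) \<le> (LINT \<xi>:{s..t}|lebesgue. L * kp \<xi>)" using LINT st by simp
  qed
qed

section \<open>The Loewner equation\<close>

text \<open>For \<open>s \<le> t\<close> expand \<open>f_t(z) = f_s(backflow t z s)\<close> to first order at \<open>z\<close>, and replace
\<open>z - backflow t z s\<close>, which is the integral of the field along the solution, by the integral of the field
frozen at \<open>z\<close>. For \<open>t < s\<close> exchange the roles of \<open>s\<close> and \<open>t\<close>; the derivatives of \<open>f_s\<close> and \<open>f_t\<close> at
\<open>z\<close> differ by a multiple of the increment of \<open>primitive k\<close>, by Cauchy's estimate for \<open>f_t - f_s\<close>.\<close>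

lemma chain_second_order:
  assumes T: "0 < T" and z: "z \<in> disc"
  shows "\<exists>V k C. caratheodory_field V k \<and> (AE t in lebesgue. t \<in> {0..T} \<longrightarrow> V z t = - G z t) \<and>
    (\<forall>s\<in>{0..T}. \<forall>t\<in>{0..T}. norm (backflow t z 0 - backflow s z 0 + deriv (\<lambda>z. backflow s z 0) z * (primitive (V z) t - primitive (V z) s))
        \<le> C * (primitive k t - primitive k s)^2)"
proof -
  obtain r where r: "0 < r" "r < 1" "z \<in> ball 0 r" using disc_radius[OF z] by blast
  define r' where "r' = (1 + r) / 2"
  have r': "0 < r'" "r' < 1" "r < r'" using r by (auto simp: r'_def)
  obtain R V k kp L where E: "flow_estimates T r' R V k kp L"
    using flow_estimates_exist[OF T r'(1,2)] by blast
  note F = flow_estimatesD(1)[OF E] and L = flow_estimatesD(2)[OF E] and der = flow_estimatesD(3)[OF E]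
    and lip = flow_estimatesD(4)[OF E] and tay = flow_estimatesD(5)[OF E] and inc = flow_estimatesD(6)[OF E]
  interpret caratheodory_field V k by (rule flow_majorantD(5)[OF F])
  let ?K = "primitive k" and ?P = "primitive (V z)"
  let ?f' = "\<lambda>s. deriv (\<lambda>z. backflow s z 0) z"
  have zr': "z \<in> cball 0 r'" and zR: "z \<in> cball 0 R" using r r' flow_majorantD(2)[OF F] by auto
  have Pb: "norm (?P t - ?P s) \<le> ?K t - ?K s" if "s \<le> t" for s t
    by (rule norm_primitive_diff_le[OF V_integrable k_integrable _ that]) (simp add: V_bound)
  have Kd: "0 \<le> ?K t - ?K s" if "s \<le> t" for s t
    using primitive_mono[OF k_integrable k_nonneg that] by simp
  have forward: "norm (backflow t z 0 - backflow s z 0 + ?f' s * (?P t - ?P s)) \<le> (L + L) * (?K t - ?K s)^2"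
    if st: "0 \<le> s" "s \<le> t" "t \<le> T" for s t
  proof -
    have t0: "0 \<le> t" using st by linarith
    let ?y = "backflow t z s"
    have yR: "?y \<in> cball 0 R"
      using flow_majorantD(10)[OF F t0 st(3) zr', of s] st by simp
    have zy: "norm (backflow t z \<tau> - z) \<le> ?K t - ?K s" if "\<tau> \<in> {s..t}" for \<tau>
    proof -
      have "norm (backflow t z t - backflow t z \<tau>) \<le> ?K t - ?K \<tau>"
        using that st by (intro flow_majorantD(12)[OF F _ _ _ _ zr']) auto
      also have "\<dots> \<le> ?K t - ?K s" using Kd[of s \<tau>] that by simp
      finally show ?thesis using backflow_end[OF t0 z] by (simp add: norm_minus_commute)
    qed
    have fro: "norm (z - ?y - (?P t - ?P s)) \<le> (?K t - ?K s) * (?K t - ?K s)"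
      using solution_increment_frozen[OF flow_majorantD(11)[OF F t0 st(3) zr'] st(1,2) order_refl zy]
      by (simp add: backflow_end[OF t0 z])
    have c: "backflow t z 0 = backflow s ?y 0" using backflow_cocycle[OF order_refl st(1,2) z] by simp
    have "backflow t z 0 - backflow s z 0 + ?f' s * (?P t - ?P s)
      = (backflow s ?y 0 - backflow s z 0 - ?f' s * (?y - z)) - ?f' s * (z - ?y - (?P t - ?P s))"
      unfolding c by (simp add: algebra_simps)
    then have "norm (backflow t z 0 - backflow s z 0 + ?f' s * (?P t - ?P s))
      \<le> norm (backflow s ?y 0 - backflow s z 0 - ?f' s * (?y - z)) + norm (?f' s * (z - ?y - (?P t - ?P s)))"
      by (simp only: norm_triangle_ineq4)
    also have "norm (backflow s ?y 0 - backflow s z 0 - ?f' s * (?y - z)) \<le> L * norm (?y - z)^2"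
      by (rule tay[OF st(1) zR yR])
    also have "L * norm (?y - z)^2 \<le> L * (?K t - ?K s)^2"
      using zy[of s] st L by (intro mult_left_mono power_mono) auto
    also have "norm (?f' s * (z - ?y - (?P t - ?P s))) \<le> L * (?K t - ?K s)^2"
      unfolding norm_mult power2_eq_square
      by (rule mult_mono[OF der[OF st(1) zR] fro]) (use L in auto)
    finally show ?thesis by (simp add: algebra_simps)
  qed
  define C1 where "C1 = L / (r' - r)"
  have C1: "0 < C1" using L r' by (simp add: C1_def)
  have dd: "norm (?f' t - ?f' s) \<le> C1 * (?K t - ?K s)" if st: "0 \<le> s" "s \<le> t" "t \<le> T" for s t
  proof -
    have t0: "0 \<le> t" using st by linarith
    have hs: "(\<lambda>z. backflow s z 0) holomorphic_on disc" "(\<lambda>z. backflow t z 0) holomorphic_on disc"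
      using st t0 by (auto intro: backflow_holomorphic)
    have "norm (deriv (\<lambda>z. backflow t z 0 - backflow s z 0) z) \<le> (L * (?K t - ?K s)) / (r' - r)"
    proof (rule deriv_bound_disc[OF _ _ r'(3,2)])
      show "(\<lambda>z. backflow t z 0 - backflow s z 0) holomorphic_on disc" by (intro holomorphic_on_diff hs)
      show "norm (backflow t x 0 - backflow s x 0) \<le> L * (?K t - ?K s)" if "x \<in> cball 0 r'" for x
        using inc[OF st that] by (simp only: norm_minus_commute)
    qed (use r in auto)
    moreover have "deriv (\<lambda>z. backflow t z 0 - backflow s z 0) z = ?f' t - ?f' s"
      by (rule deriv_diff) (use hs z in \<open>auto intro: holomorphic_on_imp_differentiable_at[OF _ open_ball]\<close>)
    ultimately show ?thesis by (simp add: C1_def)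
  qed
  define C where "C = L + L + C1"
  have main: "norm (backflow t z 0 - backflow s z 0 + ?f' s * (?P t - ?P s)) \<le> C * (?K t - ?K s)^2"
    if "s \<in> {0..T}" "t \<in> {0..T}" for s t
  proof (cases "s \<le> t")
    case True
    then have "norm (backflow t z 0 - backflow s z 0 + ?f' s * (?P t - ?P s)) \<le> (L + L) * (?K t - ?K s)^2"
      using that by (intro forward) auto
    also have "\<dots> \<le> C * (?K t - ?K s)^2" using C1 by (intro mult_right_mono) (auto simp: C_def)
    finally show ?thesis .
  next
    case False
    then have ts: "0 \<le> t" "t \<le> s" "s \<le> T" using that by auto
    have eq: "backflow t z 0 - backflow s z 0 + ?f' s * (?P t - ?P s)
      = - (backflow s z 0 - backflow t z 0 + ?f' t * (?P s - ?P t)) - (?f' s - ?f' t) * (?P s - ?P t)"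
      by (simp add: algebra_simps)
    have "norm (backflow t z 0 - backflow s z 0 + ?f' s * (?P t - ?P s))
      \<le> norm (- (backflow s z 0 - backflow t z 0 + ?f' t * (?P s - ?P t))) + norm ((?f' s - ?f' t) * (?P s - ?P t))"
      unfolding eq by (rule norm_triangle_ineq4)
    also have "\<dots> = norm (backflow s z 0 - backflow t z 0 + ?f' t * (?P s - ?P t)) + norm (?f' s - ?f' t) * norm (?P s - ?P t)"
      by (simp only: norm_minus_cancel norm_mult)
    also have "\<dots> \<le> (L + L) * (?K s - ?K t)^2 + (C1 * (?K s - ?K t)) * (?K s - ?K t)"
    proof (rule add_mono)
      show "norm (backflow s z 0 - backflow t z 0 + ?f' t * (?P s - ?P t)) \<le> (L + L) * (?K s - ?K t)^2" by (rule forward[OF ts])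
      show "norm (?f' s - ?f' t) * norm (?P s - ?P t) \<le> (C1 * (?K s - ?K t)) * (?K s - ?K t)"
      proof (rule mult_mono[OF dd[OF ts] Pb[OF ts(2)]])
        show "0 \<le> C1 * (?K s - ?K t)" using C1 Kd[OF ts(2)] by simp
      qed simp
    qed
    also have "\<dots> = C * (?K t - ?K s)^2" by (simp add: C_def power2_eq_square algebra_simps)
    finally show ?thesis .
  qed
  have "AE t in lebesgue. t \<in> {0..T} \<longrightarrow> (\<forall>z\<in>cball 0 R. V z t = - G z t \<and> norm (G z t) \<le> k t)"
    using flow_majorantD(4)[OF F] by (simp add: truncation_def)
  then have "AE t in lebesgue. t \<in> {0..T} \<longrightarrow> V z t = - G z t"
    by eventually_elim (use zR in blast)
  then show ?thesis using main caratheodory_field_axioms by blast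
qed

text \<open>At every time where both \<open>primitive k\<close> and \<open>primitive (V z)\<close> are differentiable, the second order estimate
determines the derivative of the chain.\<close>

lemma chain_derivative:
  assumes z: "z \<in> disc"
  shows "AE t in lebesgue_on {0..}. ((\<lambda>t. backflow t z 0) has_vector_derivative deriv (\<lambda>\<zeta>. backflow t \<zeta> 0) z * G z t) (at t within {0..})"
proof -
  have "AE t in lebesgue. 0 \<le> t \<and> t < real n + 1 \<longrightarrow>
      ((\<lambda>t. backflow t z 0) has_vector_derivative deriv (\<lambda>\<zeta>. backflow t \<zeta> 0) z * G z t) (at t within {0..})" for n :: nat
  proof -
    let ?T = "real n + 1"
    have "0 < ?T" by simp
    then obtain V k C where cf: "caratheodory_field V k" and VG: "AE t in lebesgue. t \<in> {0..?T} \<longrightarrow> V z t = - G z t"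
      and q: "\<forall>s\<in>{0..?T}. \<forall>t\<in>{0..?T}. norm (backflow t z 0 - backflow s z 0 + deriv (\<lambda>z. backflow s z 0) z * (primitive (V z) t - primitive (V z) s))
        \<le> C * (primitive k t - primitive k s)^2"
      using chain_second_order[OF _ z] by blast
    interpret caratheodory_field V k by (rule cf)
    show ?thesis
      using VG AE_primitive_has_vector_derivative[OF k_integrable] AE_primitive_has_vector_derivative[OF V_integrable[of z]]
    proof eventually_elim
      case (elim s)
      show ?case
      proof
        assume s: "0 \<le> s \<and> s < ?T"
        let ?c = "deriv (\<lambda>\<zeta>. backflow s \<zeta> 0) z"
        let ?h = "\<lambda>t. backflow t z 0 + ?c * primitive (V z) t"
        have "(?h has_vector_derivative 0) (at s within {0..})"
        proof (rule quadratic_bound_derivative_zero[OF elim(2), where C=C])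
          show "\<forall>\<^sub>F t in at s within {0..}. norm (?h t - ?h s) \<le> C * (primitive k t - primitive k s)^2"
            unfolding eventually_at
          proof (intro exI[of _ "?T - s"] conjI ballI impI)
            show "0 < ?T - s" using s by simp
            fix t assume "t \<in> {0..}" and "t \<noteq> s \<and> dist t s < ?T - s"
            then have t: "t \<in> {0..?T}" by (auto simp: dist_real_def)
            have "?h t - ?h s = backflow t z 0 - backflow s z 0 + ?c * (primitive (V z) t - primitive (V z) s)"
              by (simp add: algebra_simps)
            moreover have "norm (backflow t z 0 - backflow s z 0 + ?c * (primitive (V z) t - primitive (V z) s)) \<le> C * (primitive k t - primitive k s)^2"
              using q s t by (meson atLeastAtMost_iff less_imp_le)
            ultimately show "norm (?h t - ?h s) \<le> C * (primitive k t - primitive k s)^2" by (simp only:)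
          qed
        qed
        moreover have "((\<lambda>t. ?c * primitive (V z) t) has_vector_derivative ?c * V z s) (at s within {0..})"
          by (intro has_vector_derivative_mult_right has_vector_derivative_at_within[OF elim(3)])
        ultimately have "((\<lambda>t. ?h t - ?c * primitive (V z) t) has_vector_derivative 0 - ?c * V z s) (at s within {0..})"
          by (rule has_vector_derivative_diff)
        moreover have "V z s = - G z s" using elim(1) s by simp
        ultimately show "((\<lambda>t. backflow t z 0) has_vector_derivative ?c * G z s) (at s within {0..})" by simp
      qed
    qed
  qed
  then have "AE t in lebesgue. \<forall>n::nat. 0 \<le> t \<and> t < real n + 1 \<longrightarrow>
      ((\<lambda>t. backflow t z 0) has_vector_derivative deriv (\<lambda>\<zeta>. backflow t \<zeta> 0) z * G z t) (at t within {0..})"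
    by (simp only: AE_all_countable) blast
  then have "AE t in lebesgue. t \<in> {0..} \<longrightarrow>
      ((\<lambda>t. backflow t z 0) has_vector_derivative deriv (\<lambda>\<zeta>. backflow t \<zeta> 0) z * G z t) (at t within {0..})"
  proof eventually_elim
    case (elim t)
    obtain n :: nat where "t < real n" using reals_Archimedean2 by blast
    then have n: "t < real n + 1" by simp
    show ?case
    proof
      assume "t \<in> {0..}"
      then have "0 \<le> t \<and> t < real n + 1" using n by simp
      then show "((\<lambda>t. backflow t z 0) has_vector_derivative deriv (\<lambda>\<zeta>. backflow t \<zeta> 0) z * G z t) (at t within {0..})"
        using elim by blast
    qed
  qed
  then show ?thesis by (subst AE_restrict_space_iff) auto
qed

lemma chain_loc_abs_continuous:
  assumes z: "z \<in> disc"
  shows "loc_abs_continuous_on {0..} (\<lambda>t. backflow t z 0)"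
  unfolding loc_abs_continuous_on_def
proof (intro allI impI)
  fix a b :: real assume "a \<le> b \<and> {a..b} \<subseteq> {0..}"
  then have ab: "0 \<le> a" "a \<le> b" by auto
  obtain r where r: "0 < r" "r < 1" "z \<in> ball 0 r" using disc_radius[OF z] by blast
  have T: "0 < b + 1" using ab by simp
  obtain R V k kp L where E: "flow_estimates (b + 1) r R V k kp L"
    using flow_estimates_exist[OF T r(1,2)] by blast
  note F = flow_estimatesD(1)[OF E] and L = flow_estimatesD(2)[OF E] and der = flow_estimatesD(3)[OF E]
    and lip = flow_estimatesD(4)[OF E] and tay = flow_estimatesD(5)[OF E] and inc = flow_estimatesD(6)[OF E]
  interpret caratheodory_field V k by (rule flow_majorantD(5)[OF F])
  show "abs_continuous_on a b (\<lambda>t. backflow t z 0)"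
  proof (rule abs_continuous_on_combine[OF abs_continuous_on_of_real_primitive[OF k_integrable k_nonneg]
        abs_continuous_on_of_real_primitive[OF k_integrable k_nonneg], where C=L])
    fix s t assume st: "a \<le> s" "s \<le> t" "t \<le> b"
    have "dist (backflow s z 0) (backflow t z 0) \<le> L * (primitive k t - primitive k s)"
      unfolding dist_norm by (rule inc) (use st ab r in auto)
    also have "\<dots> \<le> L * (2 * dist (complex_of_real (primitive k s)) (of_real (primitive k t)))"
      using L primitive_mono[OF k_integrable k_nonneg st(2)]
      by (intro mult_left_mono) (auto simp: dist_norm norm_minus_commute simp flip: of_real_diff)
    finally show "dist (backflow s z 0) (backflow t z 0) \<le> L * (dist (complex_of_real (primitive k s)) (of_real (primitive k t))
        + dist (complex_of_real (primitive k s)) (of_real (primitive k t)))" by simp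
  qed
qed

lemma chain_continuous: "continuous_on (disc \<times> {0..}) (\<lambda>(z, t). backflow t z 0)"
  unfolding continuous_on_def
proof
  fix p :: "complex \<times> real" assume pin: "p \<in> disc \<times> {0..}"
  from pin obtain z0 t0 where p: "p = (z0, t0)" "z0 \<in> disc" "0 \<le> t0" by auto
  obtain r where r: "0 < r" "r < 1" "z0 \<in> ball 0 r" using disc_radius[OF p(2)] by blast
  have T: "0 < t0 + 1" using p by simp
  obtain R V k kp L where E: "flow_estimates (t0 + 1) r R V k kp L"
    using flow_estimates_exist[OF T r(1,2)] by blast
  note F = flow_estimatesD(1)[OF E] and L = flow_estimatesD(2)[OF E] and der = flow_estimatesD(3)[OF E]
    and lip = flow_estimatesD(4)[OF E] and tay = flow_estimatesD(5)[OF E] and inc = flow_estimatesD(6)[OF E]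
  interpret caratheodory_field V k by (rule flow_majorantD(5)[OF F])
  let ?K = "primitive k"
  have inc': "norm (backflow t z0 0 - backflow t0 z0 0) \<le> L * \<bar>?K t - ?K t0\<bar>" if "0 \<le> t" "t \<le> t0 + 1" for t
  proof (cases "t \<le> t0")
    case True
    then have "norm (backflow t z0 0 - backflow t0 z0 0) \<le> L * (?K t0 - ?K t)" using that r by (intro inc) auto
    also have "\<dots> \<le> L * \<bar>?K t - ?K t0\<bar>" using L by (intro mult_left_mono) auto
    finally show ?thesis .
  next
    case False
    then have "norm (backflow t0 z0 0 - backflow t z0 0) \<le> L * (?K t - ?K t0)" using that r p by (intro inc) auto
    also have "\<dots> \<le> L * \<bar>?K t - ?K t0\<bar>" using L by (intro mult_left_mono) auto
    finally show ?thesis by (simp add: norm_minus_commute)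
  qed
  have "((\<lambda>q. (case q of (z, t) \<Rightarrow> backflow t z 0)) \<longlongrightarrow> backflow t0 z0 0) (at p within disc \<times> {0..})"
  proof (rule LIM_zero_cancel, rule Lim_null_comparison)
    have "open (ball 0 r \<times> {..<t0 + 1} :: (complex \<times> real) set)" by (intro open_Times) auto
    moreover have "p \<in> ball 0 r \<times> {..<t0 + 1}" using p r by auto
    ultimately have "\<forall>\<^sub>F q in at p within disc \<times> {0..}. q \<in> ball 0 r \<times> {..<t0 + 1}"
      by (simp add: eventually_at_topological) blast
    moreover have "\<forall>\<^sub>F q in at p within disc \<times> {0..}. q \<in> disc \<times> {0..}"
      by (simp add: eventually_at_filter)
    ultimately show "\<forall>\<^sub>F q in at p within disc \<times> {0..}. norm ((case q of (z, t) \<Rightarrow> backflow t z 0) - backflow t0 z0 0)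
        \<le> L * norm (fst q - z0) + L * \<bar>?K (snd q) - ?K t0\<bar>"
    proof eventually_elim
      case (elim q)
      obtain z t where q: "q = (z, t)" by force
      have z: "z \<in> cball 0 R" "z0 \<in> cball 0 R" using elim q r flow_majorantD(2)[OF F] by auto
      have t: "0 \<le> t" "t \<le> t0 + 1" using elim q by auto
      have "norm (backflow t z 0 - backflow t0 z0 0) \<le> norm (backflow t z 0 - backflow t z0 0) + norm (backflow t z0 0 - backflow t0 z0 0)"
        by (rule order_trans[OF _ norm_triangle_ineq]) simp
      also have "\<dots> \<le> L * norm (z - z0) + L * \<bar>?K t - ?K t0\<bar>"
        by (intro add_mono lip t(1) z inc'[OF t])
      finally show ?case using q by simp
    qed
    have "continuous_on UNIV (\<lambda>q::complex \<times> real. L * norm (fst q - z0) + L * \<bar>?K (snd q) - ?K t0\<bar>)"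
      by (intro continuous_intros continuous_on_compose2[OF continuous_on_primitive[OF k_integrable k_nonneg, of UNIV] continuous_on_snd[OF continuous_on_id]]) auto
    then have "((\<lambda>q. L * norm (fst q - z0) + L * \<bar>?K (snd q) - ?K t0\<bar>) \<longlongrightarrow> L * norm (fst p - z0) + L * \<bar>?K (snd p) - ?K t0\<bar>) (at p within disc \<times> {0..})"
      using pin unfolding continuous_on_def[of UNIV] by (blast intro: tendsto_within_subset[OF _ subset_UNIV])
    then show "((\<lambda>q. L * norm (fst q - z0) + L * \<bar>?K (snd q) - ?K t0\<bar>) \<longlongrightarrow> 0) (at p within disc \<times> {0..})"
      using p(1) by simp
  qed
  then show "((\<lambda>(z, t). backflow t z 0) \<longlongrightarrow> (case p of (z, t) \<Rightarrow> backflow t z 0)) (at p within disc \<times> {0..})" using p(1) by simp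
qed

lemma backflow_loewner_pde_solution: "loewner_pde_solution G {0..} (\<lambda>z t. backflow t z 0)"
  unfolding loewner_pde_solution_def
proof (intro conjI ballI)
  show "is_interval {0::real..}" by (rule is_interval_ci)
  show "(\<lambda>z. backflow t z 0) holomorphic_on disc" if "t \<in> {0..}" for t using that by (intro backflow_holomorphic) auto
qed (use chain_continuous chain_loc_abs_continuous chain_derivative in auto)

text \<open>Let \<open>w\<close> be the backward solution with \<open>w t0 = z\<close>. The increment of \<open>F (w s) s\<close> splits into the increment
in the first argument, expanded by Taylor's formula, and the increment in the second argument, given by
the differential equation. With the field frozen at \<open>w s\<close> and the \<open>z\<close>-derivative of \<open>F\<close> frozen at \<open>(w s, t)\<close>,
the first-order terms cancel, and all errors are quadratic in the increment of \<open>primitive k\<close>.\<close>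

lemma loewner_pde_solution_unique:
  assumes F: "loewner_pde_solution G {0..} F" and F0: "\<And>z. z \<in> disc \<Longrightarrow> F z 0 = z"
    and z: "z \<in> disc" and t0: "0 \<le> t0"
  shows "F z t0 = backflow t0 z 0"
proof -
  define w where "w = backflow t0 z"
  have w: "caratheodory_solution mG 0 t0 w" "w ` {0..t0} \<subseteq> disc" "w t0 = z"
    using backward_solutionD(1,2,4)[OF backflow_solution[OF t0 z]] by (simp_all add: w_def)
  have "compact (w ` {0..t0})"
    by (intro compact_continuous_image caratheodory_solution_continuous_on[OF w(1)] compact_Icc)
  then obtain R where R: "0 < R" "R < 1" "w ` {0..t0} \<subseteq> cball 0 R"
    using compact_in_disc_bound[OF _ w(2)] by blast
  \<comment> \<open>Nested discs between the range of \<open>w\<close> and the unit circle: each Cauchy estimate below loses one radius.\<close>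
  define R1 where "R1 = R + (1 - R) / 4"
  define R2 where "R2 = R + (1 - R) / 2"
  define R3 where "R3 = R + 3 * (1 - R) / 4"
  have RR: "R < R1" "R1 < R2" "R2 < R3" "R3 < 1" using R by (auto simp: R1_def R2_def R3_def field_simps)
  have R3: "0 < R3" using R RR by linarith
  have T: "0 < t0 + 1" using t0 by simp
  obtain V k and kp :: "real \<Rightarrow> real" where V: "truncation (t0 + 1) R3 V k" by (rule truncation_exists[OF R3 RR(4) T])
  interpret caratheodory_field V k using V by (simp add: truncation_def)
  let ?K = "primitive k"
  have Kd: "0 \<le> ?K t - ?K s" if "s \<le> t" for s t
    using primitive_mono[OF k_integrable k_nonneg that] by simp
  have wR: "w s \<in> cball 0 R" if "s \<in> {0..t0}" for s using R(3) that by blast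
  have wV: "caratheodory_solution V 0 t0 w"
  proof (rule truncation_solution_iff[THEN iffD2, OF V order_refl _ _ w(1)])
    show "w t \<in> cball 0 R3" if "t \<in> {0..t0}" for t using wR[OF that] RR by simp
  qed simp
  have hol: "(\<lambda>y. F y \<xi>) holomorphic_on ball 0 1" if "0 \<le> \<xi>" for \<xi>
    using F that by (simp add: loewner_pde_solution_def)
  have "continuous_on (cball 0 R3 \<times> {0..t0}) (\<lambda>(y, \<xi>). F y \<xi>)"
  proof (rule continuous_on_subset)
    show "continuous_on (disc \<times> {0..}) (\<lambda>(y, \<xi>). F y \<xi>)"
      using F by (simp add: loewner_pde_solution_def)
    show "cball 0 R3 \<times> {0..t0} \<subseteq> disc \<times> {0..}" using RR by auto
  qed
  then have "compact ((\<lambda>(y, \<xi>). F y \<xi>) ` (cball 0 R3 \<times> {0..t0}))"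
    by (intro compact_continuous_image compact_Times compact_cball compact_Icc)
  from bounded_pos[THEN iffD1, OF compact_imp_bounded[OF this]]
  obtain M where M: "0 < M" and MF': "\<forall>x\<in>(\<lambda>(y, \<xi>). F y \<xi>) ` (cball 0 R3 \<times> {0..t0}). norm x \<le> M" by blast
  have MF: "norm (F y \<xi>) \<le> M" if "y \<in> cball 0 R3" "\<xi> \<in> {0..t0}" for y \<xi>
  proof -
    have "(\<lambda>(y, \<xi>). F y \<xi>) (y, \<xi>) \<in> (\<lambda>(y, \<xi>). F y \<xi>) ` (cball 0 R3 \<times> {0..t0})"
      using that by (intro imageI) simp
    then show ?thesis using MF' by auto
  qed
  define F' where "F' y \<xi> = deriv (\<lambda>\<zeta>. F \<zeta> \<xi>) y" for y \<xi>
  define M1 where "M1 = M / (R3 - R2)"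
  define M2 where "M2 = M1 / (R2 - R1)"
  define M3 where "M3 = M / (R3 - R1) / (R1 - R)"
  have Mpos: "0 < M1" "0 < M2" "0 < M3" using M RR by (auto simp: M1_def M2_def M3_def)
  have F'1: "norm (F' y \<xi>) \<le> M1" if y: "y \<in> cball 0 R2" and \<xi>: "\<xi> \<in> {0..t0}" for y \<xi>
    unfolding F'_def M1_def
  proof (rule deriv_bound_disc[OF _ _ RR(3,4) y])
    show "(\<lambda>\<zeta>. F \<zeta> \<xi>) holomorphic_on disc" using hol \<xi> by simp
    show "norm (F x \<xi>) \<le> M" if "x \<in> cball 0 R3" for x by (rule MF[OF that \<xi>])
  qed
  have aeF: "AE x in lebesgue. 0 \<le> x \<longrightarrow> (F y has_vector_derivative F' y x * G y x) (at x within {0..})"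
    if "y \<in> disc" for y
  proof -
    have "AE x in lebesgue_on {0..}. (F y has_vector_derivative deriv (\<lambda>\<zeta>. F \<zeta> x) y * G y x) (at x within {0..})"
      using F that unfolding loewner_pde_solution_def by blast
    then show ?thesis unfolding F'_def by (subst (asm) AE_restrict_space_iff) auto
  qed
  have aeV: "AE x in lebesgue. x \<in> {0..t0 + 1} \<longrightarrow> (\<forall>z\<in>cball 0 R3. V z x = - G z x \<and> norm (G z x) \<le> k x)"
    using V by (simp add: truncation_def)
  have ACF: "abs_continuous_on s t (F y)" if "y \<in> disc" "0 \<le> s" "s \<le> t" for y s t
  proof -
    have "loc_abs_continuous_on {0..} (F y)" using F that(1) by (simp add: loewner_pde_solution_def)
    moreover have "{s..t} \<subseteq> {0..}" using that by auto
    ultimately show ?thesis using that(3) unfolding loc_abs_continuous_on_def by blast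
  qed
  have F2: "norm (F y t - F y s) \<le> M1 * (?K t - ?K s)"
    if y: "y \<in> cball 0 R2" and st: "0 \<le> s" "s \<le> t" "t \<le> t0" for y s t
  proof -
    have yd: "y \<in> disc" and y3: "y \<in> cball 0 R3" using y RR by auto
    show ?thesis
    proof (rule abs_continuous_on_derivative_bound[OF st(2) ACF[OF yd st(1,2)] k_integrable k_nonneg])
      show "AE x in lebesgue. x \<in> {s..t} \<longrightarrow> (\<exists>D. (F y has_vector_derivative D) (at x within {s..t}) \<and> norm D \<le> M1 * k x)"
        using aeF[OF yd] aeV
      proof eventually_elim
        case (elim x)
        show ?case
        proof
          assume x: "x \<in> {s..t}"
          then have x0: "0 \<le> x" "x \<in> {0..t0}" "x \<in> {0..t0 + 1}" using st by auto
          have "(F y has_vector_derivative F' y x * G y x) (at x within {s..t})"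
            by (rule has_vector_derivative_within_subset[OF elim(1)[rule_format, OF x0(1)]]) (use st in auto)
          moreover have "norm (F' y x * G y x) \<le> M1 * k x"
            unfolding norm_mult by (rule mult_mono[OF F'1[OF y x0(2)]]) (use elim(2) x0 y3 Mpos in auto)
          ultimately show "\<exists>D. (F y has_vector_derivative D) (at x within {s..t}) \<and> norm D \<le> M1 * k x" by blast
        qed
      qed
    qed
  qed
  have F3: "norm (F' y \<xi> - F' y t) \<le> M2 * (?K t - ?K \<xi>)"
    if y: "y \<in> cball 0 R1" and st: "0 \<le> \<xi>" "\<xi> \<le> t" "t \<le> t0" for y \<xi> t
  proof -
    have t: "0 \<le> t" using st by linarith
    have "norm (deriv (\<lambda>\<zeta>. F \<zeta> \<xi> - F \<zeta> t) y) \<le> (M1 * (?K t - ?K \<xi>)) / (R2 - R1)"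
    proof (rule deriv_bound_disc[OF _ _ RR(2) _ y])
      show "(\<lambda>\<zeta>. F \<zeta> \<xi> - F \<zeta> t) holomorphic_on disc" by (intro holomorphic_on_diff hol st t)
      show "norm (F x \<xi> - F x t) \<le> M1 * (?K t - ?K \<xi>)" if "x \<in> cball 0 R2" for x
        using F2[OF that st] by (simp only: norm_minus_commute)
    qed (use RR in simp)
    moreover have "deriv (\<lambda>\<zeta>. F \<zeta> \<xi> - F \<zeta> t) y = F' y \<xi> - F' y t"
    proof -
      have "y \<in> disc" using y RR by simp
      then have "(\<lambda>\<zeta>. F \<zeta> \<tau>) field_differentiable (at y)" if "0 \<le> \<tau>" for \<tau>
        by (rule holomorphic_on_imp_differentiable_at[OF hol[OF that] open_ball])
      then show ?thesis unfolding F'_def using st(1) t by (intro deriv_diff)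
    qed
    ultimately show ?thesis by (simp add: M2_def)
  qed
  have F4: "norm (F y t - F y s + F' y t * (primitive (V y) t - primitive (V y) s)) \<le> M2 * (?K t - ?K s)^2"
    if y: "y \<in> cball 0 R1" and st: "0 \<le> s" "s \<le> t" "t \<le> t0" for y s t
  proof -
    have yd: "y \<in> disc" and y3: "y \<in> cball 0 R3" using y RR by auto
    let ?c = "F' y t" and ?P = "primitive (V y)"
    have ACP: "abs_continuous_on s t (\<lambda>x. F y x + ?c * ?P x)"
      by (intro abs_continuous_on_add abs_continuous_on_mult abs_continuous_on_const ACF[OF yd st(1,2)]
          abs_continuous_on_primitive V_integrable)
    have "norm ((F y t + ?c * ?P t) - (F y s + ?c * ?P s)) \<le> (M2 * (?K t - ?K s)) * (?K t - ?K s)"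
    proof (rule abs_continuous_on_derivative_bound[OF st(2) ACP k_integrable k_nonneg])
      show "AE x in lebesgue. x \<in> {s..t} \<longrightarrow> (\<exists>D. ((\<lambda>x. F y x + ?c * ?P x) has_vector_derivative D) (at x within {s..t}) \<and> norm D \<le> (M2 * (?K t - ?K s)) * k x)"
        using aeF[OF yd] aeV AE_primitive_has_vector_derivative[OF V_integrable[of y]]
      proof eventually_elim
        case (elim x)
        show ?case
        proof
          assume x: "x \<in> {s..t}"
          then have x0: "0 \<le> x" "x \<in> {0..t0 + 1}" "x \<le> t" "s \<le> x" using st by auto
          have dF: "(F y has_vector_derivative F' y x * G y x) (at x within {s..t})"
            by (rule has_vector_derivative_within_subset[OF elim(1)[rule_format, OF x0(1)]]) (use st in auto)
          have "((\<lambda>x. F y x + ?c * ?P x) has_vector_derivative F' y x * G y x + ?c * V y x) (at x within {s..t})"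
            by (intro has_vector_derivative_add dF has_vector_derivative_mult_right has_vector_derivative_at_within[OF elim(3)])
          moreover have "norm (F' y x * G y x + ?c * V y x) \<le> (M2 * (?K t - ?K s)) * k x"
          proof -
            have VG: "V y x = - G y x" "norm (G y x) \<le> k x" using elim(2) x0(2) y3 by auto
            have "norm (F' y x * G y x + ?c * V y x) = norm (F' y x - ?c) * norm (G y x)"
              unfolding VG norm_mult[symmetric] by (simp add: algebra_simps)
            also have "\<dots> \<le> (M2 * (?K t - ?K s)) * k x"
            proof (rule mult_mono[OF _ VG(2)])
              have "norm (F' y x - ?c) \<le> M2 * (?K t - ?K x)" by (rule F3[OF y x0(1,3) st(3)])
              also have "\<dots> \<le> M2 * (?K t - ?K s)" using Kd[OF x0(4)] Mpos by (intro mult_left_mono) auto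
              finally show "norm (F' y x - ?c) \<le> M2 * (?K t - ?K s)" .
              show "0 \<le> M2 * (?K t - ?K s)" using Kd[OF st(2)] Mpos by simp
            qed simp
            finally show ?thesis .
          qed
          ultimately show "\<exists>D. ((\<lambda>x. F y x + ?c * ?P x) has_vector_derivative D) (at x within {s..t}) \<and> norm D \<le> (M2 * (?K t - ?K s)) * k x"
            by blast
        qed
      qed
    qed
    moreover have "(F y t + ?c * ?P t) - (F y s + ?c * ?P s) = F y t - F y s + ?c * (?P t - ?P s)"
      by (simp add: algebra_simps)
    ultimately show ?thesis by (simp only: power2_eq_square mult.assoc)
  qed
  let ?h = "\<lambda>s. F (w s) s"
  have "?h 0 = ?h t0"
  proof (rule quadratic_bound_imp_constant[OF t0 k_integrable k_nonneg, where C="M3 + M1 + M2"])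
    show "0 \<le> M3 + M1 + M2" using Mpos by simp
    fix s t assume st: "0 \<le> s" "s \<le> t" "t \<le> t0"
    let ?D = "?K t - ?K s"
    let ?y = "w s" and ?P = "primitive (V (w s))"
    have ws: "w s \<in> cball 0 R" "w t \<in> cball 0 R" using wR[of s] wR[of t] st by auto
    have y1: "?y \<in> cball 0 R1" and y2: "?y \<in> cball 0 R2" using ws RR by auto
    have inc: "norm (w \<tau> - w s) \<le> ?D" if "\<tau> \<in> {s..t}" for \<tau>
    proof -
      have "norm (w \<tau> - w s) \<le> ?K \<tau> - ?K s"
        by (rule solution_increment_bound[OF wV]) (use that st in auto)
      also have "\<dots> \<le> ?D" using Kd[of \<tau> t] that by simp
      finally show ?thesis .
    qed
    have fro: "norm (w t - w s - (?P t - ?P s)) \<le> ?D * ?D"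
      by (rule solution_increment_frozen[OF wV st inc])
    have tay: "norm (F (w t) t - F (w s) t - F' (w s) t * (w t - w s)) \<le> M3 * ?D^2"
    proof -
      have t1: "0 \<le> t" "t \<in> {0..t0}" using st by auto
      have "norm (F (w t) t - F (w s) t - F' (w s) t * (w t - w s)) \<le> M3 * norm (w t - w s)^2"
        unfolding F'_def M3_def
      proof (rule taylor_disc[OF hol[OF t1(1)] _ RR(1) _ RR(4) ws])
        show "norm (F x t) \<le> M" if "x \<in> cball 0 R3" for x by (rule MF[OF that t1(2)])
      qed (use RR in simp)
      also have "\<dots> \<le> M3 * ?D^2" using inc[of t] st Mpos by (intro mult_left_mono power_mono) auto
      finally show ?thesis .
    qed
    have "?h t - ?h s = (F (w t) t - F (w s) t - F' (w s) t * (w t - w s)) + F' (w s) t * (w t - w s - (?P t - ?P s))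
       + (F (w s) t - F (w s) s + F' (w s) t * (?P t - ?P s))"
      by (simp add: algebra_simps)
    then have "norm (?h t - ?h s) \<le> norm (F (w t) t - F (w s) t - F' (w s) t * (w t - w s))
       + norm (F' (w s) t * (w t - w s - (?P t - ?P s))) + norm (F (w s) t - F (w s) s + F' (w s) t * (?P t - ?P s))"
      by (simp only: norm_triangle_le[OF add_right_mono[OF norm_triangle_ineq]])
    also have "\<dots> \<le> M3 * ?D^2 + M1 * ?D^2 + M2 * ?D^2"
    proof (intro add_mono tay F4[OF y1 st])
      show "norm (F' (w s) t * (w t - w s - (?P t - ?P s))) \<le> M1 * ?D^2"
        unfolding norm_mult power2_eq_square
        by (rule mult_mono[OF F'1[OF y2] fro]) (use st Mpos in auto)
    qed
    finally show "norm (?h t - ?h s) \<le> (M3 + M1 + M2) * ?D^2" by (simp only: distrib_right)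
  qed
  moreover have "w 0 \<in> disc" using wR[of 0] t0 R(2) by auto
  then have "?h 0 = w 0" by (rule F0)
  ultimately show ?thesis using w(3) by (simp add: w_def)
qed

end

section \<open>Trajectories and the range of the chain\<close>

lemma is_interval_sets_lebesgue:
  fixes S :: "real set"
  assumes "is_interval S"
  shows "S \<in> sets lebesgue"
proof -
  obtain a b where "S = {} \<or> S = UNIV \<or> S = {..<b} \<or> S = {..b} \<or> S = {a<..} \<or> S = {a..} \<or>
    S = {a<..<b} \<or> S = {a<..b} \<or> S = {a..<b} \<or> S = {a..b}"
    using is_real_interval[OF assms] by blast
  then show ?thesis by (elim disjE) auto
qed

lemma decreasing_loewner_chain_cong:
  assumes eq: "\<And>t z. 0 \<le> t \<Longrightarrow> z \<in> disc \<Longrightarrow> f t z = g t z" and g: "decreasing_loewner_chain d g"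
  shows "decreasing_loewner_chain d f"
  unfolding decreasing_loewner_chain_def
proof (intro conjI allI impI ballI)
  fix t :: real assume t: "0 \<le> t"
  have gt: "g t holomorphic_on disc" "g t ` disc \<subseteq> disc" "inj_on (g t) disc"
    using g t by (simp_all add: decreasing_loewner_chain_def)
  show "f t holomorphic_on disc" using gt(1) eq[OF t] by (subst holomorphic_cong[OF refl]) auto
  show "f t ` disc \<subseteq> disc" using gt(2) eq[OF t] by (subst image_cong[OF refl]) auto
  show "inj_on (f t) disc" using gt(3) eq[OF t] by (subst inj_on_cong) auto
next
  fix z :: complex assume "z \<in> disc"
  then show "f 0 z = z" using g eq[of 0 z] by (simp add: decreasing_loewner_chain_def)
next
  fix s t :: real assume st: "0 \<le> s \<and> s \<le> t"
  then have "f t ` disc = g t ` disc" "f s ` disc = g s ` disc" using eq by (auto intro!: image_cong)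
  moreover have "g t ` disc \<subseteq> g s ` disc" using g st unfolding decreasing_loewner_chain_def by blast
  ultimately show "f t ` disc \<subseteq> f s ` disc" by simp
next
  fix K :: "complex set" and T :: real assume KT: "compact K \<and> K \<subseteq> disc \<and> 0 < T"
  from g[unfolded decreasing_loewner_chain_def, THEN conjunct2, THEN conjunct2, THEN conjunct2, THEN spec, THEN spec, THEN mp, OF this]
  obtain k where k: "\<forall>t\<in>{0..T}. 0 \<le> k t" "Lp_on d {0..T} k"
     "\<forall>z\<in>K. \<forall>s t. 0 \<le> s \<and> s \<le> t \<and> t \<le> T \<longrightarrow> norm (g s z - g t z) \<le> (LINT \<xi>:{s..t}|lebesgue. k \<xi>)"
    by (elim exE conjE)
  have "norm (f s z - f t z) \<le> (LINT \<xi>:{s..t}|lebesgue. k \<xi>)" if "z \<in> K" "0 \<le> s \<and> s \<le> t \<and> t \<le> T" for z s t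
  proof -
    have "z \<in> disc" using KT that(1) by blast
    then have "f s z = g s z" "f t z = g t z" using that(2) eq by auto
    then show ?thesis using k(3) that by simp
  qed
  then show "\<exists>k. (\<forall>t\<in>{0..T}. 0 \<le> k t) \<and> Lp_on d {0..T} k \<and>
             (\<forall>z\<in>K. \<forall>s t. 0 \<le> s \<and> s \<le> t \<and> t \<le> T \<longrightarrow>
                norm (f s z - f t z) \<le> (LINT \<xi>:{s..t}|lebesgue. k \<xi>))"
    using k(1,2) by (intro exI[of _ k]) simp
qed

lemma loewner_pde_solution_cong:
  assumes eq: "\<And>t z. t \<in> E \<Longrightarrow> z \<in> disc \<Longrightarrow> F z t = H z t" and H: "loewner_pde_solution G E H"
  shows "loewner_pde_solution G E F"
  unfolding loewner_pde_solution_def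
proof (intro conjI ballI)
  show E: "is_interval E" "E \<subseteq> {0..}" using H by (simp_all add: loewner_pde_solution_def)
  have "continuous_on (disc \<times> E) (\<lambda>(z, t). H z t)" using H by (simp add: loewner_pde_solution_def)
  then show "continuous_on (disc \<times> E) (\<lambda>(z, t). F z t)"
    by (subst continuous_on_cong[OF refl]) (use eq in auto)
  have hol: "(\<lambda>z. H z t) holomorphic_on disc" if "t \<in> E" for t using H that by (simp add: loewner_pde_solution_def)
  show holF: "(\<lambda>z. F z t) holomorphic_on disc" if "t \<in> E" for t
    using hol[OF that] eq[OF that] by (subst holomorphic_cong[OF refl]) auto
  fix z :: complex assume z: "z \<in> disc"
  have "loc_abs_continuous_on E (H z)" using H z by (simp add: loewner_pde_solution_def)
  then show "loc_abs_continuous_on E (F z)"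
    unfolding loc_abs_continuous_on_def
  proof (intro allI impI)
    fix a b assume A: "\<forall>a b. a \<le> b \<and> {a..b} \<subseteq> E \<longrightarrow> abs_continuous_on a b (H z)" and ab: "a \<le> b \<and> {a..b} \<subseteq> E"
    then have AC: "abs_continuous_on a b (H z)" by blast
    show "abs_continuous_on a b (F z)"
    proof (rule abs_continuous_on_combine[OF AC AC, where C=1])
      fix s t assume "a \<le> s" "s \<le> t" "t \<le> b"
      then have "s \<in> E" "t \<in> E" using ab by auto
      then show "dist (F z s) (F z t) \<le> 1 * (dist (H z s) (H z t) + dist (H z s) (H z t))"
        using eq z by simp
    qed
  qed
  have Em: "E \<inter> space lebesgue \<in> sets lebesgue" using is_interval_sets_lebesgue[OF E(1)] by simp
  have "AE t in lebesgue_on E. (H z has_vector_derivative deriv (\<lambda>\<zeta>. H \<zeta> t) z * G z t) (at t within E)"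
    using H z by (simp add: loewner_pde_solution_def)
  then have "AE t in lebesgue. t \<in> E \<longrightarrow> (H z has_vector_derivative deriv (\<lambda>\<zeta>. H \<zeta> t) z * G z t) (at t within E)"
    unfolding AE_restrict_space_iff[OF Em] .
  then have "AE t in lebesgue. t \<in> E \<longrightarrow> (F z has_vector_derivative deriv (\<lambda>\<zeta>. F \<zeta> t) z * G z t) (at t within E)"
  proof eventually_elim
    case (elim t)
    show ?case
    proof
      assume t: "t \<in> E"
      have "deriv (\<lambda>\<zeta>. F \<zeta> t) z = deriv (\<lambda>\<zeta>. H \<zeta> t) z"
        by (rule complex_derivative_transform_within_open[OF holF[OF t] hol[OF t] open_ball z]) (rule eq[OF t])
      then show "(F z has_vector_derivative deriv (\<lambda>\<zeta>. F \<zeta> t) z * G z t) (at t within E)"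
        using has_vector_derivative_transform[OF t _ elim[rule_format, OF t], of "F z"] eq z by simp
    qed
  qed
  then show "AE t in lebesgue_on E. (F z has_vector_derivative deriv (\<lambda>\<zeta>. F \<zeta> t) z * G z t) (at t within E)"
    unfolding AE_restrict_space_iff[OF Em] .
qed

context herglotz_field
begin

definition chain_range :: "real \<Rightarrow> complex set" where
  "chain_range t = (\<lambda>\<zeta>. backflow t \<zeta> 0) ` disc"

text \<open>The maximal solution: it is defined at \<open>t\<close> exactly if \<open>z\<close> is in the range of \<open>f_t\<close>, with the preimage of \<open>z\<close>
as its value.\<close>

definition flow_line :: "complex \<Rightarrow> real \<rightharpoonup> complex" where
  "flow_line z t = (if 0 \<le> t \<and> z \<in> chain_range t then Some (inv_into disc (\<lambda>\<zeta>. backflow t \<zeta> 0) z) else None)"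

lemma backflow_inj_on: "0 \<le> t \<Longrightarrow> inj_on (\<lambda>\<zeta>. backflow t \<zeta> 0) disc"
  by (rule inj_onI, rule backflow_inj[of t _ _ 0]) auto

lemma flow_line_eq_Some_iff: "flow_line z t = Some \<zeta> \<longleftrightarrow> 0 \<le> t \<and> \<zeta> \<in> disc \<and> backflow t \<zeta> 0 = z"
proof
  assume A: "flow_line z t = Some \<zeta>"
  then have t: "0 \<le> t" "z \<in> chain_range t" "inv_into disc (\<lambda>\<zeta>. backflow t \<zeta> 0) z = \<zeta>"
    by (auto simp: flow_line_def split: if_splits)
  then show "0 \<le> t \<and> \<zeta> \<in> disc \<and> backflow t \<zeta> 0 = z"
    using inv_into_into[of z "\<lambda>\<zeta>. backflow t \<zeta> 0" disc] f_inv_into_f[of z "\<lambda>\<zeta>. backflow t \<zeta> 0" disc]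
    unfolding chain_range_def by blast
next
  assume A: "0 \<le> t \<and> \<zeta> \<in> disc \<and> backflow t \<zeta> 0 = z"
  then have "z \<in> chain_range t" by (auto simp: chain_range_def)
  moreover have "inv_into disc (\<lambda>\<zeta>. backflow t \<zeta> 0) z = \<zeta>"
    using A backflow_inj_on[of t] by (intro inv_into_f_eq) auto
  ultimately show "flow_line z t = Some \<zeta>" using A by (simp add: flow_line_def)
qed

lemma flow_line_before:
  assumes "flow_line z t = Some \<zeta>" and s: "0 \<le> s" "s \<le> t"
  shows "flow_line z s = Some (backflow t \<zeta> s)"
proof -
  have A: "0 \<le> t" "\<zeta> \<in> disc" "backflow t \<zeta> 0 = z" using assms(1) by (auto simp: flow_line_eq_Some_iff)
  have "backflow s (backflow t \<zeta> s) 0 = z" using backflow_cocycle[OF order_refl s A(2)] A(3) by simp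
  moreover have "backflow t \<zeta> s \<in> disc" by (rule backflow_in_disc[OF s A(2)])
  ultimately show ?thesis using s by (simp add: flow_line_eq_Some_iff)
qed

lemma dom_flow_line_nonneg: "t \<in> dom (flow_line z) \<Longrightarrow> 0 \<le> t"
  by (auto simp: flow_line_eq_Some_iff)

lemma dom_flow_line_down: "\<lbrakk>t \<in> dom (flow_line z); 0 \<le> s; s \<le> t\<rbrakk> \<Longrightarrow> s \<in> dom (flow_line z)"
  using flow_line_before by (auto simp: domIff)

lemma dom_flow_line_right_open:
  assumes "t \<in> dom (flow_line z)"
  shows "\<exists>t'>t. t' \<in> dom (flow_line z)"
proof -
  obtain \<zeta> where \<zeta>: "flow_line z t = Some \<zeta>" using assms by auto
  then have A: "0 \<le> t" "\<zeta> \<in> disc" "backflow t \<zeta> 0 = z" by (auto simp: flow_line_eq_Some_iff)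
  obtain t' \<zeta>' where t': "t < t'" "\<zeta>' \<in> disc" "backflow t' \<zeta>' 0 = z"
    using forward_extension[OF A(1,2)] A(3) by blast
  then have "flow_line z t' = Some \<zeta>'" using A(1) by (simp add: flow_line_eq_Some_iff)
  then show ?thesis using t'(1) by blast
qed

lemma flow_line_0: "z \<in> disc \<Longrightarrow> flow_line z 0 = Some z"
  by (simp add: flow_line_eq_Some_iff backflow_end)

text \<open>Up to any time \<open>q\<close> in its domain the trajectory coincides with one backward solution. Since the domain
is open to the right, countably many rational \<open>q\<close> suffice for the differential equation to hold at almost
every time.\<close>

lemma flow_line_ivp_solution:
  assumes z: "z \<in> disc"
  shows "ivp_solution mG z (flow_line z)"
  unfolding ivp_solution_def
proof (intro conjI)
  let ?D = "dom (flow_line z)"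
  show int: "is_interval ?D"
    unfolding is_interval_1
  proof (intro ballI allI impI)
    fix a b x assume "a \<in> ?D" "b \<in> ?D" "a \<le> x \<and> x \<le> b"
    then show "x \<in> ?D" using dom_flow_line_nonneg[of a z] by (intro dom_flow_line_down[of b z x]) auto
  qed
  show "?D \<subseteq> {0..}" using dom_flow_line_nonneg by auto
  show "ran (flow_line z) \<subseteq> disc" by (auto simp: ran_def flow_line_eq_Some_iff)
  show "flow_line z 0 = Some z" by (rule flow_line_0[OF z])
  show "loc_abs_continuous_on ?D (\<lambda>t. the (flow_line z t))"
    unfolding loc_abs_continuous_on_def
  proof (intro allI impI)
    fix a b assume ab: "a \<le> b \<and> {a..b} \<subseteq> ?D"
    then have "a \<in> ?D" "b \<in> ?D" by (meson atLeastAtMost_iff order_refl subsetD)+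
    then have a: "0 \<le> a" and "b \<in> ?D" using dom_flow_line_nonneg[of a z] by blast+
    then obtain \<zeta> where \<zeta>: "flow_line z b = Some \<zeta>" by auto
    then have A: "0 \<le> b" "\<zeta> \<in> disc" by (auto simp: flow_line_eq_Some_iff)
    have "abs_continuous_on 0 b (backflow b \<zeta>)"
      using backward_solutionD(1)[OF backflow_solution[OF A]] by (simp add: caratheodory_solution_def)
    then have AC: "abs_continuous_on a b (backflow b \<zeta>)" using a by (rule abs_continuous_on_subinterval) simp
    show "abs_continuous_on a b (\<lambda>t. the (flow_line z t))"
    proof (rule abs_continuous_on_combine[OF AC AC, where C=1])
      fix s t assume "a \<le> s" "s \<le> t" "t \<le> b"
      then have "flow_line z s = Some (backflow b \<zeta> s)" "flow_line z t = Some (backflow b \<zeta> t)" using a by (auto intro!: flow_line_before[OF \<zeta>])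
      then show "dist (the (flow_line z s)) (the (flow_line z t)) \<le> 1 * (dist (backflow b \<zeta> s) (backflow b \<zeta> t) + dist (backflow b \<zeta> s) (backflow b \<zeta> t))"
        by simp
    qed
  qed
  have one: "AE t in lebesgue. q \<in> ?D \<longrightarrow> 0 \<le> t \<and> t < q \<longrightarrow>
      ((\<lambda>s. the (flow_line z s)) has_vector_derivative - G (the (flow_line z t)) t) (at t within ?D)" for q
  proof (cases "q \<in> ?D")
    case True
    then obtain \<zeta> where \<zeta>: "flow_line z q = Some \<zeta>" by auto
    then have A: "0 \<le> q" "\<zeta> \<in> disc" by (auto simp: flow_line_eq_Some_iff)
    have eq: "the (flow_line z s) = backflow q \<zeta> s" if "s \<in> {0..q}" for s using flow_line_before[OF \<zeta>, of s] that by simp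
    have "AE t in lebesgue. t \<in> {0..q} \<longrightarrow> (backflow q \<zeta> has_vector_derivative - G (backflow q \<zeta> t) t) (at t within {0..q})"
      using backward_solutionD(1)[OF backflow_solution[OF A]] by (simp add: caratheodory_solution_def)
    then show ?thesis
    proof eventually_elim
      case (elim t)
      show ?case
      proof (intro impI)
        assume t: "0 \<le> t \<and> t < q"
        then have tq: "t \<in> {0..q}" by simp
        have "((\<lambda>s. the (flow_line z s)) has_vector_derivative - G (backflow q \<zeta> t) t) (at t within {0..q})"
          by (rule has_vector_derivative_transform[OF tq eq elim[rule_format, OF tq]])
        moreover have "at t within {0..q} = at t within ?D"
        proof (rule at_within_nhd[of t "{..<q}"])
          have "x \<in> {0..q} \<longleftrightarrow> x \<in> ?D" if "x < q" for x
          proof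
            assume "x \<in> {0..q}"
            then show "x \<in> ?D" by (intro dom_flow_line_down[OF True]) auto
          next
            assume "x \<in> ?D"
            then have "0 \<le> x" by (rule dom_flow_line_nonneg)
            then show "x \<in> {0..q}" using that by simp
          qed
          then show "{0..q} \<inter> {..<q} - {t} = ?D \<inter> {..<q} - {t}"
            by (auto simp only: Int_iff Diff_iff lessThan_iff)
        qed (use t in auto)
        ultimately show "((\<lambda>s. the (flow_line z s)) has_vector_derivative - G (the (flow_line z t)) t) (at t within ?D)"
          using eq[OF tq] by simp
      qed
    qed
  qed simp
  have "AE t in lebesgue. \<forall>q\<in>\<rat>. q \<in> ?D \<longrightarrow> 0 \<le> t \<and> t < q \<longrightarrow>
      ((\<lambda>s. the (flow_line z s)) has_vector_derivative - G (the (flow_line z t)) t) (at t within ?D)"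
    by (rule AE_ball_countable'[OF _ countable_rat]) (rule one)
  then have "AE t in lebesgue. t \<in> ?D \<longrightarrow>
      ((\<lambda>s. the (flow_line z s)) has_vector_derivative - G (the (flow_line z t)) t) (at t within ?D)"
  proof eventually_elim
    case (elim t)
    show ?case
    proof
      assume t: "t \<in> ?D"
      obtain t' where t': "t < t'" "t' \<in> ?D" using dom_flow_line_right_open[OF t] by blast
      obtain q where q: "q \<in> \<rat>" "t < q" "q < t'" using Rats_dense_in_real[OF t'(1)] by blast
      have t0: "0 \<le> t" by (rule dom_flow_line_nonneg[OF t])
      have "q \<in> ?D" by (rule dom_flow_line_down[OF t'(2)]) (use t0 q in auto)
      then show "((\<lambda>s. the (flow_line z s)) has_vector_derivative - G (the (flow_line z t)) t) (at t within ?D)"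
        using elim q t0 by blast
    qed
  qed
  then show "AE t in lebesgue_on ?D. ((\<lambda>s. the (flow_line z s)) has_vector_derivative - G (the (flow_line z t)) t) (at t within ?D)"
    using is_interval_sets_lebesgue[OF int] by (subst AE_restrict_space_iff) auto
qed

text \<open>Restricted to \<open>{0..t}\<close>, a solution is the backward solution that starts from its own value at \<open>t\<close>.\<close>

lemma ivp_solution_le_flow_line:
  assumes w: "ivp_solution mG z w"
  shows "w \<subseteq>\<^sub>m flow_line z"
  unfolding map_le_def
proof
  let ?D = "dom w"
  have int: "is_interval ?D" and sub: "?D \<subseteq> {0..}" and ran: "ran w \<subseteq> disc" and w0: "w 0 = Some z"
    and AC: "loc_abs_continuous_on ?D (\<lambda>t. the (w t))"
    and ae: "AE t in lebesgue_on ?D. ((\<lambda>s. the (w s)) has_vector_derivative - G (the (w t)) t) (at t within ?D)"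
    using w by (simp_all add: ivp_solution_def)
  fix t assume tD: "t \<in> ?D"
  then have t: "0 \<le> t" using sub by auto
  have "0 \<in> ?D" using w0 by auto
  then have seg: "{0..t} \<subseteq> ?D"
    using int tD unfolding is_interval_1 by (meson atLeastAtMost_iff subsetI)
  let ?w = "\<lambda>s. the (w s)"
  have disc: "?w s \<in> disc" if "s \<in> ?D" for s using that ran by (auto simp: ran_def)
  have "caratheodory_solution mG 0 t ?w"
    unfolding caratheodory_solution_def
  proof
    show "abs_continuous_on 0 t ?w" using AC seg t unfolding loc_abs_continuous_on_def by blast
    have "AE t in lebesgue. t \<in> ?D \<longrightarrow> (?w has_vector_derivative - G (?w t) t) (at t within ?D)"
      using ae is_interval_sets_lebesgue[OF int] by (subst (asm) AE_restrict_space_iff) auto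
    then show "AE x in lebesgue. x \<in> {0..t} \<longrightarrow> (?w has_vector_derivative - G (?w x) x) (at x within {0..t})"
    proof eventually_elim
      case (elim x)
      show ?case
      proof
        assume "x \<in> {0..t}"
        then have "x \<in> ?D" using seg by blast
        then show "(?w has_vector_derivative - G (?w x) x) (at x within {0..t})"
          by (rule has_vector_derivative_within_subset[OF elim[rule_format] seg])
      qed
    qed
  qed
  moreover have "?w ` {0..t} \<subseteq> disc" using seg disc by blast
  ultimately have bs: "backward_solution t (?w t) ?w" by (simp add: backward_solution_def)
  have wd: "?w t \<in> disc" by (rule disc[OF tD])
  have "backflow t (?w t) 0 = ?w 0"
    by (rule backward_solution_unique[OF backflow_solution[OF t wd] bs]) (use t in simp)
  then have "backflow t (?w t) 0 = z" using w0 by simp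
  then have "flow_line z t = Some (?w t)" using t wd by (simp add: flow_line_eq_Some_iff)
  moreover have "w t = Some (?w t)" using tD by auto
  ultimately show "w t = flow_line z t" by simp
qed

text \<open>Every solution is a restriction of the trajectory. As the domain of the trajectory has the form \<open>[0,T)\<close>,
the trajectory itself is an extension of the kind excluded by maximality.\<close>

lemma maximal_ivp_solution_iff:
  assumes z: "z \<in> disc"
  shows "maximal_ivp_solution mG z w \<longleftrightarrow> w = flow_line z"
proof
  assume "w = flow_line z"
  moreover have "\<not> (dom (flow_line z) \<subset> dom w')" if "ivp_solution mG z w'" for w'
    using ivp_solution_le_flow_line[OF that] map_le_implies_dom_le by blast
  ultimately show "maximal_ivp_solution mG z w"
    using flow_line_ivp_solution[OF z] unfolding maximal_ivp_solution_def by blast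
next
  assume w: "maximal_ivp_solution mG z w"
  then have sol: "ivp_solution mG z w" by (simp add: maximal_ivp_solution_def)
  then have le: "w \<subseteq>\<^sub>m flow_line z" by (rule ivp_solution_le_flow_line)
  let ?D = "dom (flow_line z)"
  define T where "T = (SUP t\<in>?D. ereal t)"
  have Dt: "?D = {t. 0 \<le> t \<and> ereal t < T}"
  proof (intro equalityI subsetI)
    fix t assume t: "t \<in> ?D"
    obtain t' where t': "t < t'" "t' \<in> ?D" using dom_flow_line_right_open[OF t] by blast
    have "ereal t < ereal t'" using t' by simp
    also have "\<dots> \<le> T" unfolding T_def using t'(2) by (rule SUP_upper)
    finally show "t \<in> {t. 0 \<le> t \<and> ereal t < T}" using dom_flow_line_nonneg[OF t] by simp
  next
    fix t assume "t \<in> {t. 0 \<le> t \<and> ereal t < T}"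
    then have t: "0 \<le> t" "ereal t < T" by auto
    then obtain x where "x \<in> ?D" "ereal t < ereal x" unfolding T_def less_SUP_iff by blast
    then show "t \<in> ?D" using t by (intro dom_flow_line_down[of x z t]) auto
  qed
  have "0 \<in> ?D" using flow_line_0[OF z] by auto
  then have T0: "0 < T" using Dt by (auto simp: zero_ereal_def)
  have "\<not> dom w \<subset> ?D"
    using w T0 Dt flow_line_ivp_solution[OF z] le unfolding maximal_ivp_solution_def by blast
  then have "dom w = ?D" using map_le_implies_dom_le[OF le] by blast
  then show "w = flow_line z" using le by (metis map_le_antisym map_le_def)
qed

lemma trajectory_eq: "z \<in> disc \<Longrightarrow> trajectory G z = flow_line z"
  unfolding trajectory_def by (rule the_equality) (simp_all add: maximal_ivp_solution_iff)

lemma Omega_eq: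
  assumes t: "0 \<le> t"
  shows "Omega G t = chain_range t"
proof -
  have "z \<in> chain_range t \<Longrightarrow> z \<in> disc" for z using backflow_in_disc[OF order_refl t] by (auto simp: chain_range_def)
  then show ?thesis using t by (auto simp: Omega_def trajectory_eq flow_line_def split: if_splits)
qed

lemma flow_map_bw:
  assumes t: "0 \<le> t" and \<zeta>: "\<zeta> \<in> disc"
  shows "flow_map G t (backflow t \<zeta> 0) = \<zeta>"
proof -
  have "backflow t \<zeta> 0 \<in> disc" by (rule backflow_in_disc[OF order_refl t \<zeta>])
  moreover have "flow_line (backflow t \<zeta> 0) t = Some \<zeta>" using t \<zeta> by (simp add: flow_line_eq_Some_iff)
  ultimately show ?thesis by (simp add: flow_map_def trajectory_eq)
qed

lemma flow_map_bij:
  assumes t: "0 \<le> t"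
  shows "bij_betw (flow_map G t) (Omega G t) disc"
  unfolding Omega_eq[OF t] chain_range_def
proof (rule bij_betw_byWitness[where f'="\<lambda>\<zeta>. backflow t \<zeta> 0"])
  show "\<forall>a\<in>(\<lambda>\<zeta>. backflow t \<zeta> 0) ` disc. backflow t (flow_map G t a) 0 = a" using flow_map_bw[OF t] by simp
  show "\<forall>\<zeta>\<in>disc. flow_map G t (backflow t \<zeta> 0) = \<zeta>" using flow_map_bw[OF t] by blast
  show "flow_map G t ` (\<lambda>\<zeta>. backflow t \<zeta> 0) ` disc \<subseteq> disc"
  proof (intro image_subsetI, elim imageE)
    fix z \<zeta> :: complex assume "z = backflow t \<zeta> 0" "\<zeta> \<in> disc"
    then show "flow_map G t z \<in> disc" using flow_map_bw[OF t] by simp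
  qed
qed simp

lemma inverse_flow_eq:
  assumes t: "0 \<le> t" and \<zeta>: "\<zeta> \<in> disc"
  shows "inverse_flow G t \<zeta> = backflow t \<zeta> 0"
  unfolding inverse_flow_def
proof (rule inv_into_f_eq)
  show "inj_on (flow_map G t) (Omega G t)" using flow_map_bij[OF t] by (rule bij_betw_imp_inj_on)
  show "backflow t \<zeta> 0 \<in> Omega G t" using \<zeta> by (simp add: Omega_eq[OF t] chain_range_def)
  show "flow_map G t (backflow t \<zeta> 0) = \<zeta>" by (rule flow_map_bw[OF t \<zeta>])
qed

lemma Omega_properties:
  assumes t: "0 \<le> t"
  shows "open (Omega G t)" "connected (Omega G t)" "Omega G t \<noteq> {}" "simply_connected (Omega G t)"
    "flow_map G t holomorphic_on Omega G t"
proof -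
  let ?f = "\<lambda>\<zeta>. backflow t \<zeta> 0"
  have hol: "?f holomorphic_on disc" by (rule backflow_holomorphic) (use t in auto)
  have inj: "inj_on ?f disc" by (rule backflow_inj_on[OF t])
  have \<Omega>: "Omega G t = ?f ` disc" by (simp add: Omega_eq[OF t] chain_range_def)
  show "open (Omega G t)" unfolding \<Omega> by (rule open_mapping_thm3[OF hol open_ball inj])
  show "connected (Omega G t)" unfolding \<Omega>
    by (intro connected_continuous_image holomorphic_on_imp_continuous_on[OF hol] connected_ball)
  show "Omega G t \<noteq> {}" unfolding \<Omega> by simp
  obtain g where g: "g holomorphic_on (?f ` disc)" "\<And>z. z \<in> disc \<Longrightarrow> g (?f z) = z"
    by (rule holomorphic_has_inverse[OF hol open_ball inj]) blast
  have "homeomorphism disc (?f ` disc) ?f g"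
  proof (rule homeomorphismI)
    show "continuous_on disc ?f" "continuous_on (?f ` disc) g"
      by (rule holomorphic_on_imp_continuous_on[OF hol], rule holomorphic_on_imp_continuous_on[OF g(1)])
    show "g ` ?f ` disc \<subseteq> disc" using g(2) by (intro image_subsetI) force
    show "g (?f x) = x" if "x \<in> disc" for x by (rule g(2)[OF that])
    show "?f (g y) = y" if "y \<in> ?f ` disc" for y using that g(2) by force
  qed simp
  then have "disc homeomorphic (?f ` disc)" unfolding homeomorphic_def by blast
  moreover have "simply_connected disc" by (rule convex_imp_simply_connected[OF convex_ball])
  ultimately show "simply_connected (Omega G t)" unfolding \<Omega>
    using homeomorphic_simply_connected_eq by blast
  show "flow_map G t holomorphic_on Omega G t"
    unfolding \<Omega> by (rule holomorphic_transform[OF g(1)]) (use g(2) flow_map_bw[OF t] in auto)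
qed

end

theorem theorem1p11:
  fixes d :: ereal and G :: "complex \<Rightarrow> real \<Rightarrow> complex"
  assumes "1 \<le> d" and "herglotz_vector_field d G"
  shows "(\<forall>z\<in>disc. \<exists>!w. maximal_ivp_solution (\<lambda>\<zeta> t. - G \<zeta> t) z w) \<and>
    (\<forall>t\<ge>0. open (Omega G t) \<and> connected (Omega G t) \<and> Omega G t \<noteq> {} \<and>
       simply_connected (Omega G t) \<and>
       flow_map G t holomorphic_on Omega G t \<and>
       bij_betw (flow_map G t) (Omega G t) disc) \<and>
    decreasing_loewner_chain d (inverse_flow G) \<and>
    loewner_pde_solution G {0..} (\<lambda>z t. inverse_flow G t z) \<and>
    (\<forall>z\<in>disc. inverse_flow G 0 z = z) \<and>
    (\<forall>F. loewner_pde_solution G {0..} F \<and> (\<forall>z\<in>disc. F z 0 = z) \<longrightarrow>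
       (\<forall>z\<in>disc. \<forall>t\<ge>0. F z t = inverse_flow G t z))"
proof -
  interpret herglotz_field d G using assms by unfold_locales
  show ?thesis
  proof (intro conjI ballI allI impI)
    fix z :: complex assume z: "z \<in> disc"
    show "\<exists>!w. maximal_ivp_solution (\<lambda>\<zeta> t. - G \<zeta> t) z w" unfolding maximal_ivp_solution_iff[OF z] by blast
    show "inverse_flow G 0 z = z" using inverse_flow_eq[OF order_refl z] backflow_end[OF order_refl z] by simp
  next
    show "decreasing_loewner_chain d (inverse_flow G)"
      by (rule decreasing_loewner_chain_cong[OF inverse_flow_eq backflow_decreasing_loewner_chain])
    show "loewner_pde_solution G {0..} (\<lambda>z t. inverse_flow G t z)"
      by (rule loewner_pde_solution_cong[OF _ backflow_loewner_pde_solution]) (simp add: inverse_flow_eq)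
  next
    fix F z and t :: real
    assume F: "loewner_pde_solution G {0..} F \<and> (\<forall>z\<in>disc. F z 0 = z)" and z: "z \<in> disc" and t: "0 \<le> t"
    then have "F z t = backflow t z 0" by (intro loewner_pde_solution_unique) auto
    then show "F z t = inverse_flow G t z" using inverse_flow_eq[OF t z] by simp
  qed (use Omega_properties flow_map_bij in auto)
qed

end
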